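(* Let $\mathcal P$ be a finite set, let $\sigma$ be the left shift on $\mathcal P^{\mathbb Z}$, and let $\mu$ be an ergodic $\sigma$-invariant Borel probability measure on $\mathcal P^{\mathbb Z}$ such that the process $(\mathcal P^{\mathbb Z},\mu,\sigma)$ has positive entropy. For $x\in\mathcal P^{\mathbb Z}$ and $n\in\mathbb N$ let $F_{x,n}=F_B$, where $B$ is the cylinder of the block $x[0,n)$ and $F_B$ is the distribution function of the normalized hitting time of $B$. (1) Let $(n_k)$ be a strictly increasing sequence of natural numbers and let $A\subset\mathcal P^{\mathbb Z}$ be a measurable set with $\mu(A)>0$ such that for every $x\in A$ the functions $F_{x,n_k}$ converge pointwise on $[0,\infty)$, as $k\to\infty$, to some function $F_x$. Then for $\mu$-almost every $x\in A$ we have $F_x(t)\le 1-e^{-t}$ for every $t\ge0$. (2) If $(n_k)$ grows sufficiently fast, then there is a set of full measure $\mu$ such that for every $x$ in this set $\limsup_{k\to\infty}F_{x,n_k}(t)\le 1-e^{-t}$ for every $t\ge0$. That is: there exists a sequence $(m_k)$ of natural numbers such that this conclusion holds for every strictly increasing sequence $(n_k)$ of natural numbers with $n_k\ge m_k$ for all $k$.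
   Context: The cylinder of the block $x[0,n)$ is $\{y\in\mathcal P^{\mathbb Z}:y[0,n)=x[0,n)\}$; for $\mu$-almost every $x$ it has positive measure for all $n$. For a set $B$ with $\mu(B)>0$, the hitting time is $V_B(y)=\min\{i>0:\sigma^i(y)\in B\}$, defined for $\mu$-almost every $y\in\mathcal P^{\mathbb Z}$; the normalized hitting time is $\overline V_B=\mu(B)V_B$; and $F_B(t)=\mu\{\overline V_B\le t\}$. *)

theory Defs
  imports "HOL-Probability.Probability"
begin

text \<open>
  A finite alphabet is a type \<open>'p\<close> of class \<open>finite\<close>; the full shift space over it is
  \<open>int \<Rightarrow> 'p\<close>, with the Borel sets of the product of the discrete topologies.
\<close>

definition shift_borel :: "(int \<Rightarrow> 'p::finite) measure" where
  "shift_borel = sigma UNIV {U. openin (product_topology (\<lambda>_. discrete_topology UNIV) UNIV) U}"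

definition left_shift :: "(int \<Rightarrow> 'p) \<Rightarrow> (int \<Rightarrow> 'p)" where
  "left_shift x = (\<lambda>i. x (i + 1))"

definition measure_preserving_map :: "'a measure \<Rightarrow> ('a \<Rightarrow> 'a) \<Rightarrow> bool" where
  "measure_preserving_map M T \<longleftrightarrow> T \<in> M \<rightarrow>\<^sub>M M \<and> distr M M T = M"

definition ergodic_map :: "'a measure \<Rightarrow> ('a \<Rightarrow> 'a) \<Rightarrow> bool" where
  "ergodic_map M T \<longleftrightarrow> measure_preserving_map M T \<and>
     (\<forall>A\<in>sets M. T -` A \<inter> space M = A \<longrightarrow> emeasure M A = 0 \<or> emeasure M (space M - A) = 0)"

text \<open>\<open>block x n\<close> is the block \<open>x[0,n)\<close>.\<close>

definition block :: "(int \<Rightarrow> 'p) \<Rightarrow> nat \<Rightarrow> 'p list" where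
  "block x n = map (\<lambda>i. x (int i)) [0..<n]"

definition cylinder :: "(int \<Rightarrow> 'p) \<Rightarrow> nat \<Rightarrow> (int \<Rightarrow> 'p) set" where
  "cylinder x n = {y. block y n = block x n}"

text \<open>
  The entropy of the process is the limit of the normalized Shannon entropies (in bits) of
  the blocks of length \<open>n\<close>; the limit exists for shift-invariant measures by subadditivity.
\<close>

definition block_entropy :: "(int \<Rightarrow> 'p) measure \<Rightarrow> nat \<Rightarrow> real" where
  "block_entropy M n =
     prob_space.entropy M 2 (count_space (range (\<lambda>x. block x n))) (\<lambda>x. block x n)"

definition process_entropy :: "(int \<Rightarrow> 'p) measure \<Rightarrow> real" where
  "process_entropy M = lim (\<lambda>n. block_entropy M n / real n)"

text \<open>
  The hitting time is \<open>\<infinity>\<close> at points whose forward orbit never enters \<open>B\<close>; these form a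
  null set if \<open>M\<close> is ergodic and \<open>B\<close> has positive measure. If \<open>B\<close> is a null set, then
  the normalized hitting time is constantly 0 (also where the hitting time is infinite).
\<close>

definition hitting_time :: "(int \<Rightarrow> 'p) set \<Rightarrow> (int \<Rightarrow> 'p) \<Rightarrow> enat" where
  "hitting_time B y = (INF i \<in> {i. 0 < i \<and> (left_shift ^^ i) y \<in> B}. enat i)"

definition norm_hitting_time ::
  "(int \<Rightarrow> 'p) measure \<Rightarrow> (int \<Rightarrow> 'p) set \<Rightarrow> (int \<Rightarrow> 'p) \<Rightarrow> ereal" where
  "norm_hitting_time M B y = ereal (measure M B) * ereal_of_enat (hitting_time B y)"

definition hitting_cdf :: "(int \<Rightarrow> 'p) measure \<Rightarrow> (int \<Rightarrow> 'p) set \<Rightarrow> real \<Rightarrow> real" where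
  "hitting_cdf M B t = measure M {y \<in> space M. norm_hitting_time M B y \<le> ereal t}"

definition cylinder_cdf :: "(int \<Rightarrow> 'p) measure \<Rightarrow> (int \<Rightarrow> 'p) \<Rightarrow> nat \<Rightarrow> real \<Rightarrow> real" where
  "cylinder_cdf M x n = hitting_cdf M (cylinder x n)"


lemma space_shift_borel [simp]: "space shift_borel = UNIV"
  by (simp add: shift_borel_def)

lemma sets_shift_borel_open:
  "openin (product_topology (\<lambda>_. discrete_topology UNIV) UNIV) U \<Longrightarrow> U \<in> sets shift_borel"
  by (auto simp: shift_borel_def)

lemma sets_shift_borel_PiM:
  "sets (shift_borel :: (int \<Rightarrow> 'p::finite) measure) = sets (Pi\<^sub>M UNIV (\<lambda>_. count_space UNIV))"
    (is "?L = sets ?N")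
proof
  have coord: "openin (product_topology (\<lambda>_. discrete_topology UNIV) UNIV)
      {y :: int \<Rightarrow> 'p. y i \<in> A}" for i A
    using openin_continuous_map_preimage
      [OF continuous_map_product_projection[of i UNIV "\<lambda>_. discrete_topology UNIV"], of A]
    by simp
  have "sets (Pi\<^sub>M UNIV (\<lambda>_. count_space UNIV)) \<subseteq> ?L"
  proof -
    have "id \<in> shift_borel \<rightarrow>\<^sub>M ?N"
    proof (rule measurable_PiM_single')
      show "(\<lambda>y. id y i) \<in> (shift_borel :: (int \<Rightarrow> 'p) measure) \<rightarrow>\<^sub>M count_space UNIV" for i
        using sets_shift_borel_open[OF coord[of i]]
        by (auto simp: measurable_def vimage_def)
    qed auto
    from measurable_sets[OF this] show ?thesis by (auto simp: vimage_def)
  qed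
  then show "sets ?N \<subseteq> ?L" .
  define C where "C n w = {y :: int \<Rightarrow> 'p. \<forall>i\<in>{-int n..int n}. y i = w i}" for n w
  have C_sets: "C n w \<in> sets ?N" for n w
  proof -
    have "{y \<in> space ?N. \<forall>i\<in>{-int n..int n}. y i = w i} \<in> sets ?N"
      by measurable
    then show ?thesis by (simp add: C_def space_PiM PiE_def)
  qed
  have "C n w \<in> C n ` (PiE {-int n..int n} (\<lambda>_. UNIV))" for n w
    by (rule image_eqI[of _ _ "restrict w {-int n..int n}"]) (auto simp: C_def)
  then have "range (C n) \<subseteq> C n ` (PiE {-int n..int n} (\<lambda>_. UNIV))" for n
    by auto
  then have finC: "finite (range (C n))" for n
    by (rule finite_subset) (intro finite_imageI finite_PiE, auto)
  then have countC: "countable (\<Union>n. range (C n))"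
    by (intro countable_UN) (auto intro: countable_finite)
  have "U \<in> sets ?N"
    if U: "openin (product_topology (\<lambda>_. discrete_topology UNIV) UNIV) U" for U
  proof -
    have ex: "\<exists>n. C n x \<subseteq> U" if "x \<in> U" for x
    proof -
      from U that obtain V where V: "finite {i. V i \<noteq> (UNIV :: 'p set)}" "x \<in> Pi\<^sub>E UNIV V" "Pi\<^sub>E UNIV V \<subseteq> U"
        unfolding openin_product_topology_alt by auto
      define n where "n = Max (insert 0 ((\<lambda>i. nat \<bar>i\<bar>) ` {i. V i \<noteq> UNIV}))"
      have "nat \<bar>i\<bar> \<le> n" if "V i \<noteq> UNIV" for i
        unfolding n_def using V(1) that by (intro Max_ge) auto
      then have "i \<in> {-int n..int n}" if "V i \<noteq> UNIV" for i
        using that by fastforce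
      then have "C n x \<subseteq> Pi\<^sub>E UNIV V"
        using V(2) by (fastforce simp: C_def PiE_iff)
      with V(3) show ?thesis by blast
    qed
    have "U = \<Union>{c \<in> (\<Union>n. range (C n)). c \<subseteq> U}"
    proof
      show "U \<subseteq> \<Union>{c \<in> (\<Union>n. range (C n)). c \<subseteq> U}"
      proof
        fix x assume "x \<in> U"
        with ex obtain n where "C n x \<subseteq> U" by blast
        moreover have "x \<in> C n x" by (simp add: C_def)
        ultimately show "x \<in> \<Union>{c \<in> (\<Union>n. range (C n)). c \<subseteq> U}" by blast
      qed
    qed auto
    also have "\<dots> \<in> sets ?N"
    proof (rule sets.countable_Union)
      show "countable {c \<in> (\<Union>n. range (C n)). c \<subseteq> U}"
        by (rule countable_subset[OF _ countC]) auto
    qed (auto intro: C_sets)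
    finally show ?thesis .
  qed
  then show "?L \<subseteq> sets ?N"
    unfolding shift_borel_def
    by (subst sets_measure_of, simp, intro sets.sigma_sets_subset')
       (auto simp: space_PiM PiE_def dest: sets.sets_into_space intro: sets.top[of ?N, simplified space_PiM PiE_UNIV_domain, simplified])
qed

lemma block_eq_iff: "block y n = block x n \<longleftrightarrow> (\<forall>i<n. y (int i) = x (int i))"
  by (auto simp: block_def)

lemma cylinder_measurable: "cylinder x n \<in> sets (shift_borel :: (int \<Rightarrow> 'p::finite) measure)"
proof -
  have "{y \<in> space (Pi\<^sub>M UNIV (\<lambda>_. count_space UNIV)). \<forall>i<n. y (int i) = x (int i)}
      \<in> sets (Pi\<^sub>M UNIV (\<lambda>_. count_space (UNIV :: 'p set)))"
    by measurable
  then show ?thesis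
    by (simp add: sets_shift_borel_PiM cylinder_def block_eq_iff space_PiM PiE_def)
qed

lemma finite_range_block: "finite (range (\<lambda>x :: int \<Rightarrow> 'p::finite. block x n))"
  by (rule finite_subset[OF _ finite_lists_length_eq[of "UNIV :: 'p set" n]])
     (auto simp: block_def)

lemma block_entropy_eq:
  fixes M :: "(int \<Rightarrow> 'p::finite) measure"
  assumes "prob_space M" "sets M = sets shift_borel"
  shows "block_entropy M n =
    - (\<Sum>w\<in>range (\<lambda>x. block x n). measure M {x. block x n = w} * log 2 (measure M {x. block x n = w}))"
proof -
  interpret prob_space M by fact
  interpret information_space M 2 by standard simp
  have sp: "space M = UNIV"
    using sets_eq_imp_space_eq[OF assms(2)] by simp
  have "simple_function M (\<lambda>x. block x n)"
    unfolding simple_function_def sp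
  proof (intro conjI ballI finite_range_block)
    fix w assume "w \<in> range (\<lambda>x :: int \<Rightarrow> 'p. block x n)"
    then obtain x :: "int \<Rightarrow> 'p" where "w = block x n" by auto
    then show "(\<lambda>x. block x n) -` {w} \<inter> UNIV \<in> sets M"
      using cylinder_measurable[of x n] by (simp add: assms(2) cylinder_def vimage_def)
  qed
  from entropy_simple_distributed[OF simple_distributedI[OF this measure_nonneg refl]]
  show ?thesis by (simp add: block_entropy_def sp vimage_def)
qed

end

theory Submission
  imports Defs
begin

text \<open>
  A cylinder of the block \<open>x[0,n)\<close> is a word \<open>D @ F\<close>, where \<open>F\<close> has a fixed length \<open>s\<close> and the
  prefix \<open>D\<close> is very long. To hit it is to visit \<open>D\<close> and to find \<open>F\<close> right after the visit. Write
  \<open>q\<close> for the conditional probability of \<open>F\<close> given \<open>D\<close>. Two facts make the visits look like trials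
  of success probability \<open>q\<close>, for most \<open>D\<close> and \<open>F\<close>:

  \<^item> The word after a visit is nearly independent of all that was seen before the visit, because the
    conditional probabilities of \<open>F\<close> given longer and longer pasts converge in mean square and are
    therefore almost settled once the past contains \<open>D\<close> (\<open>past_dep_vanishes\<close>).

  \<^item> Positive entropy makes \<open>q\<close> small when \<open>s\<close> is large (\<open>mean_cnd_vanishes\<close>). Otherwise the
    probability of the actual infinite future given the past would be positive on a set of positive
    measure. Along an orbit this probability can only grow, so it is invariant, hence positive
    almost everywhere by ergodicity, and then the next symbol is determined by the past.

  If the trials were independent of the times of the visits, then the probability of no hit up to time
  \<open>T = t / (q * prb D)\<close> would be the mean of \<open>(1 - q) ^ N\<close>, where the number \<open>N\<close> of visits has mean
  \<open>t / q\<close>, and Jensen's inequality would give at least \<open>(1 - q) powr (t / q)\<close>, which is about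
  \<open>exp (- t)\<close>. Irregular visiting times would thus only make the wait longer.

  However, the word after a visit may influence the times of the later visits. For a single \<open>F\<close> this
  is a real obstruction: the visits to \<open>D\<close> could come in clusters, each ended by the appearance of
  \<open>F\<close>. The way out is that there are many words \<open>F\<close> and only one future, which cannot be adapted to
  all of them. Take all \<open>F\<close> of nearly the same conditional probability \<open>q\<close>. Whatever decides the times
  of the visits, the share of these words that have not yet appeared after \<open>k\<close> visits is close to
  \<open>(1 - q) ^ k\<close>: normalised by this power, the indicators that \<open>F\<close> has not appeared are almost
  martingales, and they are almost uncorrelated for different \<open>F\<close>, so their weighted sum is close to a
  constant in mean square (\<open>bucket_bound\<close>). The Jensen argument then applies to the share, and so
  the words \<open>F\<close> that appear too early have a small share in every group of comparable \<open>q\<close>. Over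
  groups with geometrically decreasing \<open>q\<close> these shares sum up to little (\<open>sum_buckets\<close>).

  Hence, for fixed \<open>t\<close> and \<open>\<delta>\<close>, the cylinders of length \<open>n\<close> whose distribution function exceeds
  \<open>1 - exp (- t) + \<delta>\<close> at \<open>t\<close> cover a set whose measure tends to 0 (\<open>bad_cylinders_vanish\<close>). Both
  assertions follow, the second one by the Borel-Cantelli lemma, first for rational \<open>t\<close>
  and then for all \<open>t\<close> because distribution functions are monotone and \<open>exp\<close> is continuous.
\<close>

section \<open>Words and shifts\<close>

text \<open>
  A substitute for the Cauchy-Schwarz inequality: integrated, it bounds a first absolute moment by
  the second moment, with a free parameter.
\<close>

lemma abs_le_add_square_div:
  fixes a y :: real
  assumes "a > 0"
  shows "\<bar>y\<bar> \<le> a + y\<^sup>2 / a"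
proof (cases "\<bar>y\<bar> \<le> a")
  case False
  then have "\<bar>y\<bar> * a \<le> \<bar>y\<bar> * \<bar>y\<bar>" using assms by (intro mult_left_mono) auto
  then show ?thesis using assms by (simp add: field_simps power2_eq_square add_increasing)
qed (use assms in \<open>simp add: add_increasing2\<close>)

definition shift :: "int \<Rightarrow> (int \<Rightarrow> 'p) \<Rightarrow> int \<Rightarrow> 'p" where
  "shift k x = (\<lambda>i. x (i + k))"

lemma shift_shift [simp]: "shift j (shift k x) = shift (j + k) x"
  by (simp add: shift_def algebra_simps)

lemma shift_0 [simp]: "shift 0 x = x"
  by (simp add: shift_def)

lemma left_shift_eq_shift: "left_shift = shift 1"
  by (auto simp: left_shift_def shift_def)

lemma left_shift_funpow: "(left_shift ^^ n) x = shift (int n) x"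
  by (induction n) (auto simp: left_shift_eq_shift)

definition words :: "nat \<Rightarrow> 'p list set" where
  "words n = {w. length w = n}"

definition word_cyl :: "'p list \<Rightarrow> (int \<Rightarrow> 'p) set" where
  "word_cyl w = {x. block x (length w) = w}"

text \<open>A right inverse of \<open>block\<close>: functions that depend on a block only are evaluated there.\<close>

definition point_of :: "'p list \<Rightarrow> int \<Rightarrow> 'p" where
  "point_of w = (\<lambda>i. w ! nat i)"

lemma length_block [simp]: "length (block x n) = n"
  by (simp add: block_def)

lemma nth_block [simp]: "i < n \<Longrightarrow> block x n ! i = x (int i)"
  by (simp add: block_def)

lemma block_0 [simp]: "block x 0 = []"
  by (simp add: block_def)

lemma block_point_of [simp]: "block (point_of w) (length w) = w"
  by (auto intro!: nth_equalityI simp: point_of_def)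

lemma block_eq_word_iff: "block x n = w \<longleftrightarrow> length w = n \<and> (\<forall>i<n. x (int i) = w ! i)"
  by (auto simp: list_eq_iff_nth_eq)

lemma block_add: "block x (m + n) = block x m @ block (shift (int m) x) n"
  by (auto simp: list_eq_iff_nth_eq nth_append shift_def algebra_simps of_nat_diff)

lemma block_in_words [simp]: "block x n \<in> words n"
  by (simp add: words_def)

lemma finite_words [simp]: "finite (words n :: 'p::finite list set)"
  using finite_lists_length_eq[of "UNIV :: 'p set" n] by (simp add: words_def)

lemma card_words: "card (words n :: 'p::finite list set) = CARD('p) ^ n"
  using card_lists_length_eq[of "UNIV :: 'p set" n] by (simp add: words_def)

lemma sum_words_add:
  "(\<Sum>w\<in>words (m + n). f w) = (\<Sum>u\<in>words m. \<Sum>v\<in>words n. f (u @ v))"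
    for f :: "'p::finite list \<Rightarrow> real"
proof -
  have "(\<Sum>w\<in>words (m + n). f w) = (\<Sum>(u, v)\<in>words m \<times> words n. f (u @ v))"
    by (rule sum.reindex_bij_witness[where i = "\<lambda>(u, v). u @ v" and j = "\<lambda>w. (take m w, drop m w)"])
       (auto simp: words_def)
  then show ?thesis
    by (simp add: sum.cartesian_product)
qed

lemma cylinder_eq_word_cyl: "cylinder x n = word_cyl (block x n)"
  by (simp add: cylinder_def word_cyl_def)

lemma word_cyl_point_of: "word_cyl w = cylinder (point_of w) (length w)"
  by (simp add: cylinder_def word_cyl_def)

lemma indicator_word_cyl_append:
  "indicator (word_cyl (u @ v)) x =
     indicator (word_cyl u) x * (indicator (word_cyl v) (shift (int (length u)) x) :: real)"
  by (simp add: word_cyl_def indicator_def block_add)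

lemma sum_indicator_words:
  "(\<Sum>w\<in>words n. f w * indicator (word_cyl w) x) = (f (block x n) :: real)"
    for x :: "int \<Rightarrow> 'p::finite"
proof -
  have "(\<Sum>w\<in>words n. f w * indicator (word_cyl w) x) =
      (\<Sum>w\<in>words n. if w = block x n then f (block x n) else 0)"
    by (rule sum.cong) (auto simp: word_cyl_def words_def)
  then show ?thesis by simp
qed

section \<open>Word probabilities of a stationary process\<close>

locale stationary_process = prob_space M for M :: "(int \<Rightarrow> 'p::finite) measure" +
  assumes sets_M: "sets M = sets shift_borel"
    and shift_preserving: "measure_preserving_map M left_shift"
begin

lemma space_M [simp]: "space M = UNIV"
  using sets_eq_imp_space_eq[OF sets_M] by simp

lemma prob_UNIV [simp]: "prob UNIV = 1"
  using prob_space by simp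

lemma word_cyl_sets [measurable, simp]: "word_cyl w \<in> sets M"
  by (simp add: sets_M word_cyl_point_of cylinder_measurable)

lemma measurable_shift [measurable]: "shift k \<in> M \<rightarrow>\<^sub>M M"
proof -
  let ?N = "Pi\<^sub>M UNIV (\<lambda>_ :: int. count_space (UNIV :: 'p set))"
  have "shift k \<in> ?N \<rightarrow>\<^sub>M ?N"
  proof (rule measurable_PiM_single')
    show "(\<lambda>x. shift k x i) \<in> ?N \<rightarrow>\<^sub>M count_space UNIV" for i
      unfolding shift_def by measurable
  qed auto
  moreover have "sets M = sets ?N"
    using sets_M sets_shift_borel_PiM by metis
  ultimately show ?thesis
    using measurable_cong_sets by blast
qed

text \<open>
  Invariance extends to negative shifts since the shift is invertible; pasts of any length are
  blocks read after such a shift.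
\<close>

lemma distr_shift: "distr M M (shift k) = M"
proof -
  have 1: "distr M M (shift (int n)) = M" for n
  proof (induction n)
    case 0
    have "(\<lambda>x :: int \<Rightarrow> 'p. shift 0 x) = (\<lambda>x. x)" by (simp add: fun_eq_iff)
    then show ?case by (simp add: distr_id2 eta_contract_eq)
  next
    case (Suc n)
    have "distr M M (shift (int (Suc n))) = distr (distr M M (shift (int n))) M (shift 1)"
      by (subst distr_distr) (auto simp: comp_def)
    also have "\<dots> = M"
      using shift_preserving Suc by (simp add: measure_preserving_map_def left_shift_eq_shift)
    finally show ?case .
  qed
  show ?thesis
  proof (cases "k \<ge> 0")
    case True
    then show ?thesis using 1[of "nat k"] by simp
  next
    case False
    then have "M = distr (distr M M (shift (int (nat (- k))))) M (shift k) \<Longrightarrow> ?thesis"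
      using 1[of "nat (- k)"] by simp
    moreover have "distr (distr M M (shift (int (nat (- k))))) M (shift k) = distr M M (\<lambda>x. x)"
      using False by (subst distr_distr) (auto simp: comp_def)
    ultimately show ?thesis by (simp add: distr_id2)
  qed
qed

lemma integral_shift:
  fixes f :: "(int \<Rightarrow> 'p) \<Rightarrow> real"
  assumes [measurable]: "f \<in> borel_measurable M"
  shows "(\<integral>x. f (shift k x) \<partial>M) = (\<integral>x. f x \<partial>M)"
  by (subst (2) distr_shift[of k, symmetric]) (simp add: integral_distr)

lemma integrable_shift:
  fixes f :: "(int \<Rightarrow> 'p) \<Rightarrow> real"
  assumes "integrable M f"
  shows "integrable M (\<lambda>x. f (shift k x))"
  by (rule integrable_distr[OF measurable_shift]) (simp only: distr_shift assms)

lemma AE_shift: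
  assumes "AE x in M. Q x"
  shows "AE x in M. Q (shift k x)"
proof -
  have "AE x in distr M M (shift k). Q x" by (simp only: distr_shift assms)
  then show ?thesis by (rule AE_distrD[rotated]) measurable
qed

definition prb :: "'p list \<Rightarrow> real" where
  "prb w = measure M (word_cyl w)"

lemma prb_nonneg [simp]: "0 \<le> prb w"
  by (simp add: prb_def)

lemma prb_le_1 [simp]: "prb w \<le> 1"
  by (simp add: prb_def)

lemma integrable_indicator_word_cyl [simp]: "integrable M (\<lambda>x. indicator (word_cyl w) x :: real)"
  by (auto simp: integrable_indicator_iff less_top[symmetric])

lemma integrable_block [simp]: "integrable M (\<lambda>x. f (block x n) :: real)"
proof -
  have "integrable M (\<lambda>x. \<Sum>w\<in>words n. f w * indicator (word_cyl w) x)"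
    by (intro Bochner_Integration.integrable_sum integrable_mult_right) simp
  then show ?thesis by (simp add: sum_indicator_words)
qed

lemma integral_block: "(\<integral>x. f (block x n) \<partial>M) = (\<Sum>w\<in>words n. prb w * f w)"
proof -
  have "(\<integral>x. f (block x n) \<partial>M) = (\<integral>x. (\<Sum>w\<in>words n. f w * indicator (word_cyl w) x) \<partial>M)"
    by (simp add: sum_indicator_words)
  also have "\<dots> = (\<Sum>w\<in>words n. prb w * f w)"
    by (subst Bochner_Integration.integral_sum) (auto simp: prb_def mult.commute)
  finally show ?thesis .
qed

lemma measurable_block [measurable]: "(\<lambda>x. block x n) \<in> M \<rightarrow>\<^sub>M count_space UNIV"
proof (rule measurable_compose_countable'[where I = "words n" and f = "\<lambda>w x. w" and g = "\<lambda>x. block x n"])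
  show "(\<lambda>x. block x n) \<in> M \<rightarrow>\<^sub>M count_space (words n)"
  proof (rule measurable_count_space_eq2[THEN iffD2], simp, intro conjI ballI)
    fix w :: "'p list" assume "w \<in> words n"
    then have "(\<lambda>x. block x n) -` {w} \<inter> space M = word_cyl w"
      by (auto simp: word_cyl_def words_def)
    then show "(\<lambda>x. block x n) -` {w} \<inter> space M \<in> sets M" by simp
  qed auto
qed (auto simp: countable_finite)

lemma prb_Nil [simp]: "prb [] = 1"
  using prob_space by (simp add: prb_def word_cyl_def)

lemma measure_block: "measure M {x. S (block x n)} = (\<Sum>w | w \<in> words n \<and> S w. prb w)"
proof -
  have "measure M {x. S (block x n)} = (\<integral>x. indicator {w. S w} (block x n) \<partial>M)"
  proof -
    have "{x. S (block x n)} \<in> sets M"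
      using measurable_sets[OF measurable_block, of "{w. S w}" n] by (simp add: vimage_def)
    moreover have "(\<lambda>x. indicator {w. S w} (block x n) :: real) = indicator {x. S (block x n)}"
      by (auto simp: indicator_def)
    ultimately show ?thesis by simp
  qed
  also have "\<dots> = (\<Sum>w\<in>words n. prb w * indicator {w. S w} w)"
    by (rule integral_block)
  also have "\<dots> = (\<Sum>w | w \<in> words n \<and> S w. prb w)"
    by (simp add: sum.inter_filter[symmetric] indicator_def if_distrib Int_def cong: if_cong)
  finally show ?thesis .
qed

lemma prb_append_sum: "(\<Sum>v\<in>words n. prb (w @ v)) = prb w"
proof -
  have "(\<integral>x. (\<Sum>v\<in>words n. indicator (word_cyl (w @ v)) x) \<partial>M) = (\<Sum>v\<in>words n. prb (w @ v))"
    by (subst Bochner_Integration.integral_sum) (auto simp: prb_def)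
  moreover have "(\<Sum>v\<in>words n. indicator (word_cyl (w @ v)) x) = (indicator (word_cyl w) x :: real)" for x
    using sum_indicator_words[of "\<lambda>_. 1" "shift (int (length w)) x" n]
    by (simp add: indicator_word_cyl_append sum_distrib_left[symmetric])
  ultimately show ?thesis by (simp add: prb_def)
qed

lemma sum_prb_words: "(\<Sum>w\<in>words n. prb w) = 1"
  using prb_append_sum[of "[]" n] by simp

text \<open>
  This is where stationarity enters the calculus of words: a word has the same probability
  at every position.
\<close>

lemma prb_prepend_sum: "(\<Sum>v\<in>words n. prb (v @ w)) = prb w"
proof -
  have "(\<integral>x. (\<Sum>v\<in>words n. indicator (word_cyl (v @ w)) x) \<partial>M) = (\<Sum>v\<in>words n. prb (v @ w))"
    by (subst Bochner_Integration.integral_sum) (auto simp: prb_def)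
  moreover have "(\<Sum>v\<in>words n. indicator (word_cyl (v @ w)) x) =
      (indicator (word_cyl w) (shift (int n) x) :: real)" for x
  proof -
    have "(\<Sum>v\<in>words n. indicator (word_cyl (v @ w)) x) =
        (\<Sum>v\<in>words n. indicator (word_cyl w) (shift (int n) x) * indicator (word_cyl v) x :: real)"
      by (rule sum.cong) (auto simp: indicator_word_cyl_append words_def)
    then show ?thesis
      using sum_indicator_words[of "\<lambda>_. indicator (word_cyl w) (shift (int n) x)" x n] by simp
  qed
  ultimately show ?thesis
    using integral_shift[of "indicator (word_cyl w)" "int n"] by (simp add: prb_def)
qed

lemma prb_append_le1: "prb (w @ v) \<le> prb w"
proof -
  have "prb (w @ v) \<le> (\<Sum>v\<in>words (length v). prb (w @ v))"
    by (rule member_le_sum) (auto simp: words_def finite_words[unfolded words_def])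
  then show ?thesis by (simp add: prb_append_sum)
qed

end

section \<open>Conditional probabilities of words and longer pasts\<close>

context stationary_process begin

definition cnd :: "'p list \<Rightarrow> 'p list \<Rightarrow> real" where
  "cnd D F = prb (D @ F) / prb D"

lemma cnd_nonneg [simp]: "0 \<le> cnd D F"
  by (simp add: cnd_def)

lemma cnd_le_1 [simp]: "cnd D F \<le> 1"
  using prb_append_le1[of D F] by (simp add: cnd_def divide_le_eq_1 order_less_le)

lemma prb_append: "prb (D @ F) = prb D * cnd D F"
proof (cases "prb D = 0")
  case True
  then show ?thesis using prb_append_le1[of D F] prb_nonneg[of "D @ F"] by simp
qed (simp add: cnd_def)

lemma sum_cnd_le_1: "(\<Sum>F\<in>words s. cnd D F) \<le> 1"
  by (simp add: cnd_def sum_divide_distrib[symmetric] prb_append_sum)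

text \<open>
  The second moment of the conditional probability of \<open>F\<close> given the last \<open>n\<close> symbols.
\<close>

definition energy :: "nat \<Rightarrow> 'p list \<Rightarrow> real" where
  "energy n F = (\<Sum>w\<in>words n. prb w * (cnd w F)\<^sup>2)"

text \<open>
  How much the conditional probability of \<open>F\<close> after \<open>D\<close> still depends, in the mean, on the \<open>l\<close>
  symbols before \<open>D\<close>. The weights are not normalised by \<open>prb D\<close>, so that sums over \<open>D\<close> are means.
\<close>

definition past_dep :: "nat \<Rightarrow> 'p list \<Rightarrow> 'p list \<Rightarrow> real" where
  "past_dep l D F = (\<Sum>u\<in>words l. prb (u @ D) * \<bar>cnd (u @ D) F - cnd D F\<bar>)"

text \<open>
  Conditional probabilities given growing pasts form a martingale, so that the second moment of an
  increment is the increment of the second moment.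
\<close>

lemma energy_diff:
  "energy (l + n) F - energy n F =
     (\<Sum>w\<in>words n. \<Sum>u\<in>words l. prb (u @ w) * (cnd (u @ w) F - cnd w F)\<^sup>2)"
proof -
  have 1: "(\<Sum>u\<in>words l. prb (u @ w) * (cnd (u @ w) F - cnd w F)\<^sup>2) =
      (\<Sum>u\<in>words l. prb (u @ w) * (cnd (u @ w) F)\<^sup>2) - prb w * (cnd w F)\<^sup>2" for w
  proof -
    have "(\<Sum>u\<in>words l. prb (u @ w) * (cnd (u @ w) F - cnd w F)\<^sup>2) =
      (\<Sum>u\<in>words l. prb (u @ w) * (cnd (u @ w) F)\<^sup>2)
      - 2 * cnd w F * (\<Sum>u\<in>words l. prb (u @ w) * cnd (u @ w) F)
      + (cnd w F)\<^sup>2 * (\<Sum>u\<in>words l. prb (u @ w))"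
      by (simp add: power2_diff algebra_simps sum.distrib sum_subtractf sum_distrib_left)
    also have "(\<Sum>u\<in>words l. prb (u @ w) * cnd (u @ w) F) = prb w * cnd w F"
      using prb_prepend_sum[of "w @ F" l] by (simp add: prb_append[symmetric])
    finally show ?thesis
      by (simp add: prb_prepend_sum power2_eq_square algebra_simps)
  qed
  have "energy (l + n) F = (\<Sum>w\<in>words n. \<Sum>u\<in>words l. prb (u @ w) * (cnd (u @ w) F)\<^sup>2)"
    unfolding energy_def by (subst sum_words_add, subst sum.swap) (rule refl)
  then show ?thesis
    by (simp add: 1 sum_subtractf energy_def)
qed

lemma energy_mono: "m \<le> n \<Longrightarrow> energy m F \<le> energy n F"
proof -
  assume "m \<le> n"
  then obtain l where "n = l + m" using le_Suc_ex by (metis add.commute)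
  moreover have "0 \<le> energy (l + m) F - energy m F"
    unfolding energy_diff by (intro sum_nonneg mult_nonneg_nonneg) auto
  ultimately show ?thesis by simp
qed

lemma sum_past_dep_le:
  assumes "\<kappa> > 0"
  shows "(\<Sum>D\<in>words n. past_dep l D F) \<le> \<kappa> + (energy (l + n) F - energy n F) / \<kappa>"
proof -
  have "(\<Sum>D\<in>words n. past_dep l D F) \<le>
     (\<Sum>w\<in>words n. \<Sum>u\<in>words l. prb (u @ w) * (\<kappa> + (cnd (u @ w) F - cnd w F)\<^sup>2 / \<kappa>))"
    unfolding past_dep_def by (intro sum_mono mult_left_mono abs_le_add_square_div[OF assms]) auto
  also have "\<dots> = \<kappa> * (\<Sum>w\<in>words n. \<Sum>u\<in>words l. prb (u @ w)) + (energy (l + n) F - energy n F) / \<kappa>"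
    unfolding energy_diff by (simp add: algebra_simps sum.distrib sum_distrib_left sum_divide_distrib)
  also have "(\<Sum>w\<in>words n. \<Sum>u\<in>words l. prb (u @ w)) = 1"
    by (simp add: prb_prepend_sum sum_prb_words)
  finally show ?thesis by simp
qed

lemma past_dep_nonneg: "0 \<le> past_dep l D F"
  unfolding past_dep_def by (intro sum_nonneg mult_nonneg_nonneg) auto

lemma past_dep_alt: "past_dep l D F = (\<Sum>u\<in>words l. \<bar>prb (u @ D @ F) - prb (u @ D) * cnd D F\<bar>)"
  unfolding past_dep_def
proof (rule sum.cong[OF refl])
  fix u
  have "prb (u @ D @ F) - prb (u @ D) * cnd D F = prb (u @ D) * (cnd (u @ D) F - cnd D F)"
    using prb_append[of "u @ D" F] by (simp add: algebra_simps)
  then show "prb (u @ D) * \<bar>cnd (u @ D) F - cnd D F\<bar> = \<bar>prb (u @ D @ F) - prb (u @ D) * cnd D F\<bar>"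
    by (simp add: abs_mult)
qed

text \<open>
  By the triangle inequality, as averaging over the additional symbols gives back the old terms.
  One bound for a long past thus serves for all visits up to a given time.
\<close>

lemma past_dep_mono: "l \<le> m \<Longrightarrow> past_dep l D F \<le> past_dep m D F"
proof -
  assume "l \<le> m"
  then obtain k where m: "m = k + l" using le_Suc_ex by (metis add.commute)
  have "past_dep l D F =
      (\<Sum>u\<in>words l. \<bar>\<Sum>v\<in>words k. prb (v @ u @ D @ F) - prb (v @ u @ D) * cnd D F\<bar>)"
    by (simp add: past_dep_alt sum_subtractf sum_distrib_right[symmetric] prb_prepend_sum)
  also have "\<dots> \<le> (\<Sum>u\<in>words l. \<Sum>v\<in>words k. \<bar>prb (v @ u @ D @ F) - prb (v @ u @ D) * cnd D F\<bar>)"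
    by (intro sum_mono sum_abs)
  also have "\<dots> = past_dep m D F"
    unfolding m past_dep_alt by (subst sum_words_add, subst sum.swap) simp
  finally show ?thesis .
qed

text \<open>
  The mean of the conditional probability of the actual next \<open>s\<close> symbols given the last \<open>n\<close> symbols,
  see \<open>integral_past_prob\<close>. It is small if the process is hard to predict.
\<close>

definition mean_cnd :: "nat \<Rightarrow> nat \<Rightarrow> real" where
  "mean_cnd n s = (\<Sum>F\<in>words s. energy n F)"

lemma mean_cnd_alt: "mean_cnd n s = (\<Sum>D\<in>words n. \<Sum>F\<in>words s. prb (D @ F) * cnd D F)"
  unfolding mean_cnd_def energy_def
  by (subst sum.swap) (simp add: prb_append power2_eq_square algebra_simps)

lemma mean_cnd_nonneg: "0 \<le> mean_cnd n s"
  unfolding mean_cnd_def energy_def by (intro sum_nonneg mult_nonneg_nonneg) auto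

lemma mean_cnd_le_1: "mean_cnd n s \<le> 1"
proof -
  have "mean_cnd n s \<le> (\<Sum>D\<in>words n. \<Sum>F\<in>words s. prb (D @ F) * 1)"
    unfolding mean_cnd_alt by (intro sum_mono mult_left_mono) auto
  then show ?thesis by (simp add: prb_append_sum sum_prb_words)
qed

lemma energy_le_1: assumes "F \<in> words s" shows "energy n F \<le> 1"
proof -
  have "energy n F \<le> mean_cnd n s"
    unfolding mean_cnd_def using assms
    by (intro member_le_sum) (auto simp: energy_def intro!: sum_nonneg mult_nonneg_nonneg)
  then show ?thesis using mean_cnd_le_1[of n s] by simp
qed

lemma mean_cnd_mono: "m \<le> n \<Longrightarrow> mean_cnd m s \<le> mean_cnd n s"
  unfolding mean_cnd_def by (intro sum_mono energy_mono)

lemma cnd_append: "cnd D (F @ G) = cnd D F * cnd (D @ F) G"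
  using prb_append_le1[of "D @ F" G] prb_nonneg[of "D @ F @ G"]
  by (cases "prb (D @ F) = 0") (auto simp: cnd_def)

lemma mean_cnd_antimono: "s \<le> s' \<Longrightarrow> mean_cnd n s' \<le> mean_cnd n s"
proof -
  assume "s \<le> s'"
  then obtain k where s': "s' = s + k" using le_Suc_ex by blast
  have "(\<Sum>G\<in>words k. prb (D @ F @ G) * cnd D (F @ G)) \<le> prb (D @ F) * cnd D F" for D F
  proof -
    have "(\<Sum>G\<in>words k. prb (D @ F @ G) * cnd D (F @ G)) \<le> (\<Sum>G\<in>words k. prb (D @ F @ G) * cnd D F)"
      by (intro sum_mono mult_left_mono) (auto simp: cnd_append mult_left_le)
    also have "\<dots> = prb (D @ F) * cnd D F"
      using prb_append_sum[of "D @ F" k] by (simp add: sum_distrib_right[symmetric])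
    finally show ?thesis .
  qed
  then show ?thesis
    unfolding mean_cnd_alt s' sum_words_add[of _ s k] by (intro sum_mono)
qed

text \<open>
  The second moments \<open>energy n F\<close> increase with \<open>n\<close> and are bounded, so they form a Cauchy sequence.
\<close>

lemma past_dep_vanishes:
  assumes "\<kappa> > 0"
  shows "\<exists>n0. \<forall>n\<ge>n0. \<forall>l. \<forall>F\<in>words s. (\<Sum>D\<in>words n. past_dep l D F) \<le> \<kappa>"
proof -
  have "\<forall>\<^sub>F n in sequentially. \<forall>l. (\<Sum>D\<in>words n. past_dep l D F) \<le> \<kappa>" if F: "F \<in> words s" for F
  proof -
    have "convergent (\<lambda>n. energy n F)"
      using energy_le_1[OF F] energy_mono
      by (intro Bseq_monoseq_convergent incseq_imp_monoseq)
         (auto simp: incseq_def energy_def intro!: BseqI'[of _ 1] abs_of_nonneg[THEN ord_eq_le_trans] sum_nonneg mult_nonneg_nonneg)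
    then have "Cauchy (\<lambda>n. energy n F)"
      by (simp add: Cauchy_convergent_iff)
    then obtain N where N: "\<And>m n. m \<ge> N \<Longrightarrow> n \<ge> N \<Longrightarrow> dist (energy m F) (energy n F) < (\<kappa> / 2)\<^sup>2"
      using assms unfolding Cauchy_def by (meson half_gt_zero zero_less_power)
    have "(\<Sum>D\<in>words n. past_dep l D F) \<le> \<kappa>" if "n \<ge> N" for n l
    proof -
      have "(\<Sum>D\<in>words n. past_dep l D F) \<le> \<kappa> / 2 + (energy (l + n) F - energy n F) / (\<kappa> / 2)"
        by (rule sum_past_dep_le) (use assms in simp)
      also have "\<dots> \<le> \<kappa> / 2 + (\<kappa> / 2)\<^sup>2 / (\<kappa> / 2)"
        using N[of "l + n" n] that assms by (intro add_left_mono divide_right_mono) (auto simp: dist_real_def)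
      also have "\<dots> = \<kappa>" using assms by (simp add: power2_eq_square)
      finally show ?thesis .
    qed
    then show ?thesis unfolding eventually_sequentially by blast
  qed
  then have "\<forall>\<^sub>F n in sequentially. \<forall>F\<in>words s. \<forall>l. (\<Sum>D\<in>words n. past_dep l D F) \<le> \<kappa>"
    by (intro eventually_ball_finite) auto
  then show ?thesis unfolding eventually_sequentially by blast
qed

end

section \<open>Conditional probabilities as functions of a point\<close>

context stationary_process begin

text \<open>
  The conditional probability, given \<open>x[-n,0)\<close>, of the block \<open>x[0,s)\<close> that actually follows.
\<close>

definition past_prob :: "nat \<Rightarrow> nat \<Rightarrow> (int \<Rightarrow> 'p) \<Rightarrow> real" where
  "past_prob n s x = cnd (block (shift (- int n) x) n) (block x s)"

lemma past_prob_nonneg [simp]: "0 \<le> past_prob n s x"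
  by (simp add: past_prob_def)

lemma past_prob_le_1 [simp]: "past_prob n s x \<le> 1"
  by (simp add: past_prob_def)

lemma past_block_alt:
  "f (block (shift (- int n) x) n) (block x s) =
     (\<lambda>w. f (take n w) (drop n w)) (block (shift (- int n) x) (n + s))"
  by (simp add: block_add)

lemma integrable_past_block [simp]:
  "integrable M (\<lambda>x. f (block (shift (- int n) x) n) (block x s) :: real)"
  unfolding past_block_alt by (rule integrable_shift) (rule integrable_block)

lemma integral_past_block:
  "(\<integral>x. f (block (shift (- int n) x) n) (block x s) \<partial>M) =
     (\<Sum>D\<in>words n. \<Sum>F\<in>words s. prb (D @ F) * f D F)"
proof -
  have "(\<integral>x. f (block (shift (- int n) x) n) (block x s) \<partial>M) =
      (\<integral>x. (\<lambda>w. f (take n w) (drop n w)) (block x (n + s)) \<partial>M)"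
    unfolding past_block_alt by (rule integral_shift) (rule borel_measurable_integrable[OF integrable_block])
  also have "\<dots> = (\<Sum>w\<in>words (n + s). prb w * f (take n w) (drop n w))"
    by (rule integral_block)
  also have "\<dots> = (\<Sum>D\<in>words n. \<Sum>F\<in>words s. prb (D @ F) * f D F)"
    unfolding sum_words_add by (intro sum.cong refl) (auto simp: words_def)
  finally show ?thesis .
qed

lemma integrable_past_prob [simp]: "integrable M (past_prob n s)"
  unfolding past_prob_def[abs_def] by (rule integrable_past_block)

lemma measurable_past_prob [measurable]: "past_prob n s \<in> borel_measurable M"
  by (rule borel_measurable_integrable) simp

lemma integral_past_prob: "(\<integral>x. past_prob n s x \<partial>M) = mean_cnd n s"
  unfolding past_prob_def integral_past_block mean_cnd_alt ..

lemma past_prob_L1_diff: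
  assumes "n \<le> m"
  shows "(\<integral>x. \<bar>past_prob m s x - past_prob n s x\<bar> \<partial>M) \<le>
     (\<Sum>F\<in>words s. \<Sum>D\<in>words n. past_dep (m - n) D F)"
proof -
  obtain l where m: "m = l + n" using assms le_Suc_ex by (metis add.commute)
  have split: "block (shift (- int n) x) n = drop l (block (shift (- int m) x) m)" for x :: "int \<Rightarrow> 'p"
    by (simp add: m block_add)
  have "(\<integral>x. \<bar>past_prob m s x - past_prob n s x\<bar> \<partial>M) =
     (\<Sum>w\<in>words m. \<Sum>F\<in>words s. prb (w @ F) * \<bar>cnd w F - cnd (drop l w) F\<bar>)"
    unfolding past_prob_def split by (rule integral_past_block)
  also have "\<dots> \<le> (\<Sum>w\<in>words m. \<Sum>F\<in>words s. prb w * \<bar>cnd w F - cnd (drop l w) F\<bar>)"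
    by (intro sum_mono mult_right_mono prb_append_le1) auto
  also have "\<dots> = (\<Sum>u\<in>words l. \<Sum>D\<in>words n. \<Sum>F\<in>words s. prb (u @ D) * \<bar>cnd (u @ D) F - cnd D F\<bar>)"
    unfolding m sum_words_add by (intro sum.cong refl) (auto simp: words_def)
  also have "\<dots> = (\<Sum>D\<in>words n. \<Sum>u\<in>words l. \<Sum>F\<in>words s. prb (u @ D) * \<bar>cnd (u @ D) F - cnd D F\<bar>)"
    by (rule sum.swap)
  also have "\<dots> = (\<Sum>D\<in>words n. \<Sum>F\<in>words s. past_dep l D F)"
    unfolding past_dep_def by (rule sum.cong[OF refl]) (rule sum.swap)
  also have "\<dots> = (\<Sum>F\<in>words s. \<Sum>D\<in>words n. past_dep l D F)"
    by (rule sum.swap)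
  finally show ?thesis by (simp add: m)
qed

lemma past_prob_L1_Cauchy:
  assumes "\<kappa> > 0"
  shows "\<forall>\<^sub>F n in sequentially. \<forall>m\<ge>n. (\<integral>x. \<bar>past_prob m s x - past_prob n s x\<bar> \<partial>M) \<le> \<kappa>"
proof -
  define \<kappa>' where "\<kappa>' = \<kappa> / (1 + real (card (words s :: 'p list set)))"
  have \<kappa>': "\<kappa>' > 0" using assms by (simp add: \<kappa>'_def add_pos_nonneg)
  from past_dep_vanishes[OF this, of s] obtain n0 where
    n0: "\<And>n l F. n \<ge> n0 \<Longrightarrow> F \<in> words s \<Longrightarrow> (\<Sum>D\<in>words n. past_dep l D F) \<le> \<kappa>'"
    by blast
  have "(\<integral>x. \<bar>past_prob m s x - past_prob n s x\<bar> \<partial>M) \<le> \<kappa>" if "n \<ge> n0" "m \<ge> n" for m n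
  proof -
    have "(\<integral>x. \<bar>past_prob m s x - past_prob n s x\<bar> \<partial>M) \<le>
        (\<Sum>F\<in>words s. \<Sum>D\<in>words n. past_dep (m - n) D F)"
      by (rule past_prob_L1_diff) fact
    also have "\<dots> \<le> (\<Sum>F\<in>(words s :: 'p list set). \<kappa>')"
      by (intro sum_mono n0 that)
    also have "\<dots> \<le> \<kappa>' * (1 + real (card (words s :: 'p list set)))"
      using \<kappa>' by (simp add: algebra_simps)
    also have "\<dots> = \<kappa>" by (simp add: \<kappa>'_def add_nonneg_eq_0_iff)
    finally show ?thesis .
  qed
  then show ?thesis unfolding eventually_sequentially by blast
qed

lemma past_prob_antimono: "s \<le> s' \<Longrightarrow> past_prob n s' x \<le> past_prob n s x"
proof -
  assume "s \<le> s'"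
  then obtain k where s': "s' = s + k" using le_Suc_ex by blast
  show ?thesis
    by (simp add: past_prob_def s' block_add cnd_append mult_left_le)
qed

text \<open>
  The chain rule: predict one symbol, move it to the past, and predict the others. It ties the
  prediction at \<open>x\<close> to the one at the shifted point.
\<close>

lemma past_prob_Suc: "past_prob n (Suc s) x = past_prob n 1 x * past_prob (Suc n) s (shift 1 x)"
proof -
  have 1: "block x (Suc s) = block x 1 @ block (shift 1 x) s"
    using block_add[of x 1 s] by simp
  have 2: "block (shift (- int n) x) (Suc n) = block (shift (- int n) x) n @ block x 1"
    using block_add[of "shift (- int n) x" n 1] by simp
  show ?thesis
    unfolding past_prob_def 1 cnd_append by (simp add: 2)
qed

lemma L1_triangle:
  assumes "integrable M f" "integrable M g" "integrable M (h :: _ \<Rightarrow> real)"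
  shows "(\<integral>x. \<bar>f x - h x\<bar> \<partial>M) \<le> (\<integral>x. \<bar>f x - g x\<bar> \<partial>M) + (\<integral>x. \<bar>g x - h x\<bar> \<partial>M)"
proof -
  have "(\<integral>x. \<bar>f x - h x\<bar> \<partial>M) \<le> (\<integral>x. \<bar>f x - g x\<bar> + \<bar>g x - h x\<bar> \<partial>M)"
    using assms by (intro integral_mono) auto
  then show ?thesis using assms by simp
qed

lemma L1_ordered:
  assumes "integrable M f" "integrable M (g :: _ \<Rightarrow> real)" "\<And>x. g x \<le> f x"
  shows "(\<integral>x. \<bar>f x - g x\<bar> \<partial>M) = (\<integral>x. f x \<partial>M) - (\<integral>x. g x \<partial>M)"
  using assms by (simp add: abs_of_nonneg)

text \<open>
  The set where \<open>G\<close> is positive is invariant only up to a null set, whereas ergodicity speaks of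
  strictly invariant sets. The set of points whose orbit meets it infinitely often is strictly
  invariant and differs from it by a null set.
\<close>

lemma ergodic_AE_pos:
  assumes erg: "ergodic_map M left_shift"
    and [measurable]: "G \<in> borel_measurable M"
    and inv: "AE x in M. G (shift 1 x) = G x"
    and pos: "(\<integral>x. G x \<partial>M) > (0::real)"
  shows "AE x in M. G x > 0"
proof -
  have "AE x in M. \<forall>k::nat. G (shift (int k) x) = G x"
  proof (subst AE_all_countable, rule allI)
    fix k :: nat
    show "AE x in M. G (shift (int k) x) = G x"
    proof (induction k)
      case (Suc k)
      then show ?case using AE_shift[OF inv, of "int k"]
        by eventually_elim (simp add: algebra_simps)
    qed simp
  qed
  note inv' = this
  define S where "S = {x. \<forall>k::nat. \<exists>j::nat. j \<ge> k \<and> G (shift (int j) x) > 0}"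
  have [measurable]: "S \<in> sets M"
  proof -
    have "{x \<in> space M. \<forall>k::nat. \<exists>j::nat. j \<ge> k \<and> G (shift (int j) x) > 0} \<in> sets M"
      by measurable
    then show ?thesis by (simp add: S_def)
  qed
  have "left_shift -` S \<inter> space M = S"
  proof -
    have "(\<exists>j::nat. j \<ge> k \<and> G (shift (int j + 1) x) > 0)" if "x \<in> S" for k x
    proof -
      from that obtain j where "j \<ge> Suc k" "G (shift (int j) x) > 0" unfolding S_def by blast
      then show ?thesis by (intro exI[of _ "j - 1"]) (auto simp: of_nat_diff)
    qed
    moreover have "x \<in> S" if H: "\<forall>k::nat. \<exists>j::nat. j \<ge> k \<and> G (shift (int j + 1) x) > 0" for x
    proof -
      have "\<exists>j::nat. j \<ge> k \<and> G (shift (int j) x) > 0" for k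
      proof -
        from H obtain j where "j \<ge> k" "G (shift (int j + 1) x) > 0" by blast
        then show ?thesis by (intro exI[of _ "Suc j"]) (auto simp: algebra_simps)
      qed
      then show ?thesis by (simp add: S_def)
    qed
    ultimately show ?thesis
      by (auto simp: left_shift_eq_shift) (auto simp: S_def)
  qed
  then consider "emeasure M S = 0" | "emeasure M (space M - S) = 0"
    using erg \<open>S \<in> sets M\<close> unfolding ergodic_map_def by blast
  then show ?thesis
  proof cases
    case 1
    then have "AE x in M. x \<notin> S"
      by (intro AE_not_in) (auto simp: null_sets_def)
    with inv' have "AE x in M. G x \<le> 0"
      by eventually_elim (auto simp: S_def not_less)
    then have "0 \<le> (\<integral>x. - G x \<partial>M)" by (intro integral_nonneg_AE) auto
    with pos show ?thesis by simp
  next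
    case 2
    then have "AE x in M. x \<notin> space M - S"
      using sets.compl_sets[OF \<open>S \<in> sets M\<close>] by (intro AE_not_in null_setsI)
    with inv' show ?thesis
      by eventually_elim (auto simp: S_def)
  qed
qed

end

section \<open>Unpredictable words in processes of positive entropy\<close>

context stationary_process begin

text \<open>
  If arbitrarily long words keep a conditional probability that is not small in the mean, then
  already the next symbol is predicted by a long past.

  The functions \<open>past_prob n s\<close> are Cauchy in mean as \<open>n\<close> grows, and decrease with \<open>s\<close>. A diagonal
  sequence \<open>f\<close> is therefore Cauchy in mean as well, and a subsequence has an almost sure limit \<open>G\<close>
  with positive integral; \<open>G x\<close> is the conditional probability of the whole future of \<open>x\<close> given its
  past. In the limit, \<open>past_prob_Suc\<close> reads \<open>G x = p x * G (shift 1 x)\<close> with a factor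
  \<open>p x \<le> 1\<close>, the probability of the next symbol given the past. As \<open>G\<close> and its shift have the same
  integral, they agree almost everywhere, and \<open>p x = 1\<close> wherever \<open>G\<close> is positive; by ergodicity this
  is almost everywhere.
\<close>

lemma next_symbol_predictable:
  assumes erg: "ergodic_map M left_shift"
    and large: "\<epsilon>0 > 0" "\<And>s. \<exists>n. mean_cnd n s > \<epsilon>0"
  shows "(\<lambda>n. mean_cnd n 1) \<longlonglongrightarrow> 1"
proof -
  \<comment> \<open>\<open>A s\<close> is the mean of the conditional probability given the whole past.\<close>
  have conv: "convergent (\<lambda>n. mean_cnd n s)" for s
    using mean_cnd_mono mean_cnd_le_1 mean_cnd_nonneg
    by (intro Bseq_monoseq_convergent incseq_imp_monoseq BseqI'[of _ 1]) (auto simp: incseq_def)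
  define A where "A s = lim (\<lambda>n. mean_cnd n s)" for s
  have A: "(\<lambda>n. mean_cnd n s) \<longlonglongrightarrow> A s" for s
    using conv by (simp add: A_def convergent_LIMSEQ_iff)
  have le_A: "mean_cnd n s \<le> A s" for n s
    by (rule incseq_le[OF _ A]) (auto simp: incseq_def mean_cnd_mono)
  have A_gt: "A s \<ge> \<epsilon>0" for s
    using large(2)[of s] le_A by (meson less_imp_le order_trans)
  have A_mono: "s \<le> s' \<Longrightarrow> A s' \<le> A s" for s s'
    by (rule LIMSEQ_le[OF A A]) (auto intro: mean_cnd_antimono)
  have "convergent A"
    using A_mono A_gt large(1) order_trans[OF A_mono[of 0]]
    by (intro Bseq_monoseq_convergent decseq_imp_monoseq BseqI'[of _ "A 0"])
       (auto simp: decseq_def abs_of_nonneg[OF order_trans[OF less_imp_le[OF large(1)] A_gt]])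
  then obtain a where a: "A \<longlonglongrightarrow> a" by (auto simp: convergent_def)
  have a_le: "a \<le> A s" for s
    by (rule decseq_ge[OF _ a]) (auto simp: decseq_def A_mono)
  define \<delta> where "\<delta> i = 1 / real (Suc i)" for i
  have \<delta>_pos: "\<delta> i > 0" for i by (simp add: \<delta>_def)
  have \<delta>_lim: "\<delta> \<longlonglongrightarrow> 0"
    unfolding \<delta>_def using LIMSEQ_inverse_real_of_nat by (simp add: inverse_eq_divide)
  have "\<exists>N. (\<forall>m\<ge>N. (\<integral>x. \<bar>past_prob m i x - past_prob N i x\<bar> \<partial>M) \<le> \<delta> i) \<and>
      A i - mean_cnd N i \<le> \<delta> i \<and> A (Suc i) - mean_cnd N (Suc i) \<le> \<delta> i" for i
  proof -
    have ev: "\<forall>\<^sub>F N in sequentially. A s - mean_cnd N s \<le> \<delta> i" for s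
    proof -
      have "\<forall>\<^sub>F N in sequentially. mean_cnd N s > A s - \<delta> i"
        using A \<delta>_pos[of i] by (intro order_tendstoD(1)) auto
      then show ?thesis by eventually_elim simp
    qed
    show ?thesis
      using eventually_conj[OF past_prob_L1_Cauchy[OF \<delta>_pos, of i i] eventually_conj[OF ev[of i] ev[of "Suc i"]]]
      unfolding eventually_sequentially by blast
  qed
  then obtain N where
    N: "\<And>i m. m \<ge> N i \<Longrightarrow> (\<integral>x. \<bar>past_prob m i x - past_prob (N i) i x\<bar> \<partial>M) \<le> \<delta> i"
       "\<And>i. A i - mean_cnd (N i) i \<le> \<delta> i"
       "\<And>i. A (Suc i) - mean_cnd (N i) (Suc i) \<le> \<delta> i"
    by metis
  define f where "f i = past_prob (N i) i" for i
  have f_int [simp]: "integrable M (f i)" for i by (simp add: f_def)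
  have [measurable]: "f i \<in> borel_measurable M" for i by (simp add: f_def)
  have f_bound [simp]: "0 \<le> f i x" "f i x \<le> 1" for i x by (simp_all add: f_def)

  \<comment> \<open>Both functions are compared at a common past length \<open>m\<close>; there they are ordered, and the
    integral of their difference is controlled by the convergence of \<open>A\<close>.\<close>
  have f_close: "(\<integral>x. \<bar>f i x - f j x\<bar> \<partial>M) \<le> \<delta> i + (A i - a) + 2 * \<delta> j" if "i \<le> j" for i j
  proof -
    define m where "m = max (N i) (N j)"
    have "(\<integral>x. \<bar>f i x - f j x\<bar> \<partial>M) \<le>
        (\<integral>x. \<bar>f i x - past_prob m i x\<bar> \<partial>M) + ((\<integral>x. \<bar>past_prob m i x - past_prob m j x\<bar> \<partial>M)
         + (\<integral>x. \<bar>past_prob m j x - f j x\<bar> \<partial>M))"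
      by (rule order_trans[OF L1_triangle[where g = "past_prob m i"]])
         (auto intro!: add_left_mono L1_triangle)
    moreover have "(\<integral>x. \<bar>f i x - past_prob m i x\<bar> \<partial>M) \<le> \<delta> i"
      using N(1)[of i m] by (simp add: f_def m_def abs_minus_commute)
    moreover have "(\<integral>x. \<bar>past_prob m j x - f j x\<bar> \<partial>M) \<le> \<delta> j"
      using N(1)[of j m] by (simp add: f_def m_def)
    moreover have "(\<integral>x. \<bar>past_prob m i x - past_prob m j x\<bar> \<partial>M) = mean_cnd m i - mean_cnd m j"
      by (subst L1_ordered) (auto simp: integral_past_prob past_prob_antimono that)
    moreover have "mean_cnd m i \<le> A i" by (rule le_A)
    moreover have "mean_cnd (N j) j \<le> mean_cnd m j" by (rule mean_cnd_mono) (simp add: m_def)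
    ultimately show ?thesis using N(2)[of j] a_le[of j] by linarith
  qed
  obtain r where r: "strict_mono r" "AE x in M. Cauchy (\<lambda>i. f (r i) x)"
  proof (rule cauchy_L1_AE_cauchy_subseq[of M f])
    show "integrable M (f n)" for n by simp
    fix e :: real assume "e > 0"
    then have e4: "e / 4 > 0" by simp
    have "\<forall>\<^sub>F i in sequentially. \<delta> i < e / 4"
      using \<delta>_lim e4 by (rule order_tendstoD(2))
    moreover have "\<forall>\<^sub>F i in sequentially. A i < a + e / 4"
      using a e4 by (intro order_tendstoD(2)) auto
    ultimately have "\<forall>\<^sub>F i in sequentially. \<delta> i < e / 4 \<and> A i < a + e / 4"
      by eventually_elim simp
    then obtain K where K: "\<And>i. i \<ge> K \<Longrightarrow> \<delta> i < e / 4" "\<And>i. i \<ge> K \<Longrightarrow> A i < a + e / 4"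
      unfolding eventually_sequentially by blast
    have *: "LINT x|M. norm (f i x - f j x) < e" if "i \<ge> K" "i \<le> j" for i j
      using f_close[OF that(2)] K(1)[of i] K(1)[of j] K(2)[of i] that by simp
    have "LINT x|M. norm (f i x - f j x) < e" if "i \<ge> K" "j \<ge> K" for i j
    proof (cases "i \<le> j")
      case False
      then show ?thesis using *[of j i] that by (simp add: abs_minus_commute)
    qed (use * that in blast)
    then show "\<exists>N. \<forall>i\<ge>N. \<forall>j\<ge>N. LINT x|M. norm (f i x - f j x) < e" by blast
  qed (use that in blast)
  define G where "G x = lim (\<lambda>i. f (r i) x)" for x
  have G_meas [measurable]: "G \<in> borel_measurable M"
    unfolding G_def[abs_def] by (rule borel_measurable_lim_metric) simp
  have fG: "AE x in M. (\<lambda>i. f (r i) x) \<longlonglongrightarrow> G x"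
    using r(2) by eventually_elim (simp add: G_def Cauchy_convergent_iff convergent_LIMSEQ_iff)
  have G_bound: "AE x in M. 0 \<le> G x \<and> G x \<le> 1"
    using fG by eventually_elim (auto intro: LIMSEQ_le_const LIMSEQ_le_const2)
  have fG_L1: "(\<lambda>i. \<integral>x. \<bar>f (r i) x - G x\<bar> \<partial>M) \<longlonglongrightarrow> 0"
  proof -
    have "(\<lambda>i. \<integral>x. \<bar>f (r i) x - G x\<bar> \<partial>M) \<longlonglongrightarrow> (\<integral>x. 0 \<partial>M)"
    proof (rule integral_dominated_convergence[where w = "\<lambda>_. 1"])
      show "AE x in M. (\<lambda>i. \<bar>f (r i) x - G x\<bar>) \<longlonglongrightarrow> 0"
        using fG by eventually_elim (auto intro!: tendsto_eq_intros)
      show "AE x in M. norm \<bar>f (r i) x - G x\<bar> \<le> 1" for i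
        using G_bound
      proof eventually_elim
        fix x assume "0 \<le> G x \<and> G x \<le> 1"
        then show "norm \<bar>f (r i) x - G x\<bar> \<le> 1"
          using f_bound(1)[of "r i" x] f_bound(2)[of "r i" x] by (simp add: abs_le_iff del: f_bound)
      qed
    qed auto
    then show ?thesis by simp
  qed
  have G_int [simp]: "integrable M G"
    by (rule integrable_const_bound[where B = 1]) (use G_bound in auto)
  have G_pos: "(\<integral>x. G x \<partial>M) > 0"
  proof -
    have "(\<integral>x. G x \<partial>M) \<ge> \<epsilon>0 - \<delta> (r i) - (\<integral>x. \<bar>f (r i) x - G x\<bar> \<partial>M)" for i
    proof -
      have "\<bar>(\<integral>x. f (r i) x \<partial>M) - (\<integral>x. G x \<partial>M)\<bar> \<le> (\<integral>x. \<bar>f (r i) x - G x\<bar> \<partial>M)"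
        using integral_abs_bound[of M "\<lambda>x. f (r i) x - G x"] by simp
      moreover have "(\<integral>x. f (r i) x \<partial>M) \<ge> \<epsilon>0 - \<delta> (r i)"
        using N(2)[of "r i"] A_gt[of "r i"] by (simp add: f_def integral_past_prob)
      ultimately show ?thesis by linarith
    qed
    moreover have "(\<lambda>i. \<epsilon>0 - \<delta> (r i) - (\<integral>x. \<bar>f (r i) x - G x\<bar> \<partial>M)) \<longlonglongrightarrow> \<epsilon>0 - 0 - 0"
      using LIMSEQ_subseq_LIMSEQ[OF \<delta>_lim r(1)] fG_L1 by (intro tendsto_intros) (auto simp: comp_def)
    ultimately have "\<epsilon>0 \<le> (\<integral>x. G x \<partial>M)"
      by (intro LIMSEQ_le_const2[of _ "\<epsilon>0"]) auto
    then show ?thesis using large(1) by simp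
  qed

  \<comment> \<open>\<open>h i\<close> is close to the shift of \<open>f i\<close> and, up to the factor \<open>past_prob (N i) 1\<close>, also to
    \<open>f i\<close> itself. The factor at most 1 costs little of the integral, whence both the invariance of
    the limit and the statement that the factor is close to 1.\<close>
  define \<eta> where "\<eta> i = A i - a + \<delta> i" for i
  have \<eta>_lim: "\<eta> \<longlonglongrightarrow> 0"
    unfolding \<eta>_def using a \<delta>_lim by (auto intro!: tendsto_eq_intros)
  define h where "h i x = past_prob (Suc (N i)) i (shift 1 x)" for i x
  have h_int [simp]: "integrable M (h i)" for i
    unfolding h_def[abs_def] by (rule integrable_shift) simp
  have h_integral: "(\<integral>x. h i x \<partial>M) = mean_cnd (Suc (N i)) i" for i
    using integral_shift[of "past_prob (Suc (N i)) i" 1] by (simp add: h_def integral_past_prob)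
  have fs_int [simp]: "integrable M (\<lambda>x. f i (shift 1 x))" for i
    by (rule integrable_shift) simp
  have hf: "past_prob (N i) 1 x * h i x = past_prob (N i) (Suc i) x" for i x
    unfolding h_def by (rule past_prob_Suc[symmetric])
  have drop_small: "mean_cnd (Suc (N i)) i - mean_cnd (N i) (Suc i) \<le> \<eta> i" for i
    using le_A[of "Suc (N i)" i] N(3)[of i] a_le[of "Suc i"] by (simp add: \<eta>_def)
  have h_shift: "(\<integral>x. \<bar>h i x - f i (shift 1 x)\<bar> \<partial>M) \<le> \<delta> i" for i
  proof -
    have "(\<integral>x. \<bar>h i x - f i (shift 1 x)\<bar> \<partial>M) = (\<integral>x. \<bar>past_prob (Suc (N i)) i x - f i x\<bar> \<partial>M)"
      unfolding h_def by (rule integral_shift[of "\<lambda>x. \<bar>past_prob (Suc (N i)) i x - f i x\<bar>"]) measurable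
    also have "\<dots> \<le> \<delta> i" using N(1)[of i "Suc (N i)"] by (simp add: f_def)
    finally show ?thesis .
  qed
  have h_f: "(\<integral>x. \<bar>h i x - f i x\<bar> \<partial>M) \<le> 2 * \<eta> i" for i
  proof -
    have "(\<integral>x. \<bar>h i x - f i x\<bar> \<partial>M) \<le> (\<integral>x. \<bar>h i x - past_prob (N i) (Suc i) x\<bar> \<partial>M) +
       (\<integral>x. \<bar>past_prob (N i) (Suc i) x - f i x\<bar> \<partial>M)"
      by (rule L1_triangle) auto
    also have "(\<integral>x. \<bar>h i x - past_prob (N i) (Suc i) x\<bar> \<partial>M) =
        mean_cnd (Suc (N i)) i - mean_cnd (N i) (Suc i)"
    proof -
      have "past_prob (N i) (Suc i) x \<le> h i x" for x
        unfolding hf[symmetric] by (rule mult_left_le_one_le) (auto simp: h_def)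
      then show ?thesis by (subst L1_ordered) (auto simp: h_integral integral_past_prob)
    qed
    also have "(\<integral>x. \<bar>past_prob (N i) (Suc i) x - f i x\<bar> \<partial>M) = (\<integral>x. \<bar>f i x - past_prob (N i) (Suc i) x\<bar> \<partial>M)"
      by (simp add: abs_minus_commute)
    also have "\<dots> = mean_cnd (N i) i - mean_cnd (N i) (Suc i)"
      by (subst L1_ordered) (auto simp: f_def integral_past_prob past_prob_antimono)
    finally show ?thesis
      using drop_small[of i] mean_cnd_mono[of "N i" "Suc (N i)" i] by simp
  qed
  have f_inv: "(\<integral>x. \<bar>f i (shift 1 x) - f i x\<bar> \<partial>M) \<le> \<delta> i + 2 * \<eta> i" for i
  proof -
    have "(\<integral>x. \<bar>f i (shift 1 x) - f i x\<bar> \<partial>M) \<le>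
      (\<integral>x. \<bar>f i (shift 1 x) - h i x\<bar> \<partial>M) + (\<integral>x. \<bar>h i x - f i x\<bar> \<partial>M)"
      by (rule L1_triangle) auto
    then show ?thesis using h_shift[of i] h_f[of i] by (simp add: abs_minus_commute)
  qed
  have G_inv: "AE x in M. G (shift 1 x) = G x"
  proof -
    have Gs_int [simp]: "integrable M (\<lambda>x. G (shift 1 x))" by (rule integrable_shift) simp
    have "(\<integral>x. \<bar>G (shift 1 x) - G x\<bar> \<partial>M) \<le> 2 * (\<integral>x. \<bar>f i x - G x\<bar> \<partial>M) + (\<delta> i + 2 * \<eta> i)" for i
    proof -
      have "(\<integral>x. \<bar>G (shift 1 x) - G x\<bar> \<partial>M) \<le>
        (\<integral>x. \<bar>G (shift 1 x) - f i (shift 1 x)\<bar> \<partial>M) + (\<integral>x. \<bar>f i (shift 1 x) - G x\<bar> \<partial>M)"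
        by (rule L1_triangle) auto
      moreover have "(\<integral>x. \<bar>f i (shift 1 x) - G x\<bar> \<partial>M) \<le>
        (\<integral>x. \<bar>f i (shift 1 x) - f i x\<bar> \<partial>M) + (\<integral>x. \<bar>f i x - G x\<bar> \<partial>M)"
        by (rule L1_triangle) auto
      moreover have "(\<integral>x. \<bar>G (shift 1 x) - f i (shift 1 x)\<bar> \<partial>M) = (\<integral>x. \<bar>G x - f i x\<bar> \<partial>M)"
        by (rule integral_shift[of "\<lambda>x. \<bar>G x - f i x\<bar>"]) measurable
      ultimately show ?thesis using f_inv[of i] by (simp add: abs_minus_commute)
    qed
    then have le: "(\<integral>x. \<bar>G (shift 1 x) - G x\<bar> \<partial>M) \<le>
        2 * (\<integral>x. \<bar>f (r i) x - G x\<bar> \<partial>M) + (\<delta> (r i) + 2 * \<eta> (r i))" for i .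
    have "(\<lambda>i. 2 * (\<integral>x. \<bar>f (r i) x - G x\<bar> \<partial>M) + (\<delta> (r i) + 2 * \<eta> (r i))) \<longlonglongrightarrow> 2 * 0 + (0 + 2 * 0)"
      using LIMSEQ_subseq_LIMSEQ[OF \<delta>_lim r(1)] LIMSEQ_subseq_LIMSEQ[OF \<eta>_lim r(1)] fG_L1
      by (intro tendsto_intros) (auto simp: comp_def)
    then have "(\<integral>x. \<bar>G (shift 1 x) - G x\<bar> \<partial>M) \<le> 0"
      using le by (intro LIMSEQ_le_const[of _ 0]) auto
    then have "(\<integral>x. \<bar>G (shift 1 x) - G x\<bar> \<partial>M) = 0"
      by (intro antisym integral_nonneg_AE) auto
    then have "AE x in M. \<bar>G (shift 1 x) - G x\<bar> = 0"
      by (subst (asm) integral_nonneg_eq_0_iff_AE) auto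
    then show ?thesis by simp
  qed
  have G_pos_AE: "AE x in M. G x > 0"
    by (rule ergodic_AE_pos[OF erg G_meas G_inv G_pos])

  \<comment> \<open>\<open>g i\<close> is the conditional probability that the next symbol is another one. Its product with
    \<open>G\<close> tends to 0 in mean, and \<open>G\<close> is positive.\<close>
  define g where "g i x = 1 - past_prob (N i) 1 x" for i x
  have g_bound [simp]: "0 \<le> g i x" "g i x \<le> 1" for i x by (simp_all add: g_def)
  have g_meas [measurable]: "g i \<in> borel_measurable M" for i unfolding g_def[abs_def] by measurable
  have g_int [simp]: "integrable M (g i)" for i unfolding g_def[abs_def] by simp
  have prod_int [simp]: "integrable M (\<lambda>x. g i x * G x)" for i
    by (rule integrable_const_bound[where B = 1]) (use G_bound in \<open>auto simp: abs_mult intro!: mult_le_one\<close>)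
  have gG_le: "(\<integral>x. g i x * G x \<partial>M) \<le> 3 * \<eta> i + (\<integral>x. \<bar>f i x - G x\<bar> \<partial>M)" for i
  proof -
    have gh: "g i x * h i x = h i x - past_prob (N i) (Suc i) x" for x
      using hf[of i x] by (simp add: g_def algebra_simps)
    have "(\<integral>x. g i x * G x \<partial>M) \<le>
        (\<integral>x. g i x * h i x + \<bar>h i x - f i x\<bar> + \<bar>f i x - G x\<bar> \<partial>M)"
    proof (rule integral_mono)
      show "g i x * G x \<le> g i x * h i x + \<bar>h i x - f i x\<bar> + \<bar>f i x - G x\<bar>" for x
      proof -
        have "g i x * (G x - h i x) \<le> g i x * \<bar>G x - h i x\<bar>" by (intro mult_left_mono) auto
        also have "\<dots> \<le> 1 * \<bar>G x - h i x\<bar>" by (intro mult_right_mono) auto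
        also have "\<dots> \<le> \<bar>h i x - f i x\<bar> + \<bar>f i x - G x\<bar>" by simp
        finally show ?thesis by (simp add: algebra_simps)
      qed
    qed (auto simp: gh)
    also have "\<dots> = (mean_cnd (Suc (N i)) i - mean_cnd (N i) (Suc i)) + (\<integral>x. \<bar>h i x - f i x\<bar> \<partial>M)
        + (\<integral>x. \<bar>f i x - G x\<bar> \<partial>M)"
      by (simp add: gh h_integral integral_past_prob)
    finally show ?thesis using drop_small[of i] h_f[of i] by simp
  qed
  have gG_lim: "(\<lambda>i. 3 * \<eta> (r i) + (\<integral>x. \<bar>f (r i) x - G x\<bar> \<partial>M)) \<longlonglongrightarrow> 0"
    using LIMSEQ_subseq_LIMSEQ[OF \<eta>_lim r(1)] fG_L1 by (auto intro!: tendsto_eq_intros simp: comp_def)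
  \<comment> \<open>\<open>u k\<close> is supported on the region where \<open>G\<close> is below \<open>1 / k\<close>.\<close>
  define u where "u k x = max 0 (1 - real k * G x)" for k x
  have u_meas [measurable]: "u k \<in> borel_measurable M" for k unfolding u_def[abs_def] by measurable
  have u_int [simp]: "integrable M (u k)" for k
    by (rule integrable_const_bound[where B = 1]) (use G_bound in \<open>auto simp: u_def\<close>)
  have u_lim: "(\<lambda>k. \<integral>x. u k x \<partial>M) \<longlonglongrightarrow> 0"
  proof -
    have "(\<lambda>k. \<integral>x. u k x \<partial>M) \<longlonglongrightarrow> (\<integral>x. 0 \<partial>M)"
    proof (rule integral_dominated_convergence[where w = "\<lambda>_. 1"])
      show "AE x in M. (\<lambda>k. u k x) \<longlonglongrightarrow> 0"
        using G_pos_AE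
      proof eventually_elim
        fix x assume "G x > 0"
        then obtain k0 where k0: "real k0 * G x > 1" using reals_Archimedean3 by blast
        have "u k x = 0" if "k \<ge> k0" for k
        proof -
          have "real k0 * G x \<le> real k * G x" using that \<open>G x > 0\<close> by (intro mult_right_mono) auto
          then show ?thesis using k0 by (simp add: u_def)
        qed
        then have "\<forall>\<^sub>F k in sequentially. u k x = 0" unfolding eventually_sequentially by blast
        then show "(\<lambda>k. u k x) \<longlonglongrightarrow> 0" by (rule tendsto_eventually)
      qed
      show "AE x in M. norm (u k x) \<le> 1" for k
        using G_bound by eventually_elim (auto simp: u_def)
    qed auto
    then show ?thesis by simp
  qed
  have g_le: "(\<integral>x. g i x \<partial>M) \<le> real k * (\<integral>x. g i x * G x \<partial>M) + (\<integral>x. u k x \<partial>M)" for i k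
  proof -
    have "(\<integral>x. g i x \<partial>M) \<le> (\<integral>x. real k * (g i x * G x) + u k x \<partial>M)"
    proof (rule integral_mono)
      show "g i x \<le> real k * (g i x * G x) + u k x" for x
      proof -
        have "g i x * (1 - real k * G x) \<le> g i x * u k x" by (intro mult_left_mono) (auto simp: u_def)
        also have "\<dots> \<le> 1 * u k x" by (intro mult_right_mono) (auto simp: u_def)
        finally show ?thesis by (simp add: algebra_simps)
      qed
    qed auto
    then show ?thesis by simp
  qed
  have small: "\<exists>n. 1 - mean_cnd n 1 < e" if "e > 0" for e
  proof -
    from that have e: "e / 2 > 0" by simp
    obtain k where k: "(\<integral>x. u k x \<partial>M) < e / 2"
      using order_tendstoD(2)[OF u_lim e] by (auto simp: eventually_sequentially)
    have "(\<lambda>i. real k * (3 * \<eta> (r i) + (\<integral>x. \<bar>f (r i) x - G x\<bar> \<partial>M))) \<longlonglongrightarrow> real k * 0"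
      by (intro tendsto_mult_left gG_lim)
    then obtain i where i: "real k * (3 * \<eta> (r i) + (\<integral>x. \<bar>f (r i) x - G x\<bar> \<partial>M)) < e / 2"
      using order_tendstoD(2)[OF _ e] by (fastforce simp: eventually_sequentially)
    have "1 - mean_cnd (N (r i)) 1 = (\<integral>x. g (r i) x \<partial>M)"
      by (simp add: g_def integral_past_prob)
    also have "\<dots> \<le> real k * (\<integral>x. g (r i) x * G x \<partial>M) + (\<integral>x. u k x \<partial>M)" by (rule g_le)
    also have "\<dots> \<le> real k * (3 * \<eta> (r i) + (\<integral>x. \<bar>f (r i) x - G x\<bar> \<partial>M)) + (\<integral>x. u k x \<partial>M)"
      by (intro add_right_mono mult_left_mono gG_le) auto
    also have "\<dots> < e" using i k by simp
    finally show ?thesis by blast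
  qed
  show ?thesis
  proof (rule LIMSEQ_I)
    fix e :: real assume "e > 0"
    with small obtain n0 where "1 - mean_cnd n0 1 < e" by blast
    then have "norm (mean_cnd n 1 - 1) < e" if "n \<ge> n0" for n
      using mean_cnd_mono[OF that, of 1] mean_cnd_le_1[of n 1] by simp
    then show "\<exists>n0. \<forall>n\<ge>n0. norm (mean_cnd n 1 - 1) < e" by blast
  qed
qed

end

text \<open>
  The entropy function \<open>- c * ln c\<close> is at most \<open>2 * sqrt (c * (1 - c))\<close>, so it is small in the mean
  once \<open>c * (1 - c)\<close> is.
\<close>

lemma neg_mult_ln_le:
  fixes c \<kappa> :: real
  assumes "0 \<le> c" "c \<le> 1" "\<kappa> > 0"
  shows "- (c * ln c) \<le> \<kappa> + 4 * (c * (1 - c)) / \<kappa>"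
proof (cases "c = 0")
  case False
  define y where "y = 2 * sqrt c * (1 - c)"
  have c: "c > 0" using assms False by simp
  have "ln (1 / sqrt c) \<le> 1 / sqrt c - 1" using c by (intro ln_le_minus_one) auto
  then have "- ln c \<le> 2 * (1 / sqrt c - 1)" using c by (simp add: ln_div ln_sqrt)
  then have "c * - ln c \<le> c * (2 * (1 / sqrt c - 1))" using c by (intro mult_left_mono) auto
  also have "\<dots> = 2 * sqrt c * (1 - sqrt c)"
  proof -
    define b where "b = sqrt c"
    have "b > 0" "c = b * b" using c by (simp_all add: b_def)
    then show ?thesis unfolding b_def[symmetric] by (simp add: field_simps)
  qed
  also have "\<dots> \<le> y"
    unfolding y_def using assms c by (intro mult_left_mono diff_left_mono) (auto simp: real_le_rsqrt power2_eq_square mult_left_le)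
  finally have 1: "- (c * ln c) \<le> y" by simp
  have "y \<le> \<kappa> + y\<^sup>2 / \<kappa>"
    using abs_le_add_square_div[OF assms(3), of y] by linarith
  moreover have "y\<^sup>2 \<le> 4 * (c * (1 - c))"
  proof -
    have "y\<^sup>2 = 4 * (c * (1 - c)) * (1 - c)" using c by (simp add: y_def power_mult_distrib power2_eq_square)
    also have "\<dots> \<le> 4 * (c * (1 - c))" using assms by (intro mult_left_le) auto
    finally show ?thesis .
  qed
  then have "y\<^sup>2 / \<kappa> \<le> 4 * (c * (1 - c)) / \<kappa>" using assms by (intro divide_right_mono) auto
  ultimately show ?thesis using 1 by linarith
qed (use assms in simp)

lemma cesaro_null:
  fixes H :: "nat \<Rightarrow> real"
  assumes "\<And>n. 0 \<le> H n" "(\<lambda>n. H (Suc n) - H n) \<longlonglongrightarrow> 0"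
  shows "(\<lambda>n. H n / real n) \<longlonglongrightarrow> 0"
proof (rule LIMSEQ_I)
  fix e :: real assume e: "e > 0"
  then have "\<forall>\<^sub>F n in sequentially. H (Suc n) - H n < e / 2"
    using assms(2) by (intro order_tendstoD(2)) auto
  then obtain N where N: "\<And>n. n \<ge> N \<Longrightarrow> H (Suc n) - H n < e / 2"
    unfolding eventually_sequentially by blast
  have lin: "H (N + k) \<le> H N + real k * (e / 2)" for k
  proof (induction k)
    case (Suc k)
    then show ?case using N[of "N + k"] by (simp add: algebra_simps add_divide_distrib)
  qed simp
  obtain K where K: "H N < real K * (e / 2)" using e reals_Archimedean3[of "e / 2"] by auto
  have "norm (H n / real n - 0) < e" if n: "n \<ge> N + K + 1" for n
  proof -
    have "H n \<le> H N + real (n - N) * (e / 2)" using lin[of "n - N"] n by simp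
    also have "\<dots> \<le> H N + real n * (e / 2)" using e by (intro add_left_mono mult_right_mono) auto
    also have "\<dots> < real K * (e / 2) + real n * (e / 2)" using K by simp
    also have "\<dots> \<le> real n * (e / 2) + real n * (e / 2)" using e n by (intro add_right_mono mult_right_mono) auto
    finally have "H n < real n * e" by (simp add: mult.commute)
    moreover have "real n > 0" using n by simp
    ultimately show ?thesis using assms(1)[of n] by (simp add: divide_less_eq mult.commute)
  qed
  then show "\<exists>no. \<forall>n\<ge>no. norm (H n / real n - 0) < e" by blast
qed

context stationary_process begin

lemma block_entropy_words: "block_entropy M n = (\<Sum>w\<in>words n. - (prb w * ln (prb w))) / ln 2"
proof -
  have range: "range (\<lambda>x :: int \<Rightarrow> 'p. block x n) = words n"
  proof -
    have "w \<in> range (\<lambda>x. block x n)" if "w \<in> words n" for w :: "'p list"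
      using that block_point_of[of w] unfolding words_def by (metis (mono_tags) mem_Collect_eq rangeI)
    then show ?thesis by auto
  qed
  have eq: "{x. block x n = w} = word_cyl w" if "w \<in> words n" for w :: "'p list"
    using that by (simp add: word_cyl_def words_def)
  have "block_entropy M n = - (\<Sum>w\<in>words n. prb w * log 2 (prb w))"
    by (subst block_entropy_eq[OF prob_space_axioms sets_M]) (simp add: range eq prb_def)
  then show ?thesis
    by (simp add: log_def sum_divide_distrib sum_negf)
qed

text \<open>
  The increments of the block entropy are conditional entropies of the next symbol, which vanish if
  the next symbol is almost determined by the past; the entropy is the limit of their averages.
\<close>

lemma process_entropy_zero:
  assumes "(\<lambda>n. mean_cnd n 1) \<longlonglongrightarrow> 1"
  shows "process_entropy M = 0"
proof -
  define H where "H n = (\<Sum>w\<in>words n. - (prb w * ln (prb w)))" for n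
  have H_nonneg: "0 \<le> H n" for n
    unfolding H_def
  proof (intro sum_nonneg)
    fix w :: "'p list"
    show "0 \<le> - (prb w * ln (prb w))"
      by (cases "prb w = 0") (auto simp: mult_nonneg_nonpos less_le)
  qed
  have chain: "- (prb (w @ a) * ln (prb (w @ a))) = prb (w @ a) * - ln (prb w) + prb w * - (cnd w a * ln (cnd w a))" for w a
  proof (cases "prb w = 0 \<or> cnd w a = 0")
    case False
    then have "prb w > 0" "cnd w a > 0" by (auto simp: less_le)
    then show ?thesis by (simp add: prb_append ln_mult algebra_simps)
  qed (auto simp: prb_append)
  have inc: "H (Suc n) - H n = (\<Sum>w\<in>words n. \<Sum>a\<in>words 1. prb w * - (cnd w a * ln (cnd w a)))" for n
  proof -
    have "H (Suc n) = (\<Sum>w\<in>words n. \<Sum>a\<in>words 1. - (prb (w @ a) * ln (prb (w @ a))))"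
      unfolding H_def using sum_words_add[of _ n 1] by simp
    also have "\<dots> = (\<Sum>w\<in>words n. (\<Sum>a\<in>words 1. prb (w @ a)) * - ln (prb w)) +
        (\<Sum>w\<in>words n. \<Sum>a\<in>words 1. prb w * - (cnd w a * ln (cnd w a)))"
      unfolding chain sum.distrib sum_distrib_right ..
    also have "(\<Sum>w\<in>words n. (\<Sum>a\<in>words 1. prb (w @ a)) * - ln (prb w)) = H n"
      by (simp add: prb_append_sum H_def)
    finally show ?thesis by simp
  qed
  have inc_nonneg: "0 \<le> H (Suc n) - H n" for n
    unfolding inc
  proof (intro sum_nonneg mult_nonneg_nonneg)
    fix w a :: "'p list"
    show "0 \<le> - (cnd w a * ln (cnd w a))"
      by (cases "cnd w a = 0") (auto simp: mult_nonneg_nonpos less_le)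
  qed auto
  define k where "k = real (card (words 1 :: 'p list set))"
  have inc_le: "H (Suc n) - H n \<le> k * \<kappa> + 4 * (1 - mean_cnd n 1) / \<kappa>" if "\<kappa> > 0" for n \<kappa>
  proof -
    have "H (Suc n) - H n \<le> (\<Sum>w\<in>words n. \<Sum>a\<in>words 1. prb w * (\<kappa> + 4 * (cnd w a * (1 - cnd w a)) / \<kappa>))"
      unfolding inc using that by (intro sum_mono mult_left_mono neg_mult_ln_le) auto
    also have "\<dots> = (\<Sum>w\<in>words n. prb w) * (k * \<kappa>) +
        4 / \<kappa> * ((\<Sum>w\<in>words n. \<Sum>a\<in>words 1. prb (w @ a)) - (\<Sum>w\<in>words n. \<Sum>a\<in>words 1. prb (w @ a) * cnd w a))"
      by (simp add: prb_append algebra_simps sum.distrib sum_subtractf sum_distrib_left sum_distrib_right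
            sum_divide_distrib k_def diff_divide_distrib)
    also have "\<dots> = k * \<kappa> + 4 * (1 - mean_cnd n 1) / \<kappa>"
      by (simp add: prb_append_sum sum_prb_words mean_cnd_alt[symmetric])
    finally show ?thesis .
  qed
  have "(\<lambda>n. H (Suc n) - H n) \<longlonglongrightarrow> 0"
  proof (rule LIMSEQ_I)
    fix e :: real assume e: "e > 0"
    define \<kappa> where "\<kappa> = e / (2 * (k + 1))"
    have k: "k \<ge> 0" by (simp add: k_def)
    then have \<kappa>: "\<kappa> > 0" using e by (simp add: \<kappa>_def)
    have k\<kappa>: "k * \<kappa> < e / 2" using e k by (simp add: \<kappa>_def field_simps)
    have lim: "(\<lambda>n. k * \<kappa> + 4 * (1 - mean_cnd n 1) / \<kappa>) \<longlonglongrightarrow> k * \<kappa> + 4 * (1 - 1) / \<kappa>"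
      using \<kappa> by (intro tendsto_intros assms) auto
    then have "\<forall>\<^sub>F n in sequentially. k * \<kappa> + 4 * (1 - mean_cnd n 1) / \<kappa> < e"
      using k\<kappa> e by (intro order_tendstoD(2)[OF lim]) auto
    then have "\<forall>\<^sub>F n in sequentially. norm (H (Suc n) - H n - 0) < e"
    proof eventually_elim
      case (elim n)
      then show ?case using inc_le[OF \<kappa>, of n] inc_nonneg[of n] by simp
    qed
    then show "\<exists>n0. \<forall>n\<ge>n0. norm (H (Suc n) - H n - 0) < e"
      unfolding eventually_sequentially .
  qed
  then have "(\<lambda>n. H n / real n) \<longlonglongrightarrow> 0"
    by (rule cesaro_null[OF H_nonneg])
  then have "(\<lambda>n. H n / real n / ln 2) \<longlonglongrightarrow> 0 / ln 2"
    by (intro tendsto_divide) auto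
  then have "(\<lambda>n. block_entropy M n / real n) \<longlonglongrightarrow> 0"
    by (simp add: block_entropy_words H_def[symmetric] field_simps)
  then show ?thesis
    unfolding process_entropy_def by (rule limI)
qed

lemma mean_cnd_vanishes:
  assumes "ergodic_map M left_shift" "process_entropy M > 0" "\<epsilon> > 0"
  shows "\<exists>s. \<forall>n. mean_cnd n s \<le> \<epsilon>"
proof (rule ccontr)
  assume "\<not> ?thesis"
  then have "\<exists>n. mean_cnd n s > \<epsilon>" for s by (metis not_le)
  from next_symbol_predictable[OF assms(1,3) this] have "process_entropy M = 0"
    by (rule process_entropy_zero)
  with assms(2) show False by simp
qed

end

text \<open>
  Some point visits \<open>D\<close> twice within fewer than \<open>s\<close> steps, so that a word of length \<open>s\<close> read after the
  first visit may still be incomplete at the end of the second one.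
\<close>

definition short_return :: "'p list \<Rightarrow> nat \<Rightarrow> bool" where
  "short_return D s \<longleftrightarrow> (\<exists>k x. 0 < k \<and> k < s \<and> block x (length D) = D \<and> block (shift (int k) x) (length D) = D)"

lemma short_return_periodic:
  assumes "short_return D s"
  obtains k where "0 < k" "k < s" "\<And>i. i + k < length D \<Longrightarrow> D ! (i + k) = D ! i"
proof -
  from assms obtain k x where k: "0 < k" "k < s" and
    x: "block x (length D) = D" "block (shift (int k) x) (length D) = D"
    unfolding short_return_def by blast
  have "D ! (i + k) = D ! i" if "i + k < length D" for i
    using that x by (auto simp: block_eq_word_iff shift_def)
  with k show ?thesis using that by blast
qed

text \<open>
  A word that overlaps itself with offset \<open>k\<close> is periodic with period \<open>k\<close>, hence determined by its
  first \<open>k\<close> symbols. The bound does not depend on the length of the words.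
\<close>

lemma card_short_return:
  "card {D \<in> words d. short_return (D :: 'p::finite list) s} \<le> s * CARD('p) ^ s"
proof -
  define Per where "Per k = {D \<in> words d. \<forall>i. i + k < length D \<longrightarrow> (D :: 'p list) ! (i + k) = D ! i}" for k
  have card_Per: "card (Per k) \<le> CARD('p) ^ s" if k: "0 < k" "k < s" for k
  proof -
    have "inj_on (take k) (Per k)"
    proof (rule inj_onI)
      fix D E assume DE: "D \<in> Per k" "E \<in> Per k" "take k D = take k E"
      have len: "length D = d" "length E = d" using DE by (auto simp: Per_def words_def)
      have "i < d \<longrightarrow> D ! i = E ! i" for i
      proof (induction i rule: less_induct)
        case (less i)
        show ?case
        proof (cases "i < k")
          case True
          then show ?thesis using DE(3) by (metis nth_take)
        next
          case False
          then have "i = (i - k) + k" "i - k < i" using k by auto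
          then show ?thesis using DE len less[of "i - k"] unfolding Per_def
            by (metis (mono_tags, lifting) less_trans mem_Collect_eq)
        qed
      qed
      then show "D = E" using len by (auto intro: nth_equalityI)
    qed
    then have "card (Per k) = card (take k ` Per k)" by (simp add: card_image)
    also have "\<dots> \<le> card (words (min k d) :: 'p list set)"
      by (intro card_mono) (auto simp: Per_def words_def finite_words[unfolded words_def])
    also have "\<dots> \<le> CARD('p) ^ s"
      unfolding card_words using k by (intro power_increasing) (auto simp: Suc_leI)
    finally show ?thesis .
  qed
  have "{D \<in> words d. short_return (D :: 'p list) s} \<subseteq> (\<Union>k\<in>{1..<s}. Per k)"
  proof
    fix D :: "'p list" assume D: "D \<in> {D \<in> words d. short_return D s}"
    then obtain k where "0 < k" "k < s" "\<And>i. i + k < length D \<Longrightarrow> D ! (i + k) = D ! i"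
      by (auto elim: short_return_periodic)
    with D have "k \<in> {1..<s}" "D \<in> Per k" by (auto simp: Per_def)
    then show "D \<in> (\<Union>k\<in>{1..<s}. Per k)" by blast
  qed
  then have "card {D \<in> words d. short_return (D :: 'p list) s} \<le> card (\<Union>k\<in>{1..<s}. Per k)"
    by (intro card_mono finite_UN_I) (auto simp: Per_def)
  also have "\<dots> \<le> (\<Sum>k\<in>{1..<s}. card (Per k))"
    by (rule card_UN_le) simp
  also have "\<dots> \<le> (\<Sum>k\<in>{1..<s}. CARD('p) ^ s)"
    by (intro sum_mono card_Per) auto
  also have "\<dots> \<le> s * CARD('p) ^ s" by simp
  finally show ?thesis .
qed

text \<open>
  The number of such words stays bounded, while the probability of each single word tends to 0.
\<close>

lemma (in stationary_process) short_return_negligible: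
  assumes "ergodic_map M left_shift" "process_entropy M > 0" "\<epsilon> > 0"
  shows "\<exists>d0. \<forall>d\<ge>d0. (\<Sum>D | D \<in> words d \<and> short_return D s. prb D) \<le> \<epsilon>"
proof -
  define c where "c = real (s * CARD('p) ^ s) + 1"
  have c: "c > 0" by (simp add: c_def add_nonneg_pos)
  from mean_cnd_vanishes[OF assms(1,2), of "(\<epsilon> / c)\<^sup>2"] c assms(3) obtain d0 where
    d0: "\<And>n. mean_cnd n d0 \<le> (\<epsilon> / c)\<^sup>2" by auto
  have "(\<Sum>D | D \<in> words d \<and> short_return D s. prb D) \<le> \<epsilon>" if d: "d \<ge> d0" for d
  proof -
    have "prb D \<le> \<epsilon> / c" if "D \<in> words d" for D
    proof (rule power2_le_imp_le)
      have "(prb D)\<^sup>2 \<le> (\<Sum>D\<in>words d. (prb D)\<^sup>2)"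
        using that by (intro member_le_sum) auto
      also have "\<dots> = mean_cnd 0 d"
        unfolding mean_cnd_alt by (simp add: words_def cnd_def power2_eq_square)
      also have "\<dots> \<le> (\<epsilon> / c)\<^sup>2"
        using mean_cnd_antimono[OF d, of 0] d0[of 0] by simp
      finally show "(prb D)\<^sup>2 \<le> (\<epsilon> / c)\<^sup>2" .
    qed (use c assms in simp)
    then have "(\<Sum>D | D \<in> words d \<and> short_return D s. prb D) \<le>
        real (card {D \<in> words d. short_return (D :: 'p list) s}) * (\<epsilon> / c)"
      by (intro sum_bounded_above) auto
    also have "\<dots> \<le> c * (\<epsilon> / c)"
      using card_short_return[of d s, where ?'p = 'p] c assms(3) unfolding c_def
      by (intro mult_right_mono) (auto simp del: of_nat_mult)
    finally show ?thesis using c by simp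
  qed
  then show ?thesis by blast
qed

section \<open>Visits to a word and the words that follow them\<close>

definition visit :: "'p list \<Rightarrow> nat \<Rightarrow> (int \<Rightarrow> 'p) \<Rightarrow> bool" where
  "visit D i x \<longleftrightarrow> block (shift (int i) x) (length D) = D"

definition visits :: "'p list \<Rightarrow> nat \<Rightarrow> (int \<Rightarrow> 'p) \<Rightarrow> nat" where
  "visits D i x = card {j. j < i \<and> visit D j x}"

definition follows :: "'p list \<Rightarrow> 'p list \<Rightarrow> nat \<Rightarrow> (int \<Rightarrow> 'p) \<Rightarrow> bool" where
  "follows D F i x \<longleftrightarrow> block (shift (int (i + length D)) x) (length F) = F"

text \<open>
  Only the first \<open>K\<close> visits are taken into account; this keeps the martingales below bounded.
\<close>

definition active :: "'p list \<Rightarrow> nat \<Rightarrow> nat \<Rightarrow> (int \<Rightarrow> 'p) \<Rightarrow> bool" where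
  "active D K i x \<longleftrightarrow> visit D i x \<and> visits D i x < K"

definition actives :: "'p list \<Rightarrow> nat \<Rightarrow> nat \<Rightarrow> (int \<Rightarrow> 'p) \<Rightarrow> nat" where
  "actives D K i x = card {j. j < i \<and> active D K j x}"

definition missed :: "'p list \<Rightarrow> nat \<Rightarrow> 'p list \<Rightarrow> nat \<Rightarrow> (int \<Rightarrow> 'p) \<Rightarrow> bool" where
  "missed D K F i x \<longleftrightarrow> (\<forall>j<i. active D K j x \<longrightarrow> \<not> follows D F j x)"

lemma card_less_Suc_Collect:
  "card {j. j < Suc i \<and> P j} = card {j. j < i \<and> P j} + (if P i then 1 else 0)"
proof -
  have "{j. j < Suc i \<and> P j} = (if P i then insert i {j. j < i \<and> P j} else {j. j < i \<and> P j})"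
    by (auto simp: less_Suc_eq)
  then show ?thesis by simp
qed

lemma visits_0 [simp]: "visits D 0 x = 0"
  by (simp add: visits_def)

lemma visits_Suc: "visits D (Suc i) x = visits D i x + (if visit D i x then 1 else 0)"
  unfolding visits_def by (rule card_less_Suc_Collect)

lemma actives_0 [simp]: "actives D K 0 x = 0"
  by (simp add: actives_def)

lemma actives_Suc: "actives D K (Suc i) x = actives D K i x + (if active D K i x then 1 else 0)"
  unfolding actives_def by (rule card_less_Suc_Collect)

lemma actives_eq_min: "actives D K i x = min (visits D i x) K"
  by (induction i) (auto simp: actives_Suc visits_Suc active_def)

lemma visits_mono: "i \<le> j \<Longrightarrow> visits D i x \<le> visits D j x"
  unfolding visits_def by (rule card_mono) auto

lemma missed_0 [simp]: "missed D K F 0 x"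
  by (simp add: missed_def)

lemma missed_Suc: "missed D K F (Suc i) x \<longleftrightarrow> missed D K F i x \<and> (active D K i x \<longrightarrow> \<not> follows D F i x)"
  by (auto simp: missed_def less_Suc_eq)

lemma follows_unique: "length F = length F' \<Longrightarrow> follows D F i x \<Longrightarrow> follows D F' i x \<Longrightarrow> F = F'"
  by (simp add: follows_def)

lemma block_shift_cong:
  assumes "block x N = block y N" "j + n \<le> N"
  shows "block (shift (int j) x) n = block (shift (int j) y) n"
  unfolding block_eq_iff
proof (intro allI impI)
  fix i assume "i < n"
  then have "x (int (i + j)) = y (int (i + j))"
    using assms unfolding block_eq_iff by (auto simp del: of_nat_add)
  then show "shift (int j) x (int i) = shift (int j) y (int i)" by (simp add: shift_def)
qed

lemma visit_cong: "block x N = block y N \<Longrightarrow> i + length D \<le> N \<Longrightarrow> visit D i x = visit D i y"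
  using block_shift_cong[of x N y i "length D"] by (simp add: visit_def)

lemma follows_cong:
  "block x N = block y N \<Longrightarrow> i + length D + length F \<le> N \<Longrightarrow> follows D F i x = follows D F i y"
  using block_shift_cong[of x N y "i + length D" "length F"] by (simp add: follows_def)

lemma visits_cong:
  assumes "block x N = block y N" "i + length D \<le> N + 1"
  shows "visits D i x = visits D i y"
proof -
  have "{j. j < i \<and> visit D j x} = {j. j < i \<and> visit D j y}"
    using visit_cong[OF assms(1)] assms(2) by auto
  then show ?thesis by (simp add: visits_def)
qed

lemma active_cong:
  "block x N = block y N \<Longrightarrow> i + length D \<le> N \<Longrightarrow> active D K i x = active D K i y"
  using visit_cong[of x N y i D] visits_cong[of x N y i D] by (simp add: active_def)

lemma actives_cong:
  "block x N = block y N \<Longrightarrow> i + length D \<le> N + 1 \<Longrightarrow> actives D K i x = actives D K i y"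
  using visits_cong[of x N y i D] by (simp add: actives_eq_min)

lemma missed_cong:
  assumes "block x N = block y N" "i + length D + length F \<le> N + 1"
  shows "missed D K F i x = missed D K F i y"
proof -
  have "active D K j x = active D K j y \<and> follows D F j x = follows D F j y" if "j < i" for j
    using active_cong[OF assms(1), of j D K] follows_cong[OF assms(1), of j D F] assms(2) that by auto
  then show ?thesis by (auto simp: missed_def)
qed

text \<open>
  Without short returns, the word following an earlier visit has been read completely by the end of
  the current one. Hence \<open>missed\<close> is decided by the past of the word that follows the current visit.
\<close>

lemma missed_cong_visit:
  assumes "block x (i + length D) = block y (i + length D)" "visit D i x" "visit D i y"
    and "\<not> short_return D (length F)"
  shows "missed D K F i x = missed D K F i y"
proof -
  have gap: "j + length F \<le> i" if "visit D j z" "visit D i z" "j < i" for j z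
  proof (rule ccontr)
    assume "\<not> j + length F \<le> i"
    then have "short_return D (length F)"
      using that unfolding short_return_def visit_def
      by (intro exI[of _ "i - j"] exI[of _ "shift (int j) z"]) (auto simp: of_nat_diff)
    with assms(4) show False by simp
  qed
  have "active D K j x \<and> follows D F j x \<longleftrightarrow> active D K j y \<and> follows D F j y" if "j < i" for j
  proof -
    have act: "active D K j x = active D K j y"
      using active_cong[OF assms(1), of j D K] that by simp
    show ?thesis
    proof (cases "active D K j x")
      case True
      then have "j + length F \<le> i" using gap[of j x] assms(2) that by (simp add: active_def)
      then show ?thesis using act follows_cong[OF assms(1), of j D F] by simp
    qed (use act in simp)
  qed
  then show ?thesis unfolding missed_def by blast
qed

context stationary_process begin

lemma integrable_local:
  fixes f :: "(int \<Rightarrow> 'p) \<Rightarrow> real"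
  assumes "\<And>x y. block x N = block y N \<Longrightarrow> f x = f y"
  shows "integrable M f"
proof -
  have "f x = f (point_of (block x N))" for x
    by (rule assms) (use block_point_of[of "block x N"] in simp)
  then have "f = (\<lambda>x. (f \<circ> point_of) (block x N))" by auto
  then show ?thesis using integrable_block by metis
qed

text \<open>
  On a visit to \<open>D\<close> at time \<open>i\<close> the function \<open>f\<close> depends only on the word \<open>u\<close> read before, and its
  value can be read off at the point \<open>point_of (u @ D)\<close>.
\<close>

lemma decoupling_aux:
  fixes f :: "(int \<Rightarrow> 'p) \<Rightarrow> real"
  assumes loc: "\<And>x y. block x (i + length D) = block y (i + length D) \<Longrightarrow> visit D i x \<Longrightarrow> visit D i y \<Longrightarrow> f x = f y"
  shows "integrable M (\<lambda>x. f x * of_bool (visit D i x) * of_bool (follows D F i x))"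
    and "(\<integral>x. f x * of_bool (visit D i x) * of_bool (follows D F i x) \<partial>M) =
      (\<Sum>u\<in>words i. f (point_of (u @ D)) * prb (u @ D @ F))"
proof -
  have eq: "f x * of_bool (visit D i x) * of_bool (follows D F i x) =
     (\<Sum>u\<in>words i. f (point_of (u @ D)) * indicator (word_cyl (u @ D @ F)) x)" for x
  proof -
    have "(\<Sum>u\<in>words i. f (point_of (u @ D)) * indicator (word_cyl (u @ D @ F)) x) =
       (\<Sum>u\<in>words i. (f (point_of (u @ D)) * indicator (word_cyl (D @ F)) (shift (int i) x)) * indicator (word_cyl u) x)"
      by (rule sum.cong) (auto simp: indicator_word_cyl_append words_def)
    also have "\<dots> = f (point_of (block x i @ D)) * indicator (word_cyl (D @ F)) (shift (int i) x)"
      by (rule sum_indicator_words)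
    also have "indicator (word_cyl (D @ F)) (shift (int i) x) =
        (of_bool (visit D i x) * of_bool (follows D F i x) :: real)"
      unfolding indicator_word_cyl_append
      by (simp add: indicator_def word_cyl_def visit_def follows_def add.commute)
    also have "f (point_of (block x i @ D)) * (of_bool (visit D i x) * of_bool (follows D F i x)) =
       f x * (of_bool (visit D i x) * of_bool (follows D F i x))"
    proof (cases "visit D i x")
      case True
      let ?w = "block x i @ D"
      have w: "block x (i + length D) = ?w" using True by (simp add: block_add visit_def)
      have "block (point_of ?w) (i + length D) = ?w" using block_point_of[of ?w] by simp
      then have b: "block (point_of ?w) (i + length D) = block x (i + length D)" using w by simp
      then have "visit D i (point_of ?w)" using visit_cong[OF b, of i D] True by simp
      then show ?thesis using loc[OF b] True by simp
    qed simp
    finally show ?thesis by simp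
  qed
  show "integrable M (\<lambda>x. f x * of_bool (visit D i x) * of_bool (follows D F i x))"
    unfolding eq by (intro Bochner_Integration.integrable_sum integrable_mult_right) simp
  show "(\<integral>x. f x * of_bool (visit D i x) * of_bool (follows D F i x) \<partial>M) =
      (\<Sum>u\<in>words i. f (point_of (u @ D)) * prb (u @ D @ F))"
    unfolding eq by (subst Bochner_Integration.integral_sum) (auto simp: prb_def)
qed

text \<open>
  The approximate independence of the word after a visit from the history, in the form in which it
  is used: it may be replaced by an independent trial at the cost of \<open>past_dep\<close>.
\<close>

lemma decoupling:
  fixes f :: "(int \<Rightarrow> 'p) \<Rightarrow> real"
  assumes loc: "\<And>x y. block x (i + length D) = block y (i + length D) \<Longrightarrow> visit D i x \<Longrightarrow> visit D i y \<Longrightarrow> f x = f y"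
    and bound: "\<And>x. \<bar>f x\<bar> \<le> B"
  shows "integrable M (\<lambda>x. f x * of_bool (visit D i x))"
    and "integrable M (\<lambda>x. f x * of_bool (visit D i x) * of_bool (follows D F i x))"
    and "\<bar>cnd D F * (\<integral>x. f x * of_bool (visit D i x) \<partial>M) -
       (\<integral>x. f x * of_bool (visit D i x) * of_bool (follows D F i x) \<partial>M)\<bar> \<le> B * past_dep i D F"
proof -
  have triv: "follows D [] i x" for x :: "int \<Rightarrow> 'p" by (simp add: follows_def)
  show "integrable M (\<lambda>x. f x * of_bool (visit D i x))"
    using decoupling_aux(1)[where f = f and i = i and D = D and F = "[]", OF loc] by (simp add: triv)
  show "integrable M (\<lambda>x. f x * of_bool (visit D i x) * of_bool (follows D F i x))"
    by (rule decoupling_aux(1)[OF loc])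
  have 1: "(\<integral>x. f x * of_bool (visit D i x) \<partial>M) = (\<Sum>u\<in>words i. f (point_of (u @ D)) * prb (u @ D))"
    using decoupling_aux(2)[where f = f and i = i and D = D and F = "[]", OF loc] by (simp add: triv)
  have 2: "(\<integral>x. f x * of_bool (visit D i x) * of_bool (follows D F i x) \<partial>M) =
      (\<Sum>u\<in>words i. f (point_of (u @ D)) * prb (u @ D @ F))"
    by (rule decoupling_aux(2)[OF loc])
  have "\<bar>cnd D F * (\<integral>x. f x * of_bool (visit D i x) \<partial>M) -
       (\<integral>x. f x * of_bool (visit D i x) * of_bool (follows D F i x) \<partial>M)\<bar> =
    \<bar>\<Sum>u\<in>words i. f (point_of (u @ D)) * (prb (u @ D) * cnd D F - prb (u @ D @ F))\<bar>"
    unfolding 1 2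
    by (simp add: sum_distrib_left sum_subtractf[symmetric] algebra_simps)
  also have "\<dots> \<le> (\<Sum>u\<in>words i. \<bar>f (point_of (u @ D))\<bar> * \<bar>prb (u @ D) * cnd D F - prb (u @ D @ F)\<bar>)"
    unfolding abs_mult[symmetric] by (rule sum_abs)
  also have "\<dots> \<le> (\<Sum>u\<in>words i. B * \<bar>prb (u @ D) * cnd D F - prb (u @ D @ F)\<bar>)"
    by (intro sum_mono mult_right_mono bound) auto
  also have "\<dots> = B * past_dep i D F"
    unfolding past_dep_alt by (simp add: sum_distrib_left abs_minus_commute)
  finally show "\<bar>cnd D F * (\<integral>x. f x * of_bool (visit D i x) \<partial>M) -
       (\<integral>x. f x * of_bool (visit D i x) * of_bool (follows D F i x) \<partial>M)\<bar> \<le> B * past_dep i D F" .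
qed

text \<open>
  The indicator that \<open>F\<close> has not appeared, divided by its expectation in the case of independent
  trials. If the words after the visits were independent of the history, this would be a martingale
  of mean 1 in the time variable \<open>i\<close>, however the times of the visits depend on the history.
\<close>

definition mart :: "'p list \<Rightarrow> nat \<Rightarrow> 'p list \<Rightarrow> nat \<Rightarrow> (int \<Rightarrow> 'p) \<Rightarrow> real" where
  "mart D K F i x = (if missed D K F i x then (1 / (1 - cnd D F)) ^ actives D K i x else 0)"

lemma mart_0 [simp]: "mart D K F 0 = (\<lambda>x. 1)"
  by (simp add: mart_def fun_eq_iff)

lemma mart_Suc:
  "mart D K F (Suc i) x = mart D K F i x *
     (if active D K i x then (1 - of_bool (follows D F i x)) / (1 - cnd D F) else 1)"
  by (auto simp: mart_def missed_Suc actives_Suc)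

lemma mart_cong: "block x N = block y N \<Longrightarrow> i + length D + length F \<le> N + 1 \<Longrightarrow> mart D K F i x = mart D K F i y"
  using missed_cong[of x N y i D F K] actives_cong[of x N y i D K] by (simp add: mart_def)

lemma mart_cong_visit:
  assumes "block x (i + length D) = block y (i + length D)" "visit D i x" "visit D i y"
    and "\<not> short_return D (length F)"
  shows "mart D K F i x = mart D K F i y"
  using missed_cong_visit[OF assms, of K] actives_cong[OF assms(1), of i D K] by (simp add: mart_def)

lemma integrable_mart [simp]: "integrable M (mart D K F i)"
  by (rule integrable_local[of "i + length D + length F"]) (rule mart_cong, auto)

lemma integrable_mart_mult [simp]: "integrable M (\<lambda>x. mart D K F i x * mart D K F' i x)"
proof (rule integrable_local[of "i + length D + length F + length F'"])
  fix x y :: "int \<Rightarrow> 'p"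
  assume "block x (i + length D + length F + length F') = block y (i + length D + length F + length F')"
  from mart_cong[OF this, of i D F K] mart_cong[OF this, of i D F' K]
  show "mart D K F i x * mart D K F' i x = mart D K F i y * mart D K F' i y" by simp
qed

context
  fixes D :: "'p list" and K s :: nat and q B :: real
  assumes no_return: "\<not> short_return D s"
    and q: "0 \<le> q" "q \<le> 1 / 2"
    and B_def: "B = (1 / (1 - q)) ^ K"
begin

lemma B_ge_1: "B \<ge> 1"
  unfolding B_def using q by (intro one_le_power) (auto simp: field_simps)

lemma mart_bounds:
  assumes "cnd D F \<le> q"
  shows "0 \<le> mart D K F i x" "mart D K F i x \<le> B"
proof -
  have 1: "1 \<le> 1 / (1 - cnd D F)" using assms q cnd_nonneg[of D F] by (simp add: field_simps del: cnd_nonneg)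
  then show "0 \<le> mart D K F i x" by (simp add: mart_def)
  have "(1 / (1 - cnd D F)) ^ actives D K i x \<le> (1 / (1 - cnd D F)) ^ K"
    using 1 by (intro power_increasing) (auto simp: actives_eq_min)
  also have "\<dots> \<le> (1 / (1 - q)) ^ K"
    using assms q by (intro power_mono) (auto simp: frac_le)
  finally show "mart D K F i x \<le> B" using B_ge_1 by (simp add: mart_def B_def)
qed

lemma mart_step:
  assumes "cnd D F \<le> q" "length F = s"
  shows "\<bar>(\<integral>x. mart D K F (Suc i) x \<partial>M) - (\<integral>x. mart D K F i x \<partial>M)\<bar> \<le> 2 * B * past_dep i D F"
proof -
  define c where "c = cnd D F"
  define \<phi> where "\<phi> x = mart D K F i x * of_bool (visits D i x < K)" for x
  have loc: "\<phi> x = \<phi> y" if "block x (i + length D) = block y (i + length D)" "visit D i x" "visit D i y" for x y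
    using mart_cong_visit[OF that, of F K] visits_cong[OF that(1), of i D] no_return assms(2) by (simp add: \<phi>_def)
  have bound: "\<bar>\<phi> x\<bar> \<le> B" for x
    using mart_bounds[OF assms(1), of i x] B_ge_1 by (auto simp: \<phi>_def)
  note dec = decoupling(1)[where f = \<phi> and i = i and D = D and B = B, OF loc bound]
    decoupling(2,3)[where f = \<phi> and i = i and D = D and B = B and F = F, OF loc bound]
  have c: "0 \<le> c" "c \<le> 1 / 2" using assms q by (auto simp: c_def)
  have "mart D K F (Suc i) x - mart D K F i x =
     (c * (\<phi> x * of_bool (visit D i x)) - \<phi> x * of_bool (visit D i x) * of_bool (follows D F i x)) / (1 - c)" for x
    using c by (auto simp: mart_Suc \<phi>_def active_def c_def[symmetric] field_simps)
  then have "(\<integral>x. mart D K F (Suc i) x \<partial>M) - (\<integral>x. mart D K F i x \<partial>M) =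
     (\<integral>x. (c * (\<phi> x * of_bool (visit D i x)) - \<phi> x * of_bool (visit D i x) * of_bool (follows D F i x)) / (1 - c) \<partial>M)"
    by (subst Bochner_Integration.integral_diff[symmetric]) auto
  also have "\<dots> = (c * (\<integral>x. \<phi> x * of_bool (visit D i x) \<partial>M) -
      (\<integral>x. \<phi> x * of_bool (visit D i x) * of_bool (follows D F i x) \<partial>M)) / (1 - c)"
    using dec(1,2) by simp
  also have "\<bar>\<dots>\<bar> \<le> B * past_dep i D F / (1 - c)"
    using dec(3) c by (simp add: c_def[symmetric] divide_right_mono)
  also have "\<dots> \<le> B * past_dep i D F / (1 / 2)"
    using c B_ge_1 past_dep_nonneg[of i D F] by (intro divide_left_mono) auto
  finally show ?thesis by simp
qed

text \<open>
  At most one of two different words can follow a visit, so that the event that neither does has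
  probability \<open>1 - c - c'\<close>, which is at most the value \<open>(1 - c) * (1 - c')\<close> for independent events.
  This makes products of two different martingales almost supermartingales.
\<close>

lemma mart_mult_step:
  assumes "cnd D F \<le> q" "length F = s" "cnd D F' \<le> q" "length F' = s" "F \<noteq> F'"
  shows "(\<integral>x. mart D K F (Suc i) x * mart D K F' (Suc i) x \<partial>M) - (\<integral>x. mart D K F i x * mart D K F' i x \<partial>M)
     \<le> 4 * B\<^sup>2 * (past_dep i D F + past_dep i D F')"
proof -
  define c c' where "c = cnd D F" and "c' = cnd D F'"
  define \<phi> where "\<phi> x = mart D K F i x * mart D K F' i x * of_bool (visits D i x < K)" for x
  define V where "V x = (of_bool (visit D i x) :: real)" for x
  have loc: "\<phi> x = \<phi> y" if "block x (i + length D) = block y (i + length D)" "visit D i x" "visit D i y" for x y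
    using mart_cong_visit[OF that, of F K] mart_cong_visit[OF that, of F' K] visits_cong[OF that(1), of i D]
      no_return assms(2,4) by (simp add: \<phi>_def)
  have \<phi>0: "0 \<le> \<phi> x" for x
    using mart_bounds[OF assms(1), of i x] mart_bounds[OF assms(3), of i x] by (simp add: \<phi>_def)
  have "mart D K F i x * mart D K F' i x \<le> B * B" for x
    using mart_bounds[OF assms(1), of i x] mart_bounds[OF assms(3), of i x] B_ge_1 by (intro mult_mono) auto
  then have bound: "\<bar>\<phi> x\<bar> \<le> B\<^sup>2" for x
    using \<phi>0[of x] by (auto simp: \<phi>_def power2_eq_square)
  note dec = decoupling(1)[where f = \<phi> and i = i and D = D and B = "B\<^sup>2", OF loc bound]
    decoupling(2,3)[where f = \<phi> and i = i and D = D and B = "B\<^sup>2" and F = F, OF loc bound]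
  note dec' = decoupling(1)[where f = \<phi> and i = i and D = D and B = "B\<^sup>2", OF loc bound]
    decoupling(2,3)[where f = \<phi> and i = i and D = D and B = "B\<^sup>2" and F = F', OF loc bound]
  have c: "0 \<le> c" "c \<le> 1 / 2" "0 \<le> c'" "c' \<le> 1 / 2" using assms q by (auto simp: c_def c'_def)
  have den: "(1 - c) * (1 - c') \<ge> 1 / 2 * (1 / 2)" using c by (intro mult_mono) auto
  let ?R = "\<lambda>x. (c * (\<phi> x * V x) - \<phi> x * V x * of_bool (follows D F i x)
      + (c' * (\<phi> x * V x) - \<phi> x * V x * of_bool (follows D F' i x))) / ((1 - c) * (1 - c'))"
  have R_int: "integrable M ?R"
    unfolding V_def using dec(1,2) dec'(2) by simp
  have pointwise: "mart D K F (Suc i) x * mart D K F' (Suc i) x - mart D K F i x * mart D K F' i x \<le> ?R x" for x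
  proof (cases "active D K i x")
    case True
    have ex: "\<not> (follows D F i x \<and> follows D F' i x)"
      using follows_unique[of F F' D i x] assms by auto
    have \<phi>: "\<phi> x = mart D K F i x * mart D K F' i x" and V: "V x = 1"
      using True by (simp_all add: \<phi>_def V_def active_def)
    have "mart D K F (Suc i) x * mart D K F' (Suc i) x - mart D K F i x * mart D K F' i x =
       \<phi> x * (((1 - of_bool (follows D F i x)) * (1 - of_bool (follows D F' i x))) / ((1 - c) * (1 - c')) - 1)"
      using True by (simp add: mart_Suc \<phi> c_def c'_def algebra_simps)
    also have "\<dots> \<le> \<phi> x * ((c - of_bool (follows D F i x) + (c' - of_bool (follows D F' i x))) / ((1 - c) * (1 - c')))"
    proof (intro mult_left_mono \<phi>0)
      have "(1 - of_bool (follows D F i x)) * (1 - of_bool (follows D F' i x)) - (1 - c) * (1 - c')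
         \<le> c - of_bool (follows D F i x) + (c' - of_bool (follows D F' i x))"
        using ex c by (auto simp: algebra_simps)
      then have "((1 - of_bool (follows D F i x)) * (1 - of_bool (follows D F' i x)) - (1 - c) * (1 - c')) / ((1 - c) * (1 - c'))
         \<le> (c - of_bool (follows D F i x) + (c' - of_bool (follows D F' i x))) / ((1 - c) * (1 - c'))"
        using den by (intro divide_right_mono) auto
      moreover have "(1 - c) * (1 - c') \<noteq> 0" using den by auto
      ultimately show "(1 - of_bool (follows D F i x)) * (1 - of_bool (follows D F' i x)) / ((1 - c) * (1 - c')) - 1
         \<le> (c - of_bool (follows D F i x) + (c' - of_bool (follows D F' i x))) / ((1 - c) * (1 - c'))"
        by (simp add: diff_divide_distrib)
    qed
    also have "\<dots> = ?R x" by (simp add: V algebra_simps)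
    finally show ?thesis .
  next
    case False
    then have z: "\<phi> x * V x = 0" by (auto simp: \<phi>_def V_def active_def)
    show ?thesis unfolding z using False by (simp add: mart_Suc)
  qed
  have "(\<integral>x. mart D K F (Suc i) x * mart D K F' (Suc i) x \<partial>M) - (\<integral>x. mart D K F i x * mart D K F' i x \<partial>M) =
     (\<integral>x. mart D K F (Suc i) x * mart D K F' (Suc i) x - mart D K F i x * mart D K F' i x \<partial>M)"
    by simp
  also have "\<dots> \<le> (\<integral>x. ?R x \<partial>M)"
    by (intro integral_mono pointwise R_int) auto
  also have "\<dots> = (c * (\<integral>x. \<phi> x * V x \<partial>M) - (\<integral>x. \<phi> x * V x * of_bool (follows D F i x) \<partial>M)
      + (c' * (\<integral>x. \<phi> x * V x \<partial>M) - (\<integral>x. \<phi> x * V x * of_bool (follows D F' i x) \<partial>M))) / ((1 - c) * (1 - c'))"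
    unfolding V_def using dec(1,2) dec'(2) by simp
  also have "\<dots> \<le> (B\<^sup>2 * past_dep i D F + B\<^sup>2 * past_dep i D F') / ((1 - c) * (1 - c'))"
    using dec(3) dec'(3) den unfolding V_def c_def c'_def by (intro divide_right_mono add_mono) auto
  also have "\<dots> \<le> (B\<^sup>2 * past_dep i D F + B\<^sup>2 * past_dep i D F') / (1 / 2 * (1 / 2))"
    using den past_dep_nonneg by (intro divide_left_mono) auto
  finally show ?thesis by (simp add: algebra_simps)
qed

lemma mart_mean:
  assumes "cnd D F \<le> q" "length F = s" "past_dep T D F \<le> e"
  shows "\<bar>(\<integral>x. mart D K F T x \<partial>M) - 1\<bar> \<le> 2 * B * real T * e"
proof -
  have "i \<le> T \<Longrightarrow> \<bar>(\<integral>x. mart D K F i x \<partial>M) - 1\<bar> \<le> 2 * B * real i * e" for i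
  proof (induction i)
    case (Suc i)
    have "past_dep i D F \<le> e" using past_dep_mono[of i T D F] Suc.prems assms(3) by simp
    then have "2 * B * past_dep i D F \<le> 2 * B * e" using B_ge_1 by simp
    then show ?case using mart_step[OF assms(1,2), of i] Suc by (simp add: algebra_simps)
  qed simp
  then show ?thesis by simp
qed

lemma mart_mult_mean:
  assumes "cnd D F \<le> q" "length F = s" "cnd D F' \<le> q" "length F' = s" "F \<noteq> F'"
    and "past_dep T D F \<le> e" "past_dep T D F' \<le> e"
  shows "(\<integral>x. mart D K F T x * mart D K F' T x \<partial>M) \<le> 1 + 8 * B\<^sup>2 * real T * e"
proof -
  have "i \<le> T \<Longrightarrow> (\<integral>x. mart D K F i x * mart D K F' i x \<partial>M) \<le> 1 + 8 * B\<^sup>2 * real i * e" for i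
  proof (induction i)
    case (Suc i)
    have "past_dep i D F + past_dep i D F' \<le> 2 * e"
      using past_dep_mono[of i T D F] past_dep_mono[of i T D F'] Suc.prems assms(6,7) by simp
    then have "4 * B\<^sup>2 * (past_dep i D F + past_dep i D F') \<le> 4 * B\<^sup>2 * (2 * e)"
      by (intro mult_left_mono) auto
    then show ?case using mart_mult_step[OF assms(1-5), of i] Suc by (simp add: algebra_simps)
  qed simp
  then show ?thesis by simp
qed

end

text \<open>
  The expected number of visits is known exactly by stationarity, although the distribution of
  the number of visits can be anything.
\<close>

lemma integral_visits: "(\<integral>x. real (visits D T x) \<partial>M) = real T * prb D"
  and integrable_visits [simp]: "integrable M (\<lambda>x. real (visits D T x))"
proof -
  have eq: "real (visits D T x) = (\<Sum>i<T. indicator (word_cyl D) (shift (int i) x))" for x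
    by (induction T) (auto simp: visits_Suc visit_def word_cyl_def indicator_def)
  have int: "integrable M (\<lambda>x. indicator (word_cyl D) (shift (int i) x) :: real)" for i
    by (rule integrable_shift) simp
  show "integrable M (\<lambda>x. real (visits D T x))"
    unfolding eq by (intro Bochner_Integration.integrable_sum int)
  have "(\<integral>x. indicator (word_cyl D) (shift (int i) x) \<partial>M) = prb D" for i
    using integral_shift[of "indicator (word_cyl D)" "int i"] by (simp add: prb_def)
  then show "(\<integral>x. real (visits D T x) \<partial>M) = real T * prb D"
    unfolding eq by (subst Bochner_Integration.integral_sum) (auto intro: int)
qed

definition unseen :: "'p list \<Rightarrow> 'p list \<Rightarrow> nat \<Rightarrow> (int \<Rightarrow> 'p) set" where
  "unseen D F T = {x. \<forall>i<T. \<not> (visit D i x \<and> follows D F i x)}"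

lemma integrable_unseen [simp]: "integrable M (\<lambda>x. indicator (unseen D F T) x :: real)"
proof (rule integrable_local[of "T + length D + length F"])
  fix x y :: "int \<Rightarrow> 'p"
  assume *: "block x (T + length D + length F) = block y (T + length D + length F)"
  have "visit D i x = visit D i y \<and> follows D F i x = follows D F i y" if "i < T" for i
    using visit_cong[OF *, of i D] follows_cong[OF *, of i D F] that by simp
  then show "indicator (unseen D F T) x = (indicator (unseen D F T) y :: real)"
    by (auto simp: unseen_def indicator_def)
qed

text \<open>
  The words in \<open>G\<close> share one random time change, given by the number of visits up to time \<open>T\<close>. The
  weighted sum \<open>S\<close> of their martingales has mean close to \<open>W\<close>, and its variance is governed by
  the diagonal terms, which are small because each word has conditional probability at most \<open>q\<close>.
  Multiplied by \<open>(1 - q) ^ actives\<close>, \<open>S\<close> is a lower bound for the weight of the words that have not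
  appeared, except when there are more than \<open>K\<close> visits. As \<open>S\<close> is almost the constant \<open>W\<close>, it does
  not matter that it depends on the number of visits, and only the mean of \<open>(1 - q) ^ actives\<close>
  remains to be bounded, by Jensen's inequality.
\<close>

lemma bucket_bound:
  fixes D :: "'p list" and K s T :: nat and q \<eta> e k0 :: real and G :: "'p list set"
  defines "B \<equiv> (1 / (1 - q)) ^ K" and "W \<equiv> \<Sum>F\<in>G. cnd D F"
  assumes no_return: "\<not> short_return D s"
    and q: "0 \<le> q" "q \<le> 1 / 2"
    and G: "G \<subseteq> words s" "\<And>F. F \<in> G \<Longrightarrow> cnd D F \<le> q" "\<And>F. F \<in> G \<Longrightarrow> past_dep T D F \<le> e"
    and pos: "W > 0" "\<eta> > 0" "K > 0"
    and time: "real T * prb D \<le> k0"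
  shows "(\<Sum>F\<in>G. cnd D F * measure M (unseen D F T)) \<ge>
     W * (exp (k0 * ln (1 - q)) - \<eta> - 12 * B\<^sup>2 * real T * e / \<eta> - k0 / real K) - B\<^sup>2 * q / \<eta>"
proof -
  note mb = mart_bounds[OF no_return q B_def[unfolded atomize_eq]]
  note mm = mart_mean[OF no_return q B_def[unfolded atomize_eq]]
  note mmm = mart_mult_mean[OF no_return q B_def[unfolded atomize_eq]]
  have B1: "B \<ge> 1" by (rule B_ge_1[OF no_return q B_def[unfolded atomize_eq]])
  have finG [simp]: "finite G" by (rule finite_subset[OF G(1)]) simp
  have len: "F \<in> G \<Longrightarrow> length F = s" for F using G(1) by (auto simp: words_def)
  have W1: "W \<le> 1"
    unfolding W_def by (rule order_trans[OF sum_mono2 sum_cnd_le_1]) (use G(1) in auto)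
  have "G \<noteq> {}" using pos(1) by (auto simp: W_def)
  then obtain F0 where "F0 \<in> G" by blast
  then have e0: "e \<ge> 0" using G(3)[of F0] past_dep_nonneg[of T D F0] by simp
  define S where "S x = (\<Sum>F\<in>G. cnd D F * mart D K F T x)" for x
  have S_int [simp]: "integrable M S" unfolding S_def[abs_def] by simp
  have S2: "(S x)\<^sup>2 = (\<Sum>F\<in>G. \<Sum>F'\<in>G. cnd D F * cnd D F' * (mart D K F T x * mart D K F' T x))" for x
    by (simp add: S_def power2_eq_square sum_product algebra_simps)
  have S2_int [simp]: "integrable M (\<lambda>x. (S x)\<^sup>2)" unfolding S2 by simp
  define r where "r = B\<^sup>2 * real T * e"
  have r0: "r \<ge> 0" using e0 by (simp add: r_def)
  have BTe: "B * real T * e \<le> r"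
    unfolding r_def using B1 e0 by (intro mult_right_mono) (auto simp: power2_eq_square)

  \<comment> \<open>The first two moments of \<open>S\<close>; up to a multiple of \<open>r\<close>, the
    off-diagonal terms are at most those of a constant.\<close>
  have ES: "(\<integral>x. S x \<partial>M) \<ge> W * (1 - 2 * r)"
  proof -
    have "W * (1 - 2 * r) = (\<Sum>F\<in>G. cnd D F * (1 - 2 * r))" by (simp add: W_def sum_distrib_right)
    also have "\<dots> \<le> (\<Sum>F\<in>G. cnd D F * (\<integral>x. mart D K F T x \<partial>M))"
    proof (intro sum_mono mult_left_mono cnd_nonneg)
      fix F assume F: "F \<in> G"
      show "1 - 2 * r \<le> (\<integral>x. mart D K F T x \<partial>M)"
        using mm[OF G(2)[OF F] len[OF F] G(3)[OF F]] BTe by (simp add: abs_le_iff algebra_simps)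
    qed
    also have "\<dots> = (\<integral>x. S x \<partial>M)" by (simp add: S_def)
    finally show ?thesis .
  qed
  have ES2: "(\<integral>x. (S x)\<^sup>2 \<partial>M) \<le> W\<^sup>2 * (1 + 8 * r) + B\<^sup>2 * q * W"
  proof -
    have "(\<integral>x. (S x)\<^sup>2 \<partial>M) = (\<Sum>F\<in>G. \<Sum>F'\<in>G. cnd D F * cnd D F' * (\<integral>x. mart D K F T x * mart D K F' T x \<partial>M))"
      unfolding S2 by simp
    also have "\<dots> \<le> (\<Sum>F\<in>G. \<Sum>F'\<in>G. cnd D F * cnd D F' * ((1 + 8 * r) + (if F = F' then B\<^sup>2 else 0)))"
    proof (intro sum_mono mult_left_mono)
      fix F F' assume F: "F \<in> G" "F' \<in> G"
      show "(\<integral>x. mart D K F T x * mart D K F' T x \<partial>M) \<le> 1 + 8 * r + (if F = F' then B\<^sup>2 else 0)"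
      proof (cases "F = F'")
        case False
        then show ?thesis
          using mmm[OF G(2)[OF F(1)] len[OF F(1)] G(2)[OF F(2)] len[OF F(2)] False G(3)[OF F(1)] G(3)[OF F(2)]]
          by (simp add: r_def algebra_simps)
      next
        case True
        have "mart D K F T x * mart D K F T x \<le> B * B" for x
          using mb[OF G(2)[OF F(1)], of T x] B1 by (intro mult_mono) auto
        then have "(\<integral>x. mart D K F T x * mart D K F T x \<partial>M) \<le> (\<integral>x. B\<^sup>2 \<partial>M)"
          by (intro integral_mono) (auto simp: power2_eq_square)
        then show ?thesis using True r0 by simp
      qed
    qed auto
    also have "\<dots> = (\<Sum>F\<in>G. \<Sum>F'\<in>G. cnd D F * cnd D F' * (1 + 8 * r)) + (\<Sum>F\<in>G. cnd D F * cnd D F * B\<^sup>2)"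
    proof -
      have "cnd D F * cnd D F' * (c + (if F = F' then B\<^sup>2 else 0)) =
          cnd D F * cnd D F' * c + (if F = F' then cnd D F * cnd D F * B\<^sup>2 else 0)" for F F' c
        by (simp add: distrib_left)
      then show ?thesis by (simp add: sum.distrib)
    qed
    also have "(\<Sum>F\<in>G. \<Sum>F'\<in>G. cnd D F * cnd D F' * (1 + 8 * r)) = W\<^sup>2 * (1 + 8 * r)"
    proof -
      have "W\<^sup>2 = (\<Sum>F\<in>G. \<Sum>F'\<in>G. cnd D F * cnd D F')"
        unfolding W_def power2_eq_square sum_product ..
      then show ?thesis by (simp only: sum_distrib_right)
    qed
    also have "(\<Sum>F\<in>G. cnd D F * cnd D F * B\<^sup>2) \<le> (\<Sum>F\<in>G. q * cnd D F * B\<^sup>2)"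
      using G(2) by (intro sum_mono mult_right_mono) auto
    also have "\<dots> = B\<^sup>2 * q * W" by (simp add: W_def sum_distrib_left sum_distrib_right mult_ac)
    finally show ?thesis by simp
  qed
  have ESW: "(\<integral>x. (S x - W)\<^sup>2 \<partial>M) \<le> 12 * W\<^sup>2 * r + B\<^sup>2 * q * W"
  proof -
    have "(\<integral>x. (S x - W)\<^sup>2 \<partial>M) = (\<integral>x. (S x)\<^sup>2 \<partial>M) - 2 * W * (\<integral>x. S x \<partial>M) + W\<^sup>2"
      by (simp add: power2_diff algebra_simps)
    also have "\<dots> \<le> W\<^sup>2 * (1 + 8 * r) + B\<^sup>2 * q * W - 2 * W * (W * (1 - 2 * r)) + W\<^sup>2"
      using ES ES2 pos(1) by (intro add_right_mono diff_mono mult_left_mono) auto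
    also have "\<dots> = 12 * W\<^sup>2 * r + B\<^sup>2 * q * W" by (simp add: power2_eq_square algebra_simps)
    finally show ?thesis .
  qed

  \<comment> \<open>Jensen's inequality for \<open>R\<close>, obtained by integrating the tangent of the exponential at \<open>k0\<close>.\<close>
  define \<gamma> where "\<gamma> = - ln (1 - q)"
  have \<gamma>0: "\<gamma> \<ge> 0" using q by (simp add: \<gamma>_def)
  define R where "R x = (1 - q) ^ actives D K T x" for x
  have R_bounds: "0 \<le> R x" "R x \<le> 1" for x using q by (auto simp: R_def power_le_one)
  have tangent: "exp (- \<gamma> * k0) * (1 - \<gamma> * (real (visits D T x) - k0)) \<le> R x" for x
  proof -
    have "R x = exp (- \<gamma> * real (actives D K T x))"
      using q by (simp add: R_def \<gamma>_def mult.commute[of "ln (1 - q)"] exp_of_nat_mult)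
    also have "\<dots> \<ge> exp (- \<gamma> * real (visits D T x))"
      using \<gamma>0 by (simp add: actives_eq_min mult_left_mono)
    also have "exp (- \<gamma> * real (visits D T x)) = exp (- \<gamma> * k0) * exp (- \<gamma> * (real (visits D T x) - k0))"
      by (simp add: exp_add[symmetric] algebra_simps)
    also have "\<dots> \<ge> exp (- \<gamma> * k0) * (1 + - \<gamma> * (real (visits D T x) - k0))"
      by (intro mult_left_mono exp_ge_add_one_self) auto
    finally show ?thesis by simp
  qed

  have pointwise: "W * (exp (- \<gamma> * k0) * (1 - \<gamma> * (real (visits D T x) - k0)))
      - (\<eta> * W + (S x - W)\<^sup>2 / (\<eta> * W)) - W * (real (visits D T x) / real K)
      \<le> (\<Sum>F\<in>G. cnd D F * indicator (unseen D F T) x)" for x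
  proof -
    \<comment> \<open>Conditional probabilities below \<open>q\<close> are replaced by the worst case \<open>q\<close>.\<close>
    have RM: "R x * mart D K F T x \<le> 1" if F: "F \<in> G" for F
    proof (cases "missed D K F T x")
      case True
      then have "R x * mart D K F T x = ((1 - q) * (1 / (1 - cnd D F))) ^ actives D K T x"
        by (simp add: R_def mart_def power_mult_distrib power_divide)
      also have "\<dots> \<le> 1"
        using q G(2)[OF F] by (intro power_le_one) (auto simp: field_simps)
      finally show ?thesis .
    qed (simp add: mart_def)
    have RS: "R x * S x = (\<Sum>F\<in>G. cnd D F * (R x * mart D K F T x))"
      by (simp add: S_def sum_distrib_left mult_ac)
    have "R x * S x - W * (real (visits D T x) / real K) \<le> (\<Sum>F\<in>G. cnd D F * indicator (unseen D F T) x)"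
    proof (cases "visits D T x \<le> K")
      case True
      have "R x * S x \<le> (\<Sum>F\<in>G. cnd D F * indicator (unseen D F T) x)"
        unfolding RS
      proof (intro sum_mono mult_left_mono cnd_nonneg)
        fix F assume F: "F \<in> G"
        show "R x * mart D K F T x \<le> indicator (unseen D F T) x"
        proof (cases "missed D K F T x")
          case m: True
          have "active D K j x" if "visit D j x" "j < T" for j
          proof -
            have "visits D j x < visits D (Suc j) x" using that by (simp add: visits_Suc)
            also have "\<dots> \<le> visits D T x" using that by (intro visits_mono) auto
            finally show ?thesis using True that by (simp add: active_def)
          qed
          then have "x \<in> unseen D F T" using m by (auto simp: unseen_def missed_def)
          then show ?thesis using RM[OF F] by simp
        qed (simp add: mart_def)
      qed
      moreover have "0 \<le> W * (real (visits D T x) / real K)" using pos by simp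
      ultimately show ?thesis by linarith
    next
      case False
      have "R x * S x \<le> (\<Sum>F\<in>G. cnd D F * 1)"
        unfolding RS by (intro sum_mono mult_left_mono cnd_nonneg RM)
      moreover have "W * 1 \<le> W * (real (visits D T x) / real K)"
        using False pos by (intro mult_left_mono) (auto simp: field_simps)
      moreover have "0 \<le> (\<Sum>F\<in>G. cnd D F * indicator (unseen D F T) x)"
        by (intro sum_nonneg mult_nonneg_nonneg) auto
      ultimately show ?thesis by (simp add: W_def)
    qed
    moreover have "R x * W - R x * S x \<le> \<eta> * W + (S x - W)\<^sup>2 / (\<eta> * W)"
    proof -
      have "R x * W - R x * S x \<le> R x * \<bar>S x - W\<bar>"
        using R_bounds[of x] by (simp add: right_diff_distrib[symmetric] mult_left_mono)
      also have "\<dots> \<le> 1 * \<bar>S x - W\<bar>" using R_bounds[of x] by (intro mult_right_mono) auto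
      also have "\<dots> \<le> \<eta> * W + (S x - W)\<^sup>2 / (\<eta> * W)"
        using abs_le_add_square_div[of "\<eta> * W" "S x - W"] pos by simp
      finally show ?thesis .
    qed
    moreover have "W * (exp (- \<gamma> * k0) * (1 - \<gamma> * (real (visits D T x) - k0))) \<le> W * R x"
      using tangent[of x] pos(1) by (intro mult_left_mono) auto
    ultimately show ?thesis by (simp add: mult.commute)
  qed
  have SW_int [simp]: "integrable M (\<lambda>x. (S x - W)\<^sup>2)"
    by (simp add: power2_diff)
  have "W * (exp (- \<gamma> * k0) * (1 - \<gamma> * (real T * prb D - k0)))
      - (\<eta> * W + (\<integral>x. (S x - W)\<^sup>2 \<partial>M) / (\<eta> * W)) - W * (real T * prb D / real K)
    = (\<integral>x. W * (exp (- \<gamma> * k0) * (1 - \<gamma> * (real (visits D T x) - k0)))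
      - (\<eta> * W + (S x - W)\<^sup>2 / (\<eta> * W)) - W * (real (visits D T x) / real K) \<partial>M)"
    by (simp add: integral_visits)
  also have "\<dots> \<le> (\<integral>x. (\<Sum>F\<in>G. cnd D F * indicator (unseen D F T) x) \<partial>M)"
  proof (rule integral_mono)
    show "integrable M (\<lambda>x. \<Sum>F\<in>G. cnd D F * indicator (unseen D F T) x)"
      by (intro Bochner_Integration.integrable_sum integrable_mult_right integrable_unseen)
  qed (simp, rule pointwise)
  also have "\<dots> = (\<Sum>F\<in>G. cnd D F * measure M (unseen D F T))"
    by (subst Bochner_Integration.integral_sum) (auto intro!: integrable_mult_right simp del: integral_indicator)
  finally have main: "W * (exp (- \<gamma> * k0) * (1 - \<gamma> * (real T * prb D - k0)))
      - (\<eta> * W + (\<integral>x. (S x - W)\<^sup>2 \<partial>M) / (\<eta> * W)) - W * (real T * prb D / real K)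
    \<le> (\<Sum>F\<in>G. cnd D F * measure M (unseen D F T))" .
  have "(\<integral>x. (S x - W)\<^sup>2 \<partial>M) / (\<eta> * W) \<le> (12 * W\<^sup>2 * r + B\<^sup>2 * q * W) / (\<eta> * W)"
    using pos by (intro divide_right_mono ESW) auto
  also have "\<dots> = W * (12 * r / \<eta>) + B\<^sup>2 * q / \<eta>"
    using pos by (simp add: field_simps power2_eq_square)
  finally have 1: "(\<integral>x. (S x - W)\<^sup>2 \<partial>M) / (\<eta> * W) \<le> W * (12 * r / \<eta>) + B\<^sup>2 * q / \<eta>" .
  have 2: "W * (real T * prb D / real K) \<le> W * (k0 / real K)"
    using pos time by (intro mult_left_mono divide_right_mono) auto
  have "\<gamma> * (real T * prb D - k0) \<le> 0" using \<gamma>0 time by (simp add: mult_nonneg_nonpos)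
  then have "W * (exp (- \<gamma> * k0) * 1) \<le> W * (exp (- \<gamma> * k0) * (1 - \<gamma> * (real T * prb D - k0)))"
    using pos(1) by (intro mult_left_mono) auto
  then have "W * exp (- \<gamma> * k0) - \<eta> * W - (W * (12 * r / \<eta>) + B\<^sup>2 * q / \<eta>) - W * (k0 / real K)
    \<le> (\<Sum>F\<in>G. cnd D F * measure M (unseen D F T))"
    using main 1 2 by linarith
  then show ?thesis
    by (simp add: r_def \<gamma>_def algebra_simps)
qed

end

section \<open>Short hitting times in one group of cylinders\<close>

lemma hitting_time_attained:
  assumes "hitting_time B y < \<infinity>"
  obtains i where "hitting_time B y = enat i" "0 < i" "(left_shift ^^ i) y \<in> B"
proof -
  define A where "A = {i. 0 < i \<and> (left_shift ^^ i) y \<in> B}"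
  have H: "hitting_time B y = Inf (enat ` A)" by (simp add: hitting_time_def A_def)
  with assms have "A \<noteq> {}" by (auto simp: top_enat_def)
  then obtain a where "a \<in> A" by blast
  then have "Inf (enat ` A) \<in> enat ` A" by (intro wellorder_InfI[of "enat a"] imageI)
  then obtain i where "Inf (enat ` A) = enat i" "i \<in> A" by (rule imageE)
  then show ?thesis using that[of i] H by (simp add: A_def)
qed

context stationary_process begin

lemma unseen_sets [measurable]: "unseen D F T \<in> sets M"
proof -
  have "integrable M (indicator (unseen D F T) :: _ \<Rightarrow> real)" by simp
  then have "(indicator (unseen D F T) :: _ \<Rightarrow> real) \<in> borel_measurable M" by (rule borel_measurable_integrable)
  then show ?thesis by (simp add: borel_measurable_indicator_iff)
qed

text \<open>
  The hitting time counts from 1, whereas \<open>unseen\<close> counts visits from time 0; the difference is a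
  shift, which preserves the measure.
\<close>

lemma hitting_cdf_le:
  assumes pos: "prb (D @ F) > 0" and T: "t < (real T + 1) * prb (D @ F)"
  shows "hitting_cdf M (word_cyl (D @ F)) t \<le> 1 - measure M (unseen D F T)"
proof -
  let ?B = "word_cyl (D @ F)"
  have sub: "{y \<in> space M. norm_hitting_time M ?B y \<le> ereal t} \<subseteq> shift 1 -` (space M - unseen D F T) \<inter> space M"
  proof
    fix y assume "y \<in> {y \<in> space M. norm_hitting_time M ?B y \<le> ereal t}"
    then have le: "ereal (prb (D @ F)) * ereal_of_enat (hitting_time ?B y) \<le> ereal t"
      by (simp add: norm_hitting_time_def prb_def)
    have "hitting_time ?B y < \<infinity>"
      using le pos by (cases "hitting_time ?B y") auto
    then obtain i where i: "hitting_time ?B y = enat i" "0 < i" "(left_shift ^^ i) y \<in> ?B"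
      by (rule hitting_time_attained)
    have "prb (D @ F) * real i \<le> t" using le i(1) by simp
    then have "real i * prb (D @ F) < (real T + 1) * prb (D @ F)" using T by (simp add: mult.commute)
    then have "i \<le> T" using pos by (simp add: mult_less_cancel_right)
    moreover have "visit D (i - 1) (shift 1 y) \<and> follows D F (i - 1) (shift 1 y)"
      using i(2,3) by (simp add: left_shift_funpow word_cyl_def block_add visit_def follows_def of_nat_diff algebra_simps)
    ultimately have "shift 1 y \<notin> unseen D F T"
      using i(2) by (auto simp: unseen_def intro!: exI[of _ "i - 1"])
    then show "y \<in> shift 1 -` (space M - unseen D F T) \<inter> space M" by simp
  qed
  have "hitting_cdf M ?B t \<le> measure M (shift 1 -` (space M - unseen D F T) \<inter> space M)"
    unfolding hitting_cdf_def by (intro finite_measure_mono sub) measurable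
  also have "\<dots> = measure (distr M M (shift 1)) (space M - unseen D F T)"
    using sets.compl_sets[OF unseen_sets[of D F T]] by (intro measure_distr[symmetric]) auto
  also have "\<dots> = 1 - measure M (unseen D F T)"
    unfolding distr_shift by (rule prob_compl) measurable
  finally show ?thesis .
qed

text \<open>
  Evaluates \<open>bucket_bound\<close> for the words \<open>F\<close> that are hit too early and whose conditional
  probability lies between \<open>qs\<close> and \<open>(1 + \<eta>) * qs\<close>. The time \<open>T\<close> is the one that belongs to the
  smallest probability \<open>qs\<close> of the group, hence late enough for all its words. The expected number
  of visits is then at most \<open>t / qs\<close>, and \<open>K\<close> exceeds this number by the factor \<open>1 / \<eta>\<close>. As the
  total weight \<open>W\<close> of the group enters the main terms linearly but the variance term not at all,
  \<open>W\<close> is at most a multiple of \<open>qs\<close>.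
\<close>

lemma bucket_small:
  fixes D :: "'p list" and s :: nat and t \<delta> \<eta> qs \<kappa> :: real
  defines "T \<equiv> nat \<lfloor>t / (prb D * qs)\<rfloor>" and "C \<equiv> exp (4 * t / \<eta> + 1)"
  assumes pos: "t > 0" "\<delta> > 0" "0 < \<eta>" "\<eta> \<le> 1" "6 * \<eta> * (t + 1) \<le> \<delta>" "qs > 0" "2 * ((1 + \<eta>) * qs) \<le> \<eta>"
    and no_return: "\<not> short_return D s" and D: "prb D > 0"
    and \<kappa>: "12 * C\<^sup>2 * \<kappa> * t \<le> \<eta>\<^sup>2 * qs" "\<And>F. F \<in> words s \<Longrightarrow> past_dep T D F \<le> \<kappa> * prb D"
  shows "(\<Sum>F | F \<in> words s \<and> qs \<le> cnd D F \<and> cnd D F \<le> (1 + \<eta>) * qs \<and>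
             hitting_cdf M (word_cyl (D @ F)) t > 1 - exp (- t) + \<delta>. cnd D F)
     \<le> 2 * C\<^sup>2 * ((1 + \<eta>) * qs) / (\<eta> * \<delta>)"
proof -
  define G where "G = {F. F \<in> words s \<and> qs \<le> cnd D F \<and> cnd D F \<le> (1 + \<eta>) * qs \<and>
             hitting_cdf M (word_cyl (D @ F)) t > 1 - exp (- t) + \<delta>}"
  define W where "W = (\<Sum>F\<in>G. cnd D F)"
  define q where "q = (1 + \<eta>) * qs"
  have q: "0 < q" "q \<le> 1 / 2" "2 * q \<le> \<eta>" using pos by (auto simp: q_def)
  have qs_q: "q \<le> 2 * qs" using pos by (simp add: q_def algebra_simps)
  have W0: "W \<ge> 0" unfolding W_def by (intro sum_nonneg) auto
  have C1: "C \<ge> 1" using pos by (simp add: C_def)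
  have "W \<le> 2 * C\<^sup>2 * q / (\<eta> * \<delta>)"
  proof (cases "W = 0")
    case True
    then show ?thesis using q pos by simp
  next
    case False
    with W0 have Wpos: "W > 0" by simp
    define k0 where "k0 = t / qs"
    define K where "K = nat \<lceil>k0 / \<eta>\<rceil>"
    define B where "B = (1 / (1 - q)) ^ K"
    have k0: "k0 > 0" using pos by (simp add: k0_def)
    have K: "real K \<ge> k0 / \<eta>" "real K \<le> k0 / \<eta> + 1"
      unfolding K_def using k0 pos by (simp_all add: of_nat_ceiling)
    have K0: "K > 0" using K(1) k0 pos by (metis divide_pos_pos gr0I not_less of_nat_0)
    have kK: "k0 / real K \<le> \<eta>"
      using K(1) K0 pos by (simp add: field_simps)
    have lnq: "ln (1 - q) \<ge> - q - 2 * q\<^sup>2"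
      using q by (intro ln_one_minus_pos_lower_bound) auto
    have BC: "B \<le> C"
    proof -
      have q2: "2 * q\<^sup>2 \<le> q" using q by (simp add: power2_eq_square)
      have "- ln (1 - q) \<le> 2 * q" using lnq q2 by linarith
      then have "B \<le> exp (2 * q) ^ K"
        unfolding B_def
      proof (intro power_mono)
        assume a: "- ln (1 - q) \<le> 2 * q"
        have "1 / (1 - q) = exp (- ln (1 - q))" using q by (simp add: exp_minus inverse_eq_divide)
        also have "\<dots> \<le> exp (2 * q)" using a by simp
        finally show "1 / (1 - q) \<le> exp (2 * q)" .
      qed (use q in simp)
      also have "\<dots> = exp (real K * (2 * q))" by (rule exp_of_nat_mult[symmetric])
      also have "\<dots> \<le> exp (4 * t / \<eta> + 1)"
      proof -
        have "real K * (2 * q) \<le> (k0 / \<eta> + 1) * (2 * q)" using K(2) q by (intro mult_right_mono) auto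
        also have "\<dots> = k0 / \<eta> * (2 * q) + 2 * q" by (simp add: algebra_simps)
        also have "k0 / \<eta> * (2 * q) \<le> k0 / \<eta> * (2 * (2 * qs))"
          using qs_q k0 pos by (intro mult_left_mono) auto
        also have "\<dots> = 4 * t / \<eta>" using pos by (simp add: k0_def)
        finally show ?thesis using q by simp
      qed
      finally show ?thesis by (simp add: C_def)
    qed
    have B0: "B \<ge> 0" using q by (simp add: B_def)
    have BC2: "B\<^sup>2 \<le> C\<^sup>2" using BC B0 by (rule power_mono)
    have Tle: "real T \<le> t / (prb D * qs)"
      unfolding T_def using pos D by (simp add: of_nat_floor)
    have Tgt: "t / (prb D * qs) < real T + 1"
      unfolding T_def using pos D by (simp add: floor_less_iff)
    have time: "real T * prb D \<le> k0"
      using Tle D pos by (simp add: k0_def field_simps)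
    have "\<kappa> * prb D \<ge> past_dep T D (replicate s undefined)" by (rule \<kappa>(2)) (simp add: words_def)
    then have "\<kappa> * prb D \<ge> 0" using past_dep_nonneg by (rule order_trans[rotated])
    then have \<kappa>0: "\<kappa> \<ge> 0" using D by (simp add: zero_le_mult_iff)
    have "W * (exp (k0 * ln (1 - q)) - \<eta> - 12 * B\<^sup>2 * real T * (\<kappa> * prb D) / \<eta> - k0 / real K) - B\<^sup>2 * q / \<eta>
       \<le> (\<Sum>F\<in>G. cnd D F * measure M (unseen D F T))"
      unfolding B_def W_def
      by (rule bucket_bound[OF no_return]) (use q pos K0 time Wpos \<kappa> in \<open>auto simp: G_def q_def W_def\<close>)
    also have "\<dots> \<le> (\<Sum>F\<in>G. cnd D F * (exp (- t) - \<delta>))"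
    proof (intro sum_mono mult_left_mono cnd_nonneg)
      fix F assume F: "F \<in> G"
      then have c: "cnd D F \<ge> qs" by (simp add: G_def)
      have p: "prb (D @ F) = prb D * cnd D F" by (rule prb_append)
      have "t < (real T + 1) * (prb D * qs)" using Tgt D pos by (simp add: pos_divide_less_eq)
      also have "\<dots> \<le> (real T + 1) * prb (D @ F)" unfolding p using c by (intro mult_left_mono) auto
      finally have "hitting_cdf M (word_cyl (D @ F)) t \<le> 1 - measure M (unseen D F T)"
        by (intro hitting_cdf_le) (use p D c pos in auto)
      then show "measure M (unseen D F T) \<le> exp (- t) - \<delta>" using F by (simp add: G_def)
    qed
    also have "\<dots> = W * (exp (- t) - \<delta>)" by (simp add: W_def sum_distrib_right)
    finally have main: "W * (exp (k0 * ln (1 - q)) - \<eta> - 12 * B\<^sup>2 * real T * (\<kappa> * prb D) / \<eta> - k0 / real K) - B\<^sup>2 * q / \<eta>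
       \<le> W * (exp (- t) - \<delta>)" .
    \<comment> \<open>The width of the group and the second order term of \<open>ln (1 - q)\<close> cost a factor
      \<open>1 + \<eta>\<close> each in the exponent.\<close>
    have e1: "exp (k0 * ln (1 - q)) \<ge> exp (- t) - 3 * \<eta> * t"
    proof -
      have "- t - 3 * \<eta> * t \<le> - (k0 * (q * (1 + \<eta>)))"
      proof -
        have "k0 * (q * (1 + \<eta>)) = t * ((1 + \<eta>) * (1 + \<eta>))" using pos by (simp add: k0_def q_def)
        also have "\<dots> \<le> t * (1 + 3 * \<eta>)"
          using pos mult_left_le[of \<eta> \<eta>] by (intro mult_left_mono) (auto simp: algebra_simps)
        finally show ?thesis by (simp add: algebra_simps)
      qed
      also have "\<dots> \<le> k0 * ln (1 - q)"
      proof -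
        have "q * (2 * q) \<le> q * \<eta>" using q by (intro mult_left_mono) auto
        then have "- (q * (1 + \<eta>)) \<le> ln (1 - q)" using lnq by (simp add: power2_eq_square algebra_simps)
        then have "k0 * - (q * (1 + \<eta>)) \<le> k0 * ln (1 - q)" using k0 by (intro mult_left_mono) auto
        then show ?thesis by simp
      qed
      finally have 1: "exp (- t - 3 * \<eta> * t) \<le> exp (k0 * ln (1 - q))" by (simp only: exp_le_cancel_iff)
      define z where "z = 3 * \<eta> * t"
      have "exp (- t) * (1 - z) \<le> exp (- t) * exp (- z)"
        using exp_ge_add_one_self[of "- z"] by (intro mult_left_mono) auto
      also have "\<dots> = exp (- t - 3 * \<eta> * t)" by (simp add: z_def flip: exp_add)
      also note 1
      finally have "exp (- t) - exp (- t) * z \<le> exp (k0 * ln (1 - q))" by (simp add: algebra_simps)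
      moreover have "exp (- t) * z \<le> 1 * z" using pos by (intro mult_right_mono) (auto simp: z_def)
      ultimately show ?thesis by (simp add: z_def)
    qed
    have e2: "12 * B\<^sup>2 * real T * (\<kappa> * prb D) / \<eta> \<le> \<eta>"
    proof -
      have "12 * B\<^sup>2 * real T * (\<kappa> * prb D) = 12 * B\<^sup>2 * \<kappa> * (real T * prb D)" by simp
      also have "\<dots> \<le> 12 * C\<^sup>2 * \<kappa> * (t / qs)"
        using BC2 time \<kappa>0 k0 D unfolding k0_def by (intro mult_mono) auto
      also have "\<dots> = 12 * C\<^sup>2 * \<kappa> * t / qs" by simp
      also have "\<dots> \<le> \<eta>\<^sup>2 * qs / qs" using \<kappa>(1) pos by (intro divide_right_mono) auto
      also have "\<dots> = \<eta> * \<eta>" using pos by (simp add: power2_eq_square)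
      finally show ?thesis using pos by (simp add: pos_divide_le_eq)
    qed
    have "W * (exp (- t) - \<delta> / 2) \<le> W * (exp (k0 * ln (1 - q)) - \<eta> - 12 * B\<^sup>2 * real T * (\<kappa> * prb D) / \<eta> - k0 / real K)"
      using Wpos e1 e2 kK pos by (intro mult_left_mono) (auto simp: algebra_simps)
    moreover have "B\<^sup>2 * q / \<eta> \<le> C\<^sup>2 * q / \<eta>"
      using BC2 q pos by (intro divide_right_mono mult_right_mono) auto
    ultimately have "W * (exp (- t) - \<delta> / 2) - C\<^sup>2 * q / \<eta> \<le> W * (exp (- t) - \<delta>)" using main by linarith
    then have "W * \<delta> / 2 \<le> C\<^sup>2 * q / \<eta>" by (simp add: algebra_simps)
    then show ?thesis using pos by (simp add: field_simps)
  qed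
  then show ?thesis unfolding W_def G_def q_def .
qed

end

section \<open>Cylinders with short hitting times are rare\<close>

lemma geometric_bucket:
  fixes c \<theta> \<rho> :: real
  assumes "0 < \<rho>" "\<rho> < 1" "\<theta> * \<rho> ^ I \<le> c" "c \<le> \<theta>" "I > 0"
  shows "\<exists>i<I. \<theta> * \<rho> ^ Suc i \<le> c \<and> c \<le> \<theta> * \<rho> ^ i"
proof -
  define i where "i = (LEAST j. \<theta> * \<rho> ^ Suc j \<le> c)"
  have ex: "\<theta> * \<rho> ^ Suc (I - 1) \<le> c" using assms(3,5) by simp
  have 1: "\<theta> * \<rho> ^ Suc i \<le> c" unfolding i_def by (rule LeastI[of "\<lambda>j. \<theta> * \<rho> ^ Suc j \<le> c", OF ex])
  have "i \<le> I - 1" unfolding i_def by (rule Least_le[of "\<lambda>j. \<theta> * \<rho> ^ Suc j \<le> c", OF ex])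
  then have 2: "i < I" using assms(5) by simp
  have "c \<le> \<theta> * \<rho> ^ i"
  proof (cases i)
    case (Suc j)
    then have "\<not> \<theta> * \<rho> ^ Suc j \<le> c" unfolding i_def using not_less_Least[of j "\<lambda>j. \<theta> * \<rho> ^ Suc j \<le> c"] by simp
    then show ?thesis using Suc by simp
  qed (use assms(4) in simp)
  with 1 2 show ?thesis by blast
qed

lemma sum_UNION_le:
  fixes f :: "'a \<Rightarrow> real"
  assumes "finite I" "\<And>i. i \<in> I \<Longrightarrow> finite (A i)" "\<And>x. 0 \<le> f x"
  shows "sum f (\<Union>i\<in>I. A i) \<le> (\<Sum>i\<in>I. sum f (A i))"
  using assms(1,2)
proof (induction I rule: finite_induct)
  case (insert i I)
  have "sum f (A i \<union> (\<Union>i\<in>I. A i)) \<le> sum f (A i) + sum f (\<Union>i\<in>I. A i)"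
    using insert by (subst sum_Un) (auto intro!: sum_nonneg assms(3))
  then show ?case using insert by simp
qed simp

context stationary_process begin

text \<open>
  The cylinder of \<open>w\<close> is hit too early: its distribution function exceeds the exponential one by
  more than \<open>\<delta>\<close> at \<open>t\<close>.
\<close>

definition bad :: "real \<Rightarrow> real \<Rightarrow> 'p list \<Rightarrow> bool" where
  "bad t \<delta> w \<longleftrightarrow> hitting_cdf M (word_cyl w) t > 1 - exp (- t) + \<delta>"

text \<open>
  The groups are bounded by the powers of \<open>\<rho> = 1 / (1 + \<eta>)\<close> times \<open>\<theta>\<close>, and the share of a
  group is bounded by a multiple of its probabilities, so that a geometric series bounds the sum. The lower bound
  \<open>\<theta> * \<rho> ^ I\<close> makes one bound on the dependence on the past suffice for all groups.
\<close>

lemma sum_buckets: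
  fixes D :: "'p list" and s L I :: nat and t \<delta> \<eta> \<theta> \<kappa> :: real
  defines "C \<equiv> exp (4 * t / \<eta> + 1)" and "\<rho> \<equiv> 1 / (1 + \<eta>)"
  assumes pos: "t > 0" "\<delta> > 0" "0 < \<eta>" "\<eta> \<le> 1" "6 * \<eta> * (t + 1) \<le> \<delta>" "\<theta> > 0" "2 * \<theta> \<le> \<eta>" "I > 0"
    and no_return: "\<not> short_return D s" and D: "prb D > 0"
    and \<kappa>: "12 * C\<^sup>2 * \<kappa> * t \<le> \<eta>\<^sup>2 * (\<theta> * \<rho> ^ I)"
      "t / (prb D * (\<theta> * \<rho> ^ I)) \<le> real L" "\<And>F. F \<in> words s \<Longrightarrow> past_dep L D F \<le> \<kappa> * prb D"
  shows "(\<Sum>F | F \<in> words s \<and> \<theta> * \<rho> ^ I \<le> cnd D F \<and> cnd D F \<le> \<theta> \<and> bad t \<delta> (D @ F). cnd D F)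
     \<le> 4 * C\<^sup>2 * \<theta> / (\<eta>\<^sup>2 * \<delta>)"
proof -
  have \<rho>: "0 < \<rho>" "\<rho> < 1" using pos by (auto simp: \<rho>_def)
  have \<rho>\<eta>: "(1 + \<eta>) * \<rho> = 1" using pos by (simp add: \<rho>_def)
  define G where "G i = {F. F \<in> words s \<and> \<theta> * \<rho> ^ Suc i \<le> cnd D F \<and> cnd D F \<le> (1 + \<eta>) * (\<theta> * \<rho> ^ Suc i) \<and> bad t \<delta> (D @ F)}" for i
  have shrink: "(1 + \<eta>) * (\<theta> * \<rho> ^ Suc i) = \<theta> * \<rho> ^ i" for i
    using \<rho>\<eta> by (simp add: mult.left_commute[of _ \<theta>] mult.assoc[symmetric])
  have each: "(\<Sum>F\<in>G i. cnd D F) \<le> 2 * C\<^sup>2 * \<theta> / (\<eta> * \<delta>) * \<rho> ^ i" if i: "i < I" for i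
  proof -
    define qs where "qs = \<theta> * \<rho> ^ Suc i"
    have qs0: "qs > 0" using pos \<rho> by (simp add: qs_def)
    have low: "\<theta> * \<rho> ^ I \<le> qs"
      unfolding qs_def using i pos \<rho> by (intro mult_left_mono power_decreasing) auto
    have "\<theta> * \<rho> ^ i \<le> \<theta>" using pos \<rho> by (simp add: mult_left_le power_le_one)
    then have small: "2 * ((1 + \<eta>) * qs) \<le> \<eta>" unfolding qs_def shrink using pos(7) by linarith
    have \<kappa>': "12 * C\<^sup>2 * \<kappa> * t \<le> \<eta>\<^sup>2 * qs"
      by (rule order_trans[OF \<kappa>(1)]) (use low in \<open>simp add: mult_left_mono\<close>)
    have "t / (prb D * qs) \<le> t / (prb D * (\<theta> * \<rho> ^ I))"
      using low pos \<rho> D qs0 by (intro divide_left_mono mult_left_mono) auto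
    then have "t / (prb D * qs) \<le> real L" using \<kappa>(2) by simp
    then have "nat \<lfloor>t / (prb D * qs)\<rfloor> \<le> L" by linarith
    then have "past_dep (nat \<lfloor>t / (prb D * qs)\<rfloor>) D F \<le> \<kappa> * prb D" if "F \<in> words s" for F
      using past_dep_mono \<kappa>(3)[OF that] order_trans by blast
    from bucket_small[OF pos(1-5) qs0 small no_return D \<kappa>'[unfolded C_def] this]
    have "(\<Sum>F\<in>G i. cnd D F) \<le> 2 * C\<^sup>2 * ((1 + \<eta>) * qs) / (\<eta> * \<delta>)"
      by (simp add: G_def qs_def bad_def C_def)
    then show ?thesis unfolding qs_def shrink by simp
  qed
  have "(\<Sum>F | F \<in> words s \<and> \<theta> * \<rho> ^ I \<le> cnd D F \<and> cnd D F \<le> \<theta> \<and> bad t \<delta> (D @ F). cnd D F)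
     \<le> (\<Sum>F\<in>(\<Union>i<I. G i). cnd D F)"
  proof (rule sum_mono2)
    show "finite (\<Union>i<I. G i)" by (auto simp: G_def)
    show "{F \<in> words s. \<theta> * \<rho> ^ I \<le> cnd D F \<and> cnd D F \<le> \<theta> \<and> bad t \<delta> (D @ F)} \<subseteq> (\<Union>i<I. G i)"
    proof
      fix F assume F: "F \<in> {F \<in> words s. \<theta> * \<rho> ^ I \<le> cnd D F \<and> cnd D F \<le> \<theta> \<and> bad t \<delta> (D @ F)}"
      then obtain i where "i < I" "\<theta> * \<rho> ^ Suc i \<le> cnd D F" "cnd D F \<le> \<theta> * \<rho> ^ i"
        using geometric_bucket[OF \<rho>, of \<theta> I "cnd D F"] pos(8) by auto
      then show "F \<in> (\<Union>i<I. G i)" using F unfolding G_def shrink by blast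
    qed
  qed auto
  also have "\<dots> \<le> (\<Sum>i<I. \<Sum>F\<in>G i. cnd D F)"
    by (rule sum_UNION_le) (auto simp: G_def)
  also have "\<dots> \<le> (\<Sum>i<I. 2 * C\<^sup>2 * \<theta> / (\<eta> * \<delta>) * \<rho> ^ i)"
    by (intro sum_mono each) auto
  also have "\<dots> = 2 * C\<^sup>2 * \<theta> / (\<eta> * \<delta>) * (\<Sum>i<I. \<rho> ^ i)" by (simp add: sum_distrib_left)
  also have "\<dots> \<le> 2 * C\<^sup>2 * \<theta> / (\<eta> * \<delta>) * (2 / \<eta>)"
  proof (rule mult_left_mono)
    have "(\<Sum>i<I. \<rho> ^ i) = (1 - \<rho> ^ I) / (1 - \<rho>)" using \<rho> by (simp add: sum_gp_strict)
    also have "\<dots> \<le> 1 / (1 - \<rho>)" using \<rho> by (intro divide_right_mono) auto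
    also have "\<dots> = (1 + \<eta>) / \<eta>" using pos by (simp add: \<rho>_def field_simps)
    also have "\<dots> \<le> 2 / \<eta>" using pos by (intro divide_right_mono) auto
    finally show "(\<Sum>i<I. \<rho> ^ i) \<le> 2 / \<eta>" .
  qed (use pos in simp)
  also have "2 * C\<^sup>2 * \<theta> / (\<eta> * \<delta>) * (2 / \<eta>) = 4 * C\<^sup>2 * \<theta> / (\<eta>\<^sup>2 * \<delta>)"
    by (simp add: power2_eq_square mult_ac)
  finally show ?thesis .
qed

end

context stationary_process begin

lemma cylinder_cdf_bad: "cylinder_cdf M x n t > 1 - exp (- t) + \<delta> \<longleftrightarrow> bad t \<delta> (block x n)"
  by (simp add: cylinder_cdf_def bad_def cylinder_eq_word_cyl)

text \<open>
  The constants are chosen in the following order: \<open>\<eta>\<close> for the width of the groups, \<open>\<theta>\<close> for the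
  largest admissible conditional probability, \<open>s\<close> such that most conditional probabilities of words
  of length \<open>s\<close> are below \<open>\<theta>\<close>, \<open>I\<close> such that probabilities below \<open>ql = \<theta> * \<rho> ^ Suc I\<close> are
  negligible in total, \<open>\<kappa>\<close> for the dependence on the past, and last the length \<open>n\<close>. A bad word
  \<open>D @ F\<close> falls into one of five classes, each of measure at most \<open>\<epsilon>\<close>: \<open>D\<close> has a short return; the
  word after \<open>D\<close> depends too much on the past; \<open>F\<close> has conditional probability below \<open>ql\<close>, or
  above \<open>\<theta>\<close>, or in between, where \<open>sum_buckets\<close> applies.
\<close>

lemma bad_cylinders_rare:
  assumes erg: "ergodic_map M left_shift" and ent: "process_entropy M > 0"
    and pos: "t > 0" "\<delta> > 0" "\<epsilon> > 0"
  shows "\<exists>n0. \<forall>n\<ge>n0. measure M {x. cylinder_cdf M x n t > 1 - exp (- t) + \<delta>} \<le> 5 * \<epsilon>"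
proof -
  define \<eta> where "\<eta> = min 1 (\<delta> / (6 * (t + 1)))"
  have \<eta>: "0 < \<eta>" "\<eta> \<le> 1" "6 * \<eta> * (t + 1) \<le> \<delta>"
  proof -
    have "\<eta> \<le> \<delta> / (6 * (t + 1))" by (simp add: \<eta>_def)
    then show "6 * \<eta> * (t + 1) \<le> \<delta>" using pos by (simp add: field_simps)
  qed (use pos in \<open>auto simp: \<eta>_def\<close>)
  define C where "C = exp (4 * t / \<eta> + 1)"
  have C: "C > 0" by (simp add: C_def)
  define \<theta> where "\<theta> = min (\<eta> / 2) (\<epsilon> * \<eta>\<^sup>2 * \<delta> / (4 * C\<^sup>2))"
  have \<theta>: "\<theta> > 0" "2 * \<theta> \<le> \<eta>" using \<eta> pos C by (auto simp: \<theta>_def)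
  have \<theta>\<epsilon>: "4 * C\<^sup>2 * \<theta> / (\<eta>\<^sup>2 * \<delta>) \<le> \<epsilon>"
  proof -
    have "\<theta> \<le> \<epsilon> * \<eta>\<^sup>2 * \<delta> / (4 * C\<^sup>2)" by (simp add: \<theta>_def)
    then show ?thesis using \<eta> pos C by (simp add: field_simps)
  qed
  define \<rho> where "\<rho> = 1 / (1 + \<eta>)"
  have \<rho>: "0 < \<rho>" "\<rho> < 1" using \<eta> by (auto simp: \<rho>_def)
  from mean_cnd_vanishes[OF erg ent, of "\<epsilon> * \<theta>"] pos \<theta> obtain s where
    s: "\<And>n. mean_cnd n s \<le> \<epsilon> * \<theta>" by auto
  define m where "m = real (card (words s :: 'p list set))"
  have m: "m > 0" unfolding m_def card_words by simp
  have "(\<lambda>I. \<theta> * \<rho> ^ I) \<longlonglongrightarrow> \<theta> * 0"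
    using \<rho> by (intro tendsto_mult_left LIMSEQ_realpow_zero) auto
  moreover have "\<theta> * 0 < \<epsilon> / m" using pos m by simp
  ultimately have "\<forall>\<^sub>F I in sequentially. \<theta> * \<rho> ^ I < \<epsilon> / m"
    by (rule order_tendstoD(2))
  then obtain I where I: "\<And>i. i \<ge> I \<Longrightarrow> \<theta> * \<rho> ^ i < \<epsilon> / m"
    unfolding eventually_sequentially by blast
  have qmin: "\<theta> * \<rho> ^ Suc I < \<epsilon> / m" by (rule I) simp
  define ql where "ql = \<theta> * \<rho> ^ Suc I"
  have ql: "ql > 0" using \<theta> \<rho> by (simp add: ql_def)
  define \<kappa> where "\<kappa> = \<eta>\<^sup>2 * ql / (12 * C\<^sup>2 * t)"
  have \<kappa>: "\<kappa> > 0" using \<eta> ql C pos by (simp add: \<kappa>_def)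
  have \<kappa>C: "12 * C\<^sup>2 * \<kappa> * t \<le> \<eta>\<^sup>2 * ql" using C pos by (simp add: \<kappa>_def)
  from past_dep_vanishes[of "\<kappa> * \<epsilon> / m" s] obtain d1 where
    d1: "\<And>d l F. d \<ge> d1 \<Longrightarrow> F \<in> words s \<Longrightarrow> (\<Sum>D\<in>words d. past_dep l D F) \<le> \<kappa> * \<epsilon> / m"
    using \<kappa> pos m by auto
  from short_return_negligible[OF erg ent pos(3), of s] obtain d2 where
    d2: "\<And>d. d \<ge> d2 \<Longrightarrow> (\<Sum>D | D \<in> words d \<and> short_return D s. prb D) \<le> \<epsilon>" by blast

  have "measure M {x. cylinder_cdf M x n t > 1 - exp (- t) + \<delta>} \<le> 5 * \<epsilon>" if n: "n \<ge> max d1 d2 + s" for n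
  proof -
    define d where "d = n - s"
    have d: "n = d + s" "d \<ge> d1" "d \<ge> d2" using n by (auto simp: d_def)
    define \<tau> where "\<tau> D = t / (prb D * ql)" for D
    \<comment> \<open>One time horizon that suffices for all \<open>D\<close> and all groups.\<close>
    define L where "L = nat \<lceil>\<Sum>D\<in>words d. \<bar>\<tau> D\<bar>\<rceil>"
    have L: "\<tau> D \<le> real L" if "D \<in> words d" for D
    proof -
      have "\<bar>\<tau> D\<bar> \<le> (\<Sum>D\<in>words d. \<bar>\<tau> D\<bar>)" using that by (intro member_le_sum) auto
      also have "\<dots> \<le> real L" unfolding L_def by (rule real_nat_ceiling_ge)
      finally show ?thesis by simp
    qed
    define dep where "dep D \<longleftrightarrow> (\<exists>F\<in>words s. past_dep L D F > \<kappa> * prb D)" for D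
    let ?X = "\<lambda>D F. bad t \<delta> (D @ F)"
    have per_D: "prb D * (\<Sum>F\<in>words s. cnd D F * of_bool (?X D F)) \<le>
      prb D * of_bool (short_return D s) + prb D * of_bool (dep D) + prb D * \<epsilon>
        + prb D * ((\<Sum>F\<in>words s. (cnd D F)\<^sup>2) / \<theta>) + prb D * \<epsilon>" if D: "D \<in> words d" for D
    proof (cases "prb D = 0")
      case False
      then have D0: "prb D > 0" by (simp add: less_le)
      let ?sq = "(\<Sum>F\<in>words s. (cnd D F)\<^sup>2) / \<theta>"
      have sq0: "?sq \<ge> 0" using \<theta> by (intro divide_nonneg_pos sum_nonneg) auto
      have "(\<Sum>F\<in>words s. cnd D F * of_bool (?X D F)) \<le> of_bool (short_return D s) + of_bool (dep D) + \<epsilon> + ?sq + \<epsilon>"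
      proof (cases "short_return D s \<or> dep D")
        case True
        have "(\<Sum>F\<in>words s. cnd D F * of_bool (?X D F)) \<le> (\<Sum>F\<in>words s. cnd D F)"
          by (intro sum_mono) auto
        also have "\<dots> \<le> 1" by (rule sum_cnd_le_1)
        finally show ?thesis using True sq0 pos by auto
      next
        case good: False
        have split: "cnd D F * of_bool (?X D F) \<le> ql + (cnd D F)\<^sup>2 / \<theta> +
            (if ql \<le> cnd D F \<and> cnd D F \<le> \<theta> \<and> ?X D F then cnd D F else 0)" for F
        proof -
          have sq: "0 \<le> (cnd D F)\<^sup>2 / \<theta>" using \<theta> by simp
          have "cnd D F \<le> (cnd D F)\<^sup>2 / \<theta>" if "cnd D F > \<theta>"
          proof -
            have "cnd D F * \<theta> \<le> cnd D F * cnd D F" using that by (intro mult_left_mono) auto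
            then show ?thesis using \<theta> by (simp add: pos_le_divide_eq power2_eq_square)
          qed
          moreover have "cnd D F * of_bool (?X D F) \<le> cnd D F" by simp
          ultimately show ?thesis
            using ql sq by (cases "cnd D F > \<theta>"; cases "ql \<le> cnd D F"; cases "?X D F") auto
        qed
        have "(\<Sum>F\<in>words s. cnd D F * of_bool (?X D F)) \<le> (\<Sum>F\<in>words s. ql + (cnd D F)\<^sup>2 / \<theta> +
            (if ql \<le> cnd D F \<and> cnd D F \<le> \<theta> \<and> ?X D F then cnd D F else 0))"
          by (intro sum_mono split)
        also have "\<dots> = m * ql + ?sq +
            (\<Sum>F | F \<in> words s \<and> ql \<le> cnd D F \<and> cnd D F \<le> \<theta> \<and> ?X D F. cnd D F)"
          by (simp add: sum.distrib m_def sum_divide_distrib sum.inter_filter[symmetric] Int_def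
              flip: sum.inter_filter)
        also have "m * ql \<le> \<epsilon>" using qmin m by (simp add: ql_def field_simps)
        also have "(\<Sum>F | F \<in> words s \<and> ql \<le> cnd D F \<and> cnd D F \<le> \<theta> \<and> ?X D F. cnd D F) \<le> 4 * C\<^sup>2 * \<theta> / (\<eta>\<^sup>2 * \<delta>)"
          unfolding ql_def C_def \<rho>_def
        proof (rule sum_buckets)
          show "past_dep L D F \<le> \<kappa> * prb D" if "F \<in> words s" for F
            using good that by (auto simp: dep_def not_less)
          show "t / (prb D * (\<theta> * (1 / (1 + \<eta>)) ^ Suc I)) \<le> real L"
            using L[OF D] by (simp add: \<tau>_def ql_def \<rho>_def)
          show "12 * (exp (4 * t / \<eta> + 1))\<^sup>2 * \<kappa> * t \<le> \<eta>\<^sup>2 * (\<theta> * (1 / (1 + \<eta>)) ^ Suc I)"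
            using \<kappa>C by (simp add: C_def ql_def \<rho>_def)
        qed (use pos \<eta> \<theta> good D0 in auto)
        also note \<theta>\<epsilon>
        finally show ?thesis using good by simp
      qed
      then have "prb D * (\<Sum>F\<in>words s. cnd D F * of_bool (?X D F)) \<le>
         prb D * (of_bool (short_return D s) + of_bool (dep D) + \<epsilon> + ?sq + \<epsilon>)"
        by (intro mult_left_mono) auto
      then show ?thesis by (simp add: algebra_simps)
    qed simp
    have "measure M {x. cylinder_cdf M x n t > 1 - exp (- t) + \<delta>} = (\<Sum>w | w \<in> words n \<and> bad t \<delta> w. prb w)"
      unfolding cylinder_cdf_bad by (rule measure_block)
    also have "\<dots> = (\<Sum>w\<in>words n. prb w * of_bool (bad t \<delta> w))"
      by (simp add: of_bool_def if_distrib sum.inter_filter cong: if_cong)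
    also have "\<dots> = (\<Sum>D\<in>words d. prb D * (\<Sum>F\<in>words s. cnd D F * of_bool (?X D F)))"
      unfolding d(1) sum_words_add by (simp only: prb_append sum_distrib_left mult.assoc)
    also have "\<dots> \<le> (\<Sum>D\<in>words d. prb D * of_bool (short_return D s) + prb D * of_bool (dep D) + prb D * \<epsilon>
        + prb D * ((\<Sum>F\<in>words s. (cnd D F)\<^sup>2) / \<theta>) + prb D * \<epsilon>)"
      by (intro sum_mono per_D)
    also have "\<dots> = (\<Sum>D\<in>words d. prb D * of_bool (short_return D s)) + (\<Sum>D\<in>words d. prb D * of_bool (dep D))
        + \<epsilon> + mean_cnd d s / \<theta> + \<epsilon>"
    proof -
      have "(\<Sum>D\<in>words d. prb D * \<epsilon>) = \<epsilon>" by (simp add: sum_distrib_right[symmetric] sum_prb_words)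
      moreover have "(\<Sum>D\<in>words d. prb D * ((\<Sum>F\<in>words s. (cnd D F)\<^sup>2) / \<theta>)) = mean_cnd d s / \<theta>"
        by (simp add: mean_cnd_alt prb_append power2_eq_square sum_distrib_left sum_divide_distrib mult.assoc)
      ultimately show ?thesis by (simp only: sum.distrib)
    qed
    also have "(\<Sum>D\<in>words d. prb D * of_bool (short_return D s)) \<le> \<epsilon>"
      using d2[OF d(3)] by (simp add: of_bool_def if_distrib sum.inter_filter cong: if_cong)
    also have "(\<Sum>D\<in>words d. prb D * of_bool (dep D)) \<le> \<epsilon>"
    proof -
      have "prb D * of_bool (dep D) \<le> (\<Sum>F\<in>words s. past_dep L D F / \<kappa>)" for D
      proof (cases "dep D")
        case True
        then obtain F where F: "F \<in> words s" "past_dep L D F > \<kappa> * prb D" by (auto simp: dep_def)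
        have "prb D \<le> past_dep L D F / \<kappa>" using F \<kappa> by (simp add: pos_le_divide_eq mult.commute)
        also have "\<dots> \<le> (\<Sum>F\<in>words s. past_dep L D F / \<kappa>)"
          using F \<kappa> past_dep_nonneg by (intro member_le_sum) auto
        finally show ?thesis using True by simp
      qed (use \<kappa> past_dep_nonneg in \<open>auto intro!: sum_nonneg\<close>)
      then have "(\<Sum>D\<in>words d. prb D * of_bool (dep D)) \<le> (\<Sum>D\<in>words d. \<Sum>F\<in>words s. past_dep L D F / \<kappa>)"
        by (intro sum_mono)
      also have "\<dots> = (\<Sum>F\<in>words s. (\<Sum>D\<in>words d. past_dep L D F) / \<kappa>)"
        by (subst sum.swap) (simp add: sum_divide_distrib)
      also have "\<dots> \<le> (\<Sum>F\<in>(words s :: 'p list set). (\<kappa> * \<epsilon> / m) / \<kappa>)"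
        using \<kappa> by (intro sum_mono divide_right_mono d1[OF d(2)]) auto
      also have "\<dots> = \<epsilon>" using \<kappa> m by (simp flip: m_def)
      finally show ?thesis .
    qed
    also have "mean_cnd d s / \<theta> \<le> \<epsilon>" using s[of d] \<theta> by (simp add: pos_divide_le_eq)
    finally show ?thesis by simp
  qed
  then show ?thesis by blast
qed

lemma bad_sets: "{x. cylinder_cdf M x n t > c} \<in> sets M"
proof -
  have "{x. cylinder_cdf M x n t > c} = (\<lambda>x. block x n) -` {w. hitting_cdf M (word_cyl w) t > c} \<inter> space M"
    by (auto simp: cylinder_cdf_def cylinder_eq_word_cyl)
  also have "\<dots> \<in> sets M" by (rule measurable_sets[OF measurable_block]) auto
  finally show ?thesis .
qed

lemma bad_cylinders_vanish:
  assumes "ergodic_map M left_shift" "process_entropy M > 0" "t > 0" "\<delta> > 0"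
  shows "(\<lambda>n. measure M {x. cylinder_cdf M x n t > 1 - exp (- t) + \<delta>}) \<longlonglongrightarrow> 0"
proof (rule LIMSEQ_I)
  fix e :: real assume e: "e > 0"
  from bad_cylinders_rare[OF assms, of "e / 10"] e obtain n0 where
    n0: "\<And>n. n \<ge> n0 \<Longrightarrow> measure M {x. cylinder_cdf M x n t > 1 - exp (- t) + \<delta>} \<le> 5 * (e / 10)" by auto
  have "norm (measure M {x. cylinder_cdf M x n t > 1 - exp (- t) + \<delta>} - 0) < e" if "n \<ge> n0" for n
    using n0[OF that] e by simp
  then show "\<exists>n0. \<forall>n\<ge>n0. norm (measure M {x. cylinder_cdf M x n t > 1 - exp (- t) + \<delta>} - 0) < e" by blast
qed

end

section \<open>Almost every point\<close>

text \<open>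
  Passes from rational to real times by continuity from the right.
\<close>

lemma le_one_minus_exp_of_rat:
  fixes a :: ereal and t :: real
  assumes le: "\<And>q :: rat. t < of_rat q \<Longrightarrow> a \<le> ereal (1 - exp (- of_rat q))"
  shows "a \<le> ereal (1 - exp (- t))"
proof (rule ccontr)
  assume "\<not> ?thesis"
  then have less: "ereal (1 - exp (- t)) < a" by simp
  obtain b where b: "t < b" "ereal (1 - exp (- b)) < a"
  proof (cases a)
    case (real r)
    with less have r: "1 - r < exp (- t)" by simp
    show thesis
    proof (cases "r < 1")
      case True
      define u where "u = - ln (1 - r)"
      have "exp (- u) = 1 - r" using True by (simp add: u_def)
      moreover from this r have "t < u" by (metis exp_less_cancel_iff neg_less_iff_less)
      then obtain b where "t < b" "b < u" using dense by blast
      ultimately have "1 - r < exp (- b)" by (metis exp_less_cancel_iff neg_less_iff_less)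
      then show thesis using that[of b] \<open>t < b\<close> real by simp
    next
      case False
      then have "1 - exp (- (t + 1)) < r" using exp_gt_zero[of "- (t + 1)"] by linarith
      then show thesis using that[of "t + 1"] real by simp
    qed
  next
    case PInf
    then show thesis using that[of "t + 1"] by simp
  next
    case MInf
    then show thesis using less by simp
  qed
  obtain q :: rat where q: "t < of_rat q" "of_rat q < b" using of_rat_dense[OF b(1)] by blast
  have "a \<le> ereal (1 - exp (- of_rat q))" by (rule le[OF q(1)])
  also have "\<dots> \<le> ereal (1 - exp (- b))" using q(2) by simp
  finally show False using b(2) by simp
qed

context stationary_process begin

lemma cylinder_cdf_mono:
  assumes "t \<le> t'"
  shows "cylinder_cdf M x n t \<le> cylinder_cdf M x n t'"
proof -
  have meas: "{y \<in> space M. norm_hitting_time M B y \<le> ereal c} \<in> sets M" if "B = cylinder x n" for B c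
  proof -
    have [measurable]: "B \<in> sets M" using that by (simp add: cylinder_eq_word_cyl)
    have ht: "hitting_time B \<in> M \<rightarrow>\<^sub>M count_space UNIV"
    proof -
      have "hitting_time B = (\<lambda>y. INF i. if 0 < i \<and> shift (int i) y \<in> B then enat i else top)"
        unfolding hitting_time_def[abs_def] left_shift_funpow
      proof (intro ext antisym INF_greatest)
        fix y :: "int \<Rightarrow> 'p" and i :: nat
        show "(INF i\<in>{i. 0 < i \<and> shift (int i) y \<in> B}. enat i) \<le>
            (if 0 < i \<and> shift (int i) y \<in> B then enat i else top)"
          by (auto intro: INF_lower)
        assume "i \<in> {i. 0 < i \<and> shift (int i) y \<in> B}"
        then show "(INF i. if 0 < i \<and> shift (int i) y \<in> B then enat i else top) \<le> enat i"
          by (intro INF_lower2[of i]) auto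
      qed
      also have "\<dots> \<in> M \<rightarrow>\<^sub>M count_space UNIV"
        by (intro measurable_INF) (simp, measurable)
      finally show ?thesis .
    qed
    have "{y \<in> space M. norm_hitting_time M B y \<le> ereal c} =
       hitting_time B -` {h. ereal (measure M B) * ereal_of_enat h \<le> ereal c} \<inter> space M"
      by (auto simp: norm_hitting_time_def)
    also have "\<dots> \<in> sets M" by (rule measurable_sets[OF ht]) simp
    finally show ?thesis .
  qed
  show ?thesis
    unfolding cylinder_cdf_def hitting_cdf_def using assms
    by (intro finite_measure_mono meas) (auto intro: order_trans)
qed

text \<open>
  Where the limit exceeds the bound by \<open>\<delta>\<close>, the cylinders are bad for all late \<open>k\<close>, and an
  intersection of sets whose measures tend to 0 is a null set.
\<close>

lemma AE_limit_bound:
  assumes erg: "ergodic_map M left_shift" and ent: "process_entropy M > 0"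
    and n: "strict_mono n"
    and lim: "\<And>x t. x \<in> A \<Longrightarrow> t \<ge> 0 \<Longrightarrow> (\<lambda>k. cylinder_cdf M x (n k) t) \<longlonglongrightarrow> F x t"
  shows "AE x in M. x \<in> A \<longrightarrow> (\<forall>t\<ge>0. F x t \<le> 1 - exp (- t))"
proof -
  have each: "AE x in M. x \<in> A \<longrightarrow> F x t \<le> 1 - exp (- t) + \<delta>" if "t > 0" "\<delta> > 0" for t \<delta>
  proof -
    define E where "E k = {x. cylinder_cdf M x (n k) t > 1 - exp (- t) + \<delta>}" for k
    have E: "E k \<in> sets M" for k unfolding E_def by (rule bad_sets)
    have E_lim: "(\<lambda>k. measure M (E k)) \<longlonglongrightarrow> 0"
      using LIMSEQ_subseq_LIMSEQ[OF bad_cylinders_vanish[OF erg ent that] n] by (simp add: E_def comp_def)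
    have "measure M (\<Inter>k\<in>{j..}. E k) = 0" for j
    proof -
      have "measure M (\<Inter>k\<in>{j..}. E k) \<le> measure M (E i)" if "i \<ge> j" for i
        using that E by (intro finite_measure_mono) auto
      then have "measure M (\<Inter>k\<in>{j..}. E k) \<le> 0"
        by (intro LIMSEQ_le_const[OF E_lim]) auto
      then show ?thesis by (simp add: measure_le_0_iff)
    qed
    then have "(\<Inter>k\<in>{j..}. E k) \<in> null_sets M" for j
      using E by (intro null_setsI) (auto simp: emeasure_eq_measure intro!: sets.countable_INT'')
    then have "AE x in M. \<forall>j::nat. x \<notin> (\<Inter>k\<in>{j..}. E k)"
      by (subst AE_all_countable) (intro allI AE_not_in)
    then show ?thesis
    proof eventually_elim
      case (elim x)
      show ?case
      proof
        assume x: "x \<in> A"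
        show "F x t \<le> 1 - exp (- t) + \<delta>"
        proof (rule ccontr)
          assume "\<not> ?thesis"
          then have "\<forall>\<^sub>F k in sequentially. cylinder_cdf M x (n k) t > 1 - exp (- t) + \<delta>"
            using lim[OF x, of t] that by (intro order_tendstoD(1)) auto
          then show False using elim by (auto simp: eventually_sequentially E_def)
        qed
      qed
    qed
  qed
  have "AE x in M. \<forall>q::rat. \<forall>k::nat. q > 0 \<longrightarrow> x \<in> A \<longrightarrow> F x (of_rat q) \<le> 1 - exp (- of_rat q) + 1 / real (Suc k)"
    unfolding AE_all_countable using each by (auto simp del: of_nat_Suc)
  then show ?thesis
  proof eventually_elim
    case (elim x)
    show ?case
    proof (intro impI allI)
      fix t :: real assume x: "x \<in> A" and t: "0 \<le> t"
      have "ereal (F x t) \<le> ereal (1 - exp (- t))"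
      proof (rule le_one_minus_exp_of_rat)
        fix q :: rat assume q: "t < of_rat q"
        have "0 < (of_rat q :: real)" by (rule le_less_trans[OF t q])
        then have q0: "q > 0" by simp
        have "F x t \<le> F x (of_rat q)"
          using q t less_imp_le[OF q0] by (intro LIMSEQ_le[OF lim[OF x t] lim[OF x, of "of_rat q"]]) (auto intro!: cylinder_cdf_mono)
        also have "F x (of_rat q) \<le> 1 - exp (- of_rat q)"
        proof (rule field_le_epsilon)
          fix e :: real assume "e > 0"
          then obtain k where "1 / real (Suc k) < e" using nat_approx_posE by blast
          then show "F x (of_rat q) \<le> 1 - exp (- of_rat q) + e"
            using elim q0 x by (meson add_left_mono less_imp_le order_trans)
        qed
        finally show "ereal (F x t) \<le> ereal (1 - exp (- of_rat q))" by simp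
      qed
      then show "F x t \<le> 1 - exp (- t)" by simp
    qed
  qed
qed

text \<open>
  The lengths are chosen such that at stage \<open>k\<close> the cylinders that are bad at one of the first \<open>k\<close>
  rational times with excess \<open>1 / Suc k\<close> have summable measures.
\<close>

lemma AE_limsup_bound_fast:
  assumes erg: "ergodic_map M left_shift" and ent: "process_entropy M > 0"
  shows "\<exists>m :: nat \<Rightarrow> nat. \<forall>n :: nat \<Rightarrow> nat. (\<forall>k. m k \<le> n k) \<longrightarrow>
        (AE x in M. \<forall>t\<ge>0. limsup (\<lambda>k. ereal (cylinder_cdf M x (n k) t)) \<le> ereal (1 - exp (- t)))"
proof -
  define E where "E k q n = {x. cylinder_cdf M x n (of_rat q) > 1 - exp (- of_rat q) + 1 / real (Suc k)}"
    for k n and q :: rat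
  have E [measurable]: "E k q n \<in> sets M" for k q n unfolding E_def by (rule bad_sets)
  have "\<exists>m. \<forall>n\<ge>m. \<forall>q\<in>from_nat ` {..k}. q > 0 \<longrightarrow> measure M (E k q n) < (1 / 2) ^ k" for k
  proof -
    have "\<forall>\<^sub>F n in sequentially. q > 0 \<longrightarrow> measure M (E k q n) < (1 / 2) ^ k" for q
    proof (cases "q > 0")
      case True
      then have "(\<lambda>n. measure M (E k q n)) \<longlonglongrightarrow> 0"
        unfolding E_def by (intro bad_cylinders_vanish[OF erg ent]) auto
      then have "\<forall>\<^sub>F n in sequentially. measure M (E k q n) < (1 / 2) ^ k"
        by (rule order_tendstoD(2)) simp
      then show ?thesis by eventually_elim simp
    qed simp
    then have "\<forall>\<^sub>F n in sequentially. \<forall>q\<in>from_nat ` {..k}. q > 0 \<longrightarrow> measure M (E k q n) < (1 / 2) ^ k"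
      by (intro eventually_ball_finite) auto
    then show ?thesis unfolding eventually_sequentially .
  qed
  then obtain m where m: "\<And>k n q. n \<ge> m k \<Longrightarrow> q \<in> from_nat ` {..k} \<Longrightarrow> q > 0 \<Longrightarrow> measure M (E k q n) < (1 / 2) ^ k"
    by metis
  have "AE x in M. \<forall>t\<ge>0. limsup (\<lambda>k. ereal (cylinder_cdf M x (n k) t)) \<le> ereal (1 - exp (- t))"
    if n: "\<forall>k. m k \<le> n k" for n
  proof -
    have "AE x in M. \<forall>\<^sub>F k in sequentially. x \<notin> E k q (n k)" if q: "q > 0" for q
    proof -
      have q': "q \<in> from_nat ` {..k}" if "k \<ge> to_nat q" for k
        using that by (intro image_eqI[of _ _ "to_nat q"]) auto
      have "AE x in M. \<forall>\<^sub>F k in sequentially. x \<in> space M - E k q (n k)"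
      proof (rule borel_cantelli_AE1)
        show "summable (\<lambda>k. measure M (E k q (n k)))"
        proof (rule summable_comparison_test')
          show "summable (\<lambda>k. (1 / 2 :: real) ^ k)" by (rule summable_geometric) simp
          show "norm (measure M (E k q (n k))) \<le> (1 / 2) ^ k" if "k \<ge> to_nat q" for k
            using m[OF n[rule_format] q'[OF that] q] by simp
        qed
      qed (auto simp: emeasure_eq_measure)
      then show ?thesis by eventually_elim (auto elim: eventually_mono)
    qed
    then have "AE x in M. \<forall>q::rat. q > 0 \<longrightarrow> (\<forall>\<^sub>F k in sequentially. x \<notin> E k q (n k))"
      unfolding AE_all_countable by auto
    then show ?thesis
    proof eventually_elim
      case (elim x)
      show ?case
      proof (intro allI impI)
        fix t :: real assume t: "0 \<le> t"
        show "limsup (\<lambda>k. ereal (cylinder_cdf M x (n k) t)) \<le> ereal (1 - exp (- t))"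
        proof (rule le_one_minus_exp_of_rat)
          fix q :: rat assume q: "t < of_rat q"
          have "0 < (of_rat q :: real)" by (rule le_less_trans[OF t q])
          then have q0: "q > 0" by simp
          have "limsup (\<lambda>k. ereal (cylinder_cdf M x (n k) t)) \<le>
              limsup (\<lambda>k. ereal (1 - exp (- of_rat q) + 1 / real (Suc k)))"
          proof (rule Limsup_mono)
            show "\<forall>\<^sub>F k in sequentially. ereal (cylinder_cdf M x (n k) t) \<le> ereal (1 - exp (- of_rat q) + 1 / real (Suc k))"
              using elim[rule_format, OF q0]
            proof eventually_elim
              case (elim k)
              then show ?case
                using cylinder_cdf_mono[OF less_imp_le[OF q], of x "n k"] by (simp add: E_def)
            qed
          qed
          also have "\<dots> = ereal (1 - exp (- of_rat q))"
          proof (rule lim_imp_Limsup)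
            have "(\<lambda>k. 1 / real (Suc k)) \<longlonglongrightarrow> 0"
              using LIMSEQ_inverse_real_of_nat by (simp add: inverse_eq_divide)
            then have "(\<lambda>k. 1 - exp (- of_rat q) + 1 / real (Suc k)) \<longlonglongrightarrow> 1 - exp (- of_rat q) + 0"
              by (intro tendsto_intros)
            then show "(\<lambda>k. ereal (1 - exp (- of_rat q) + 1 / real (Suc k))) \<longlonglongrightarrow> ereal (1 - exp (- of_rat q))"
              by simp
          qed simp
          finally show "limsup (\<lambda>k. ereal (cylinder_cdf M x (n k) t)) \<le> ereal (1 - exp (- of_rat q))" .
        qed
      qed
    qed
  qed
  then show ?thesis by blast
qed

end

theorem theorem3:
  fixes M :: "(int \<Rightarrow> 'p::finite) measure"
  assumes "prob_space M"
    and "sets M = sets shift_borel"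
    and "ergodic_map M left_shift"
    and "process_entropy M > 0"
  shows
    "(\<forall>(n :: nat \<Rightarrow> nat) (A :: (int \<Rightarrow> 'p) set) (F :: (int \<Rightarrow> 'p) \<Rightarrow> real \<Rightarrow> real).
        strict_mono n \<and> A \<in> sets M \<and> measure M A > 0 \<and>
        (\<forall>x\<in>A. \<forall>t\<ge>0. (\<lambda>k. cylinder_cdf M x (n k) t) \<longlonglongrightarrow> F x t) \<longrightarrow>
        (AE x in M. x \<in> A \<longrightarrow> (\<forall>t\<ge>0. F x t \<le> 1 - exp (- t))))
     \<and> (\<exists>m :: nat \<Rightarrow> nat. \<forall>n :: nat \<Rightarrow> nat.
        strict_mono n \<and> (\<forall>k. m k \<le> n k) \<longrightarrow>
        (AE x in M. \<forall>t\<ge>0.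
           limsup (\<lambda>k. ereal (cylinder_cdf M x (n k) t)) \<le> ereal (1 - exp (- t))))"
proof -
  interpret stationary_process M
    using assms by (auto simp: stationary_process_def stationary_process_axioms_def ergodic_map_def)
  show ?thesis
    using AE_limit_bound[OF assms(3,4)] AE_limsup_bound_fast[OF assms(3,4)] by blast
qed

end
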